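(* Let $G$ be a tame $\ell_c$-group. A sequence $M\to N\to P$ in $\mathcal{R}(G)$ is exact if and only if the associated sequence of vector spaces $M(\pi)\to N(\pi)\to P(\pi)$ is exact for every $\pi\in\widehat{G}$.
   Context: An $\ell$-group is a Hausdorff, locally compact, totally disconnected topological group. An $\ell_c$-group is an $\ell$-group which is a filtered union of its compact open subgroups (every element lies in a compact open subgroup, and any two compact open subgroups are contained in a third). A complex representation $(\pi,V)$ of an $\ell$-group $G$ is smooth if every vector of $V$ has open stabilizer in $G$; it is admissible if in addition $V^K$ is finite-dimensional for every compact open subgroup $K \subset G$. An $\ell$-group is tame if all its irreducible smooth representations are admissible. $\mathcal{R}(G)$ is the category of smooth representations of $G$, and $\widehat{G}$ is the set of isomorphism classes of irreducible smooth representations of $G$. For $M\in\mathcal{R}(G)$ and $\pi\in\widehat{G}$ put $M_{\pi}=M/\bigcap_{f\in\operatorname{Hom}_G(M,\pi)}\ker f$, and define the stalk of $M$ at $\pi$ to be the vector space $M(\pi)=\operatorname{Hom}_G(\pi,M_{\pi})$. A morphism $M\to N$ induces $M_\pi\to N_\pi$ and hence a linear map $M(\pi)\to N(\pi)$, making $M\mapsto M(\pi)$ a functor. *)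

theory Defs
  imports
    "HOL-Analysis.Abstract_Topological_Spaces"
    "HOL-Analysis.Product_Topology"
    "HOL-Algebra.Group_Action"
    "HOL-Algebra.QuotRing"
    "HOL-Algebra.Module"
begin

section \<open>l-groups\<close>

locale topological_group = group G
  for G :: "('g, 'b) monoid_scheme" (structure) +
  fixes X :: "'g topology"
  assumes topspace_eq: "topspace X = carrier G"
    and continuous_mult: "continuous_map (prod_topology X X) X (\<lambda>(x, y). x \<otimes> y)"
    and continuous_inv: "continuous_map X X (\<lambda>x. inv x)"

definition totally_disconnected_space :: "'a topology \<Rightarrow> bool" where
  "totally_disconnected_space X \<longleftrightarrow> (\<forall>x\<in>topspace X. connected_component_of_set X x = {x})"

locale l_group = topological_group +
  assumes Hausdorff: "Hausdorff_space X"
    and locally_compact: "locally_compact_space X"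
    and totally_disconnected: "totally_disconnected_space X"

definition compact_open_subgroup :: "('g, 'b) monoid_scheme \<Rightarrow> 'g topology \<Rightarrow> 'g set \<Rightarrow> bool" where
  "compact_open_subgroup G X K \<longleftrightarrow> subgroup K G \<and> compactin X K \<and> openin X K"

locale lc_group = l_group +
  assumes covered: "\<And>g. g \<in> carrier G \<Longrightarrow> \<exists>K. compact_open_subgroup G X K \<and> g \<in> K"
    and directed: "\<And>K L. compact_open_subgroup G X K \<Longrightarrow> compact_open_subgroup G X L
      \<Longrightarrow> \<exists>H. compact_open_subgroup G X H \<and> K \<subseteq> H \<and> L \<subseteq> H"


section \<open>Smooth representations\<close>

definition complex_field :: "complex ring" where
  "complex_field = \<lparr>carrier = UNIV, mult = (*), one = 1, zero = 0, add = (+)\<rparr>"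

text \<open>
  Modules of HOL-Algebra are records extending rings, so a representation formally carries
  fields \<open>mult\<close> and \<open>one\<close>; they have no meaning here and nothing below refers to them.
\<close>

record ('g, 'v) rep = "(complex, 'v) module" +
  act :: "'g \<Rightarrow> 'v \<Rightarrow> 'v"

locale complex_rep = G?: group G + V?: Module.module complex_field V
  for G :: "('g, 'b) monoid_scheme" (structure) and V :: "('g, 'v) rep" (structure) +
  assumes act_closed: "\<And>g v. g \<in> carrier G \<Longrightarrow> v \<in> carrier V \<Longrightarrow> act V g v \<in> carrier V"
    and act_add: "\<And>g v w. g \<in> carrier G \<Longrightarrow> v \<in> carrier V \<Longrightarrow> w \<in> carrier V
      \<Longrightarrow> act V g (v \<oplus>\<^bsub>V\<^esub> w) = act V g v \<oplus>\<^bsub>V\<^esub> act V g w"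
    and act_smult: "\<And>g c v. g \<in> carrier G \<Longrightarrow> v \<in> carrier V
      \<Longrightarrow> act V g (c \<odot>\<^bsub>V\<^esub> v) = c \<odot>\<^bsub>V\<^esub> act V g v"
    and act_one: "\<And>v. v \<in> carrier V \<Longrightarrow> act V \<one>\<^bsub>G\<^esub> v = v"
    and act_mult: "\<And>g h v. g \<in> carrier G \<Longrightarrow> h \<in> carrier G \<Longrightarrow> v \<in> carrier V
      \<Longrightarrow> act V (g \<otimes>\<^bsub>G\<^esub> h) v = act V g (act V h v)"

definition smooth_rep :: "('g, 'b) monoid_scheme \<Rightarrow> 'g topology \<Rightarrow> ('g, 'v) rep \<Rightarrow> bool" where
  "smooth_rep G X V \<longleftrightarrow>
    complex_rep G V \<and> (\<forall>v\<in>carrier V. openin X (stabilizer G (act V) v))"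

definition fixed_vectors :: "('g, 'v) rep \<Rightarrow> 'g set \<Rightarrow> 'v set" where
  "fixed_vectors V K = {v \<in> carrier V. \<forall>k\<in>K. act V k v = v}"

definition finite_dimensional :: "(complex, 'v, 'z) module_scheme \<Rightarrow> 'v set \<Rightarrow> bool" where
  "finite_dimensional V W \<longleftrightarrow>
    (\<exists>B. finite B \<and> B \<subseteq> W \<and> (\<forall>w\<in>W. \<exists>c. w = (\<Oplus>\<^bsub>V\<^esub>b\<in>B. c b \<odot>\<^bsub>V\<^esub> b)))"

definition admissible_rep :: "('g, 'b) monoid_scheme \<Rightarrow> 'g topology \<Rightarrow> ('g, 'v) rep \<Rightarrow> bool" where
  "admissible_rep G X V \<longleftrightarrow> smooth_rep G X V \<and>
    (\<forall>K. compact_open_subgroup G X K \<longrightarrow> finite_dimensional V (fixed_vectors V K))"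

definition subrep :: "('g, 'b) monoid_scheme \<Rightarrow> ('g, 'v) rep \<Rightarrow> 'v set \<Rightarrow> bool" where
  "subrep G V W \<longleftrightarrow>
    submodule W complex_field V \<and> (\<forall>g\<in>carrier G. \<forall>w\<in>W. act V g w \<in> W)"

definition smooth_irrep :: "('g, 'b) monoid_scheme \<Rightarrow> 'g topology \<Rightarrow> ('g, 'v) rep \<Rightarrow> bool" where
  "smooth_irrep G X V \<longleftrightarrow> smooth_rep G X V \<and> carrier V \<noteq> {\<zero>\<^bsub>V\<^esub>} \<and>
    (\<forall>W. subrep G V W \<longrightarrow> W = {\<zero>\<^bsub>V\<^esub>} \<or> W = carrier V)"

definition rep_hom :: "('g, 'b) monoid_scheme \<Rightarrow> ('g, 'v) rep \<Rightarrow> ('g, 'w) rep \<Rightarrow> ('v \<Rightarrow> 'w) set" where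
  "rep_hom G V W = {f \<in> carrier V \<rightarrow> carrier W.
    (\<forall>x\<in>carrier V. \<forall>y\<in>carrier V. f (x \<oplus>\<^bsub>V\<^esub> y) = f x \<oplus>\<^bsub>W\<^esub> f y) \<and>
    (\<forall>c. \<forall>x\<in>carrier V. f (c \<odot>\<^bsub>V\<^esub> x) = c \<odot>\<^bsub>W\<^esub> f x) \<and>
    (\<forall>g\<in>carrier G. \<forall>x\<in>carrier V. f (act V g x) = act W g (f x))}"

text \<open>
  The elements of the set below represent all isomorphism classes of irreducible smooth
  representations of \<open>G\<close> (possibly with repetitions): such a representation is spanned by the
  orbit of any nonzero vector, so its underlying set injects into \<open>'g \<Rightarrow> complex\<close>. Quantifying
  over the smooth dual thus means quantifying over this set; see \<open>smooth_dual_exhaustive\<close>.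
\<close>

definition smooth_dual :: "('g, 'b) monoid_scheme \<Rightarrow> 'g topology \<Rightarrow> ('g, 'g \<Rightarrow> complex) rep set" where
  "smooth_dual G X = {\<pi>. smooth_irrep G X \<pi>}"

definition tame :: "('g, 'b) monoid_scheme \<Rightarrow> 'g topology \<Rightarrow> bool" where
  "tame G X \<longleftrightarrow> (\<forall>\<pi>\<in>smooth_dual G X. admissible_rep G X \<pi>)"


section \<open>Stalks\<close>

definition quot_rep :: "('g, 'v) rep \<Rightarrow> 'v set \<Rightarrow> ('g, 'v set) rep" where
  "quot_rep V W = \<lparr>carrier = a_rcosets\<^bsub>V\<^esub> W, mult = undefined, one = undefined,
    zero = W, add = set_add V,
    smult = (\<lambda>c Y. \<Union>y\<in>Y. W +>\<^bsub>V\<^esub> (c \<odot>\<^bsub>V\<^esub> y)),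
    act = (\<lambda>g Y. \<Union>y\<in>Y. W +>\<^bsub>V\<^esub> act V g y)\<rparr>"

definition common_kernel :: "('g, 'b) monoid_scheme \<Rightarrow> ('g, 'v) rep \<Rightarrow> ('g, 'w) rep \<Rightarrow> 'v set" where
  "common_kernel G M \<pi> = (\<Inter>f\<in>rep_hom G M \<pi>. a_kernel M \<pi> f)"

definition isotypic_quot ::
    "('g, 'b) monoid_scheme \<Rightarrow> ('g, 'v) rep \<Rightarrow> ('g, 'w) rep \<Rightarrow> ('g, 'v set) rep" where
  "isotypic_quot G M \<pi> = quot_rep M (common_kernel G M \<pi>)"

text \<open>The map \<open>M\<^sub>\<pi> \<rightarrow> N\<^sub>\<pi>\<close> induced by \<open>f : M \<rightarrow> N\<close>.\<close>

definition isotypic_quot_map ::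
    "('g, 'b) monoid_scheme \<Rightarrow> ('g, 'w) rep \<Rightarrow> ('g, 'n) rep \<Rightarrow> ('m \<Rightarrow> 'n) \<Rightarrow> 'm set \<Rightarrow> 'n set" where
  "isotypic_quot_map G \<pi> N f Y = (\<Union>y\<in>Y. common_kernel G N \<pi> +>\<^bsub>N\<^esub> f y)"

text \<open>
  Elements of the stalk are made extensional, so that an element is determined by its values
  on \<open>carrier \<pi>\<close>.
\<close>

definition stalk ::
    "('g, 'b) monoid_scheme \<Rightarrow> ('g, 'w) rep \<Rightarrow> ('g, 'm) rep \<Rightarrow> (complex, 'w \<Rightarrow> 'm set) module" where
  "stalk G \<pi> M = \<lparr>
    carrier = rep_hom G \<pi> (isotypic_quot G M \<pi>) \<inter> extensional (carrier \<pi>),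
    mult = undefined, one = undefined,
    zero = (\<lambda>v\<in>carrier \<pi>. \<zero>\<^bsub>isotypic_quot G M \<pi>\<^esub>),
    add = (\<lambda>\<phi> \<psi>. \<lambda>v\<in>carrier \<pi>. \<phi> v \<oplus>\<^bsub>isotypic_quot G M \<pi>\<^esub> \<psi> v),
    smult = (\<lambda>c \<phi>. \<lambda>v\<in>carrier \<pi>. c \<odot>\<^bsub>isotypic_quot G M \<pi>\<^esub> \<phi> v)\<rparr>"

definition stalk_map ::
    "('g, 'b) monoid_scheme \<Rightarrow> ('g, 'w) rep \<Rightarrow> ('g, 'n) rep \<Rightarrow> ('m \<Rightarrow> 'n)
      \<Rightarrow> ('w \<Rightarrow> 'm set) \<Rightarrow> ('w \<Rightarrow> 'n set)" where
  "stalk_map G \<pi> N f \<phi> = (\<lambda>v\<in>carrier \<pi>. isotypic_quot_map G \<pi> N f (\<phi> v))"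

definition exact_at ::
    "('a, 'u, 'x) module_scheme \<Rightarrow> ('u \<Rightarrow> 'v) \<Rightarrow> ('a, 'v, 'y) module_scheme
      \<Rightarrow> ('v \<Rightarrow> 'w) \<Rightarrow> ('a, 'w, 'z) module_scheme \<Rightarrow> bool" where
  "exact_at A f B g C \<longleftrightarrow> f ` carrier A = a_kernel B C g"


section \<open>Exhaustiveness of the smooth dual\<close>

lemma complex_field_simps [simp]:
  "carrier complex_field = UNIV" "mult complex_field = (*)" "one complex_field = 1"
  "zero complex_field = 0" "add complex_field = (+)"
  by (simp_all add: complex_field_def)

lemma complex_field_cring: "cring complex_field"
proof (rule cringI)
  show "abelian_group complex_field"
    by (rule abelian_groupI) (auto simp: add.assoc add.commute intro: exI[of _ "- x" for x])
  show "Group.comm_monoid complex_field"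
    by (rule comm_monoidI) (auto simp: mult.assoc mult.commute)
qed (auto simp: distrib_right)

lemma complex_field_a_inv [simp]: "a_inv complex_field c = - c"
  by (metis UNIV_I abelian_group.minus_equality add.left_inverse complex_field_cring
      complex_field_simps(1,4,5) cring.axioms(1) ring.axioms(1))

definition rep_transport :: "('v \<Rightarrow> 'w) \<Rightarrow> ('g, 'v) rep \<Rightarrow> ('g, 'w) rep" where
  "rep_transport h V = (let k = inv_into (carrier V) h in
    \<lparr>carrier = h ` carrier V, mult = undefined, one = undefined,
     zero = h \<zero>\<^bsub>V\<^esub>, add = (\<lambda>x y. h (k x \<oplus>\<^bsub>V\<^esub> k y)),
     smult = (\<lambda>c x. h (c \<odot>\<^bsub>V\<^esub> k x)), act = (\<lambda>g x. h (act V g (k x)))\<rparr>)"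

lemma rep_transport_simps:
  assumes "inj_on h (carrier V)"
  shows "carrier (rep_transport h V) = h ` carrier V"
    "\<zero>\<^bsub>rep_transport h V\<^esub> = h \<zero>\<^bsub>V\<^esub>"
    "\<And>x y. \<lbrakk>x \<in> carrier V; y \<in> carrier V\<rbrakk> \<Longrightarrow> h x \<oplus>\<^bsub>rep_transport h V\<^esub> h y = h (x \<oplus>\<^bsub>V\<^esub> y)"
    "\<And>c x. x \<in> carrier V \<Longrightarrow> c \<odot>\<^bsub>rep_transport h V\<^esub> h x = h (c \<odot>\<^bsub>V\<^esub> x)"
    "\<And>g x. x \<in> carrier V \<Longrightarrow> act (rep_transport h V) g (h x) = h (act V g x)"
  using assms by (simp_all add: rep_transport_def Let_def)

lemma complex_rep_transport:
  assumes V: "complex_rep G V" and h: "inj_on h (carrier V)"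
  shows "complex_rep G (rep_transport h V)"
proof -
  interpret complex_rep G V by fact
  note [simp] = rep_transport_simps[OF h]
  have "abelian_group (rep_transport h V)"
  proof (rule abelian_groupI, goal_cases)
    case (6 x)
    then obtain v where v: "x = h v" "v \<in> carrier V" by auto
    then have "h (\<ominus>\<^bsub>V\<^esub> v) \<oplus>\<^bsub>rep_transport h V\<^esub> x = h \<zero>\<^bsub>V\<^esub>"
      by (simp add: M.l_neg)
    with v show ?case by auto
  qed (auto simp: M.a_ac)
  then have "Module.module complex_field (rep_transport h V)"
    by (intro moduleI complex_field_cring)
      (use smult_closed smult_l_distr smult_r_distr smult_assoc1 smult_one in \<open>auto\<close>)
  then show ?thesis
    by (intro complex_rep.intro complex_rep_axioms.intro G.is_group)
      (use smult_closed in \<open>auto simp: act_closed act_add act_smult act_one act_mult\<close>)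
qed

lemma smooth_irrep_transport:
  assumes V: "smooth_irrep G X V" and h: "inj_on h (carrier V)"
  shows "smooth_irrep G X (rep_transport h V)"
proof -
  interpret complex_rep G V using V by (simp add: smooth_irrep_def smooth_rep_def)
  interpret T: complex_rep G "rep_transport h V"
    by (rule complex_rep_transport[OF complex_rep_axioms h])
  note [simp] = rep_transport_simps[OF h]
  have stab: "stabilizer G (act (rep_transport h V)) (h v) = stabilizer G (act V) v"
    if "v \<in> carrier V" for v
    using that h act_closed by (auto simp: stabilizer_def inj_on_eq_iff)
  have irr: "U = {h \<zero>\<^bsub>V\<^esub>} \<or> U = h ` carrier V" if U: "subrep G (rep_transport h V) U" for U
  proof -
    define W where "W = {v \<in> carrier V. h v \<in> U}"
    have sub: "submodule U complex_field (rep_transport h V)"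
      and st: "\<And>g u. g \<in> carrier G \<Longrightarrow> u \<in> U \<Longrightarrow> act (rep_transport h V) g u \<in> U"
      using U by (auto simp: subrep_def)
    note E = T.submoduleE[OF sub]
    have UW: "U = h ` W" using E(1) by (auto simp: W_def)
    have z: "h \<zero>\<^bsub>V\<^esub> \<in> U"
      using subgroup.one_closed[OF submodule.axioms(1)[OF sub]] by simp
    have add: "v \<oplus>\<^bsub>V\<^esub> w \<in> W" if "v \<in> W" "w \<in> W" for v w
      using that E(5)[of "h v" "h w"] by (auto simp: W_def)
    have sm: "c \<odot>\<^bsub>V\<^esub> v \<in> W" if "v \<in> W" for c v
      using that E(4)[of c "h v"] smult_closed[of c v] by (auto simp: W_def)
    have neg: "\<ominus>\<^bsub>V\<^esub> v \<in> W" if "v \<in> W" for v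
    proof -
      have "v \<in> carrier V" using that by (simp add: W_def)
      then have "(- 1) \<odot>\<^bsub>V\<^esub> v = \<ominus>\<^bsub>V\<^esub> v" using smult_l_minus[of 1 v] smult_one[of v] by simp
      then show ?thesis using sm[OF that, of "- 1"] by simp
    qed
    have "subrep G V W"
      unfolding subrep_def
    proof (intro conjI ballI submoduleI)
      fix g w assume "g \<in> carrier G" "w \<in> W"
      then show "act V g w \<in> W" using st[of g "h w"] act_closed by (auto simp: W_def)
    qed (use z add sm neg in \<open>auto simp: W_def\<close>)
    then have "W = {\<zero>\<^bsub>V\<^esub>} \<or> W = carrier V" using V by (simp add: smooth_irrep_def)
    then show ?thesis using UW by auto
  qed
  have "h ` carrier V \<noteq> {h \<zero>\<^bsub>V\<^esub>}"
    using V h inj_on_image_eq_iff[OF h, of "carrier V" "{\<zero>\<^bsub>V\<^esub>}"]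
    by (auto simp: smooth_irrep_def)
  then show ?thesis
    using V irr T.complex_rep_axioms
    by (auto simp: smooth_irrep_def smooth_rep_def stab)
qed

lemma smooth_irrep_inj:
  fixes V :: "('g, 'v) rep"
  assumes V: "smooth_irrep G X V"
  shows "\<exists>h :: 'v \<Rightarrow> 'g \<Rightarrow> complex. inj_on h (carrier V)"
proof -
  interpret complex_rep G V using V by (simp add: smooth_irrep_def smooth_rep_def)
  obtain v where v: "v \<in> carrier V" "v \<noteq> \<zero>\<^bsub>V\<^esub>"
    using V M.zero_closed by (auto simp: smooth_irrep_def)
  define t where "t a g = a g \<odot>\<^bsub>V\<^esub> act V g v" for a g
  have t: "t a g \<in> carrier V" if "g \<in> carrier G" for a g
    using that v smult_closed[of "a g"] by (simp add: t_def act_closed)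
  define good where "good a \<longleftrightarrow> finite {g. a g \<noteq> 0} \<and> {g. a g \<noteq> 0} \<subseteq> carrier G" for a :: "'g \<Rightarrow> complex"
  define E where "E a = (\<Oplus>\<^bsub>V\<^esub>g\<in>{g. a g \<noteq> 0}. t a g)" for a
  have E_eq: "E a = (\<Oplus>\<^bsub>V\<^esub>g\<in>S. t a g)"
    if "finite S" "S \<subseteq> carrier G" "{g. a g \<noteq> 0} \<subseteq> S" for a S
    unfolding E_def
    by (rule M.add.finprod_mono_neutral_cong_left)
      (use that t v smult_l_null in \<open>auto simp: t_def act_closed\<close>)
  define D where "D = E ` {a. good a}"
  have E_closed: "E a \<in> carrier V" if "good a" for a
    unfolding E_def by (rule M.finsum_closed) (use that t in \<open>auto simp: good_def\<close>)
  have D_add: "x \<oplus>\<^bsub>V\<^esub> y \<in> D" if xy: "x \<in> D" "y \<in> D" for x y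
  proof -
    obtain a b where ab: "good a" "good b" "x = E a" "y = E b"
      using xy unfolding D_def by blast
    let ?S = "{g. a g \<noteq> 0} \<union> {g. b g \<noteq> 0}"
    have S: "finite ?S" "?S \<subseteq> carrier G" using ab by (auto simp: good_def)
    have "{g. a g + b g \<noteq> 0} \<subseteq> ?S" by auto
    moreover from this have g: "good (\<lambda>g. a g + b g)"
      using S by (auto simp: good_def intro: finite_subset)
    ultimately have "E (\<lambda>g. a g + b g) = (\<Oplus>\<^bsub>V\<^esub>g\<in>?S. t (\<lambda>g. a g + b g) g)"
      using S by (intro E_eq)
    also have "\<dots> = (\<Oplus>\<^bsub>V\<^esub>g\<in>?S. t a g \<oplus>\<^bsub>V\<^esub> t b g)"
      using S v t smult_l_distr
      by (intro M.finsum_cong') (auto simp: t_def act_closed)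
    also have "\<dots> = (\<Oplus>\<^bsub>V\<^esub>g\<in>?S. t a g) \<oplus>\<^bsub>V\<^esub> (\<Oplus>\<^bsub>V\<^esub>g\<in>?S. t b g)"
      using S t by (intro M.finsum_addf) blast+
    also have "\<dots> = x \<oplus>\<^bsub>V\<^esub> y" using E_eq[OF S, of a] E_eq[OF S, of b] ab by simp
    finally show ?thesis using g unfolding D_def by (metis imageI mem_Collect_eq)
  qed
  have D_zero: "\<zero>\<^bsub>V\<^esub> \<in> D"
    unfolding D_def by (rule image_eqI[of _ _ "\<lambda>_. 0"]) (auto simp: good_def E_def)
  have D_single: "c \<odot>\<^bsub>V\<^esub> act V g v \<in> D" if "g \<in> carrier G" for c g
  proof -
    let ?a = "\<lambda>k. if k = g then c else 0"
    have "{k. ?a k \<noteq> 0} \<subseteq> {g}" by auto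
    then have "E ?a = (\<Oplus>\<^bsub>V\<^esub>k\<in>{g}. t ?a k)" and "good ?a"
      using that by (auto intro!: E_eq simp: good_def)
    moreover have "(\<Oplus>\<^bsub>V\<^esub>k\<in>{g}. t ?a k) = c \<odot>\<^bsub>V\<^esub> act V g v"
      using t[OF that, of ?a] by (simp add: t_def)
    ultimately show ?thesis by (metis D_def imageI mem_Collect_eq)
  qed
  have D_map: "p x \<in> D"
    if x: "x \<in> D" and p0: "p \<zero>\<^bsub>V\<^esub> = \<zero>\<^bsub>V\<^esub>"
      and pa: "\<And>x y. x \<in> carrier V \<Longrightarrow> y \<in> carrier V \<Longrightarrow> p (x \<oplus>\<^bsub>V\<^esub> y) = p x \<oplus>\<^bsub>V\<^esub> p y"
      and ps: "\<And>c g. g \<in> carrier G \<Longrightarrow> p (c \<odot>\<^bsub>V\<^esub> act V g v) \<in> D" for p x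
  proof -
    obtain a where a: "good a" "x = E a" using x by (auto simp: D_def)
    have "p (\<Oplus>\<^bsub>V\<^esub>g\<in>S. t a g) \<in> D" if "finite S" "S \<subseteq> carrier G" for S
      using that
    proof (induction S)
      case empty then show ?case by (simp add: p0 D_zero)
    next
      case (insert g S)
      have c: "(\<Oplus>\<^bsub>V\<^esub>g\<in>S. t a g) \<in> carrier V" "t a g \<in> carrier V"
        using insert.prems t by (auto intro!: M.finsum_closed)
      have "(\<Oplus>\<^bsub>V\<^esub>g\<in>insert g S. t a g) = t a g \<oplus>\<^bsub>V\<^esub> (\<Oplus>\<^bsub>V\<^esub>g\<in>S. t a g)"
        using insert t by (intro M.finsum_insert) auto
      then have "p (\<Oplus>\<^bsub>V\<^esub>g\<in>insert g S. t a g) = p (t a g) \<oplus>\<^bsub>V\<^esub> p (\<Oplus>\<^bsub>V\<^esub>g\<in>S. t a g)"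
        using c by (simp add: pa)
      then show ?case using insert ps[of g "a g"] by (simp add: D_add t_def)
    qed
    then show ?thesis using a by (auto simp: good_def E_def)
  qed
  have smD: "c \<odot>\<^bsub>V\<^esub> x \<in> D" if "x \<in> D" for c x
  proof (rule D_map[of x "\<lambda>x. c \<odot>\<^bsub>V\<^esub> x"])
    fix d g assume g: "g \<in> carrier G"
    then show "c \<odot>\<^bsub>V\<^esub> (d \<odot>\<^bsub>V\<^esub> act V g v) \<in> D"
      using D_single[OF g, of "c * d"] smult_assoc1[of c d "act V g v"] v by (simp add: act_closed)
  qed (use that smult_r_null smult_r_distr in auto)
  have D_sub: "D \<subseteq> carrier V" using E_closed by (auto simp: D_def)
  have "subrep G V D"
    unfolding subrep_def
  proof (intro conjI ballI submoduleI)
    fix g x assume g: "g \<in> carrier G" and x: "x \<in> D"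
    show "act V g x \<in> D"
    proof (rule D_map[OF x])
      have "act V g (0 \<odot>\<^bsub>V\<^esub> v) = 0 \<odot>\<^bsub>V\<^esub> act V g v" using g v by (simp add: act_smult)
      then show "act V g \<zero>\<^bsub>V\<^esub> = \<zero>\<^bsub>V\<^esub>" using smult_l_null g v by (simp add: act_closed)
    next
      fix c k assume k: "k \<in> carrier G"
      have "act V g (c \<odot>\<^bsub>V\<^esub> act V k v) = c \<odot>\<^bsub>V\<^esub> act V (g \<otimes>\<^bsub>G\<^esub> k) v"
        using g k v by (simp add: act_smult act_mult act_closed)
      then show "act V g (c \<odot>\<^bsub>V\<^esub> act V k v) \<in> D" using D_single[of "g \<otimes>\<^bsub>G\<^esub> k" c] g k by simp
    qed (use g in \<open>simp add: act_add\<close>)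
  next
    fix x assume "x \<in> D"
    moreover from this have "(- 1) \<odot>\<^bsub>V\<^esub> x = \<ominus>\<^bsub>V\<^esub> x"
      using smult_l_minus[of 1 x] smult_one[of x] D_sub by auto
    ultimately show "\<ominus>\<^bsub>V\<^esub> x \<in> D" using smD[of x "- 1"] by simp
  qed (use D_sub D_zero D_add smD in auto)
  moreover have "v \<in> D"
    using D_single[of "\<one>\<^bsub>G\<^esub>" 1] v smult_one[of v] by (simp add: act_one)
  ultimately have "D = carrier V" using V v by (auto simp: smooth_irrep_def)
  then have "inj_on (inv_into {a. good a} E) (carrier V)"
    unfolding D_def by (metis inj_on_inv_into order_refl)
  then show ?thesis by blast
qed

lemma smooth_dual_exhaustive:
  fixes G :: "('g, 'b) monoid_scheme" and V :: "('g, 'v) rep"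
  assumes "smooth_irrep G X V"
  shows "\<exists>\<pi>\<in>smooth_dual G X. \<exists>h\<in>rep_hom G V \<pi>. bij_betw h (carrier V) (carrier \<pi>)"
proof -
  obtain h :: "'v \<Rightarrow> 'g \<Rightarrow> complex" where h: "inj_on h (carrier V)"
    using smooth_irrep_inj[OF assms] by blast
  have "rep_transport h V \<in> smooth_dual G X"
    using smooth_irrep_transport[OF assms h] by (simp add: smooth_dual_def)
  moreover have "h \<in> rep_hom G V (rep_transport h V)"
    by (simp add: rep_hom_def rep_transport_simps[OF h])
  moreover have "bij_betw h (carrier V) (carrier (rep_transport h V))"
    using h by (simp add: rep_transport_simps[OF h] bij_betw_def)
  ultimately show ?thesis by blast
qed

end

theory Submission
  imports Defs
begin

text \<open>
  Admissible irreducible representations \<open>\<pi>\<close> are injective: extending a homomorphism \<open>\<phi> : T \<rightarrow> \<pi>\<close> to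
  one more vector \<open>x\<close> means finding \<open>y\<close> with \<open>a y = \<phi>(a x)\<close> for all \<open>a\<close> in the group algebra with
  \<open>a x \<in> T\<close>. For \<open>a\<close> supported in a compact open subgroup a solution is found by averaging, and since
  all solutions lie in the finite-dimensional space of vectors fixed by some \<open>K\<close>, there is a common one.
  Hence every vector outside a subrepresentation \<open>U\<close> is detected by a homomorphism to some irreducible
  \<open>\<pi>\<close> that vanishes on \<open>U\<close>. On the other hand \<open>M\<^sub>\<pi>\<close> is semisimple, because each cyclic
  subrepresentation of it embeds into a finite power of \<open>\<pi>\<close>; so \<open>Hom(\<pi>, -)\<close> preserves and detects the
  exactness of \<open>M\<^sub>\<pi> \<rightarrow> N\<^sub>\<pi> \<rightarrow> P\<^sub>\<pi>\<close>, and the theorem reduces to comparing these sequences, for all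
  \<open>\<pi>\<close>, with \<open>M \<rightarrow> N \<rightarrow> P\<close>.
\<close>

section \<open>Subrepresentations and homomorphisms\<close>

text \<open>The filtered union only places each finite set of group elements in some compact open
  subgroup, and solutions found over different subgroups need not agree; finite dimension removes
  this obstacle by an argument of Mittag-Leffler type. The extension of k : U -> \<pi> to V is not
  built as a map. Zorn's lemma produces its kernel instead: a subrepresentation C with C + U = V
  that meets U in ker k. The same maximality lemma yields linear complements (over the trivial
  group) and complements in semisimple representations (with zero intersection). Linear subspaces
  are treated throughout as subrepresentations for the trivial group. Injectivity serves twice: for
  the detection of vectors, and for the passage from M -> N -> P to the isotypic quotients, where a
  homomorphism N -> \<pi> that kills ker g descends to g(N) and has to be extended to P.\<close>

abbreviation restrict_rep :: "('g, 'v) rep \<Rightarrow> 'v set \<Rightarrow> ('g, 'v) rep" where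
  "restrict_rep V U \<equiv> V\<lparr>carrier := U\<rparr>"

abbreviation sum_set :: "('g, 'v) rep \<Rightarrow> 'v set \<Rightarrow> 'v set \<Rightarrow> 'v set" where
  "sum_set V A B \<equiv> {a \<oplus>\<^bsub>V\<^esub> b | a b. a \<in> A \<and> b \<in> B}"

context complex_rep
begin

lemma neg_eq_smult: "x \<in> carrier V \<Longrightarrow> \<ominus>\<^bsub>V\<^esub> x = (- 1) \<odot>\<^bsub>V\<^esub> x"
  using smult_l_minus[of 1 x] smult_one[of x] by simp

lemma smult_mem [simp]: "x \<in> carrier V \<Longrightarrow> c \<odot>\<^bsub>V\<^esub> x \<in> carrier V"
  using smult_closed by simp

lemma smult_zero_left [simp]: "x \<in> carrier V \<Longrightarrow> 0 \<odot>\<^bsub>V\<^esub> x = \<zero>\<^bsub>V\<^esub>"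
  using smult_l_null by simp

lemma smult_zero_right [simp]: "c \<odot>\<^bsub>V\<^esub> \<zero>\<^bsub>V\<^esub> = \<zero>\<^bsub>V\<^esub>"
  using smult_r_null by simp

lemma smult_one' [simp]: "x \<in> carrier V \<Longrightarrow> 1 \<odot>\<^bsub>V\<^esub> x = x"
  using smult_one by simp

lemma smult_add_left:
  "x \<in> carrier V \<Longrightarrow> (a + b) \<odot>\<^bsub>V\<^esub> x = a \<odot>\<^bsub>V\<^esub> x \<oplus>\<^bsub>V\<^esub> b \<odot>\<^bsub>V\<^esub> x"
  using smult_l_distr by simp

lemma smult_add_right:
  "x \<in> carrier V \<Longrightarrow> y \<in> carrier V \<Longrightarrow> c \<odot>\<^bsub>V\<^esub> (x \<oplus>\<^bsub>V\<^esub> y) = c \<odot>\<^bsub>V\<^esub> x \<oplus>\<^bsub>V\<^esub> c \<odot>\<^bsub>V\<^esub> y"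
  using smult_r_distr by simp

lemma smult_smult: "x \<in> carrier V \<Longrightarrow> a \<odot>\<^bsub>V\<^esub> (b \<odot>\<^bsub>V\<^esub> x) = (a * b) \<odot>\<^bsub>V\<^esub> x"
  using smult_assoc1 by simp

lemma act_zero: "g \<in> carrier G \<Longrightarrow> act V g \<zero>\<^bsub>V\<^esub> = \<zero>\<^bsub>V\<^esub>"
  using act_smult[of g "\<zero>\<^bsub>V\<^esub>" 0] by (simp add: act_closed)

lemma act_inv_cancel:
  assumes "g \<in> carrier G" "v \<in> carrier V"
  shows "act V g (act V (inv\<^bsub>G\<^esub> g) v) = v" "act V (inv\<^bsub>G\<^esub> g) (act V g v) = v"
  using assms act_mult[of g "inv\<^bsub>G\<^esub> g" v] act_mult[of "inv\<^bsub>G\<^esub> g" g v] by (simp_all add: act_one)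

lemma add_minus_cancel:
  assumes "x \<in> carrier V" "y \<in> carrier V"
  shows "(x \<ominus>\<^bsub>V\<^esub> y) \<oplus>\<^bsub>V\<^esub> y = x" "y \<oplus>\<^bsub>V\<^esub> (x \<ominus>\<^bsub>V\<^esub> y) = x"
    "(x \<oplus>\<^bsub>V\<^esub> y) \<ominus>\<^bsub>V\<^esub> y = x" "(y \<oplus>\<^bsub>V\<^esub> x) \<ominus>\<^bsub>V\<^esub> y = x"
proof -
  show "(x \<ominus>\<^bsub>V\<^esub> y) \<oplus>\<^bsub>V\<^esub> y = x"
    using assms by (simp add: a_minus_def M.a_assoc M.l_neg)
  then show "y \<oplus>\<^bsub>V\<^esub> (x \<ominus>\<^bsub>V\<^esub> y) = x"
    using assms by (simp add: M.a_comm)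
  show "(x \<oplus>\<^bsub>V\<^esub> y) \<ominus>\<^bsub>V\<^esub> y = x"
    using assms by (simp add: a_minus_def M.a_assoc M.r_neg)
  then show "(y \<oplus>\<^bsub>V\<^esub> x) \<ominus>\<^bsub>V\<^esub> y = x"
    using assms by (simp add: M.a_comm)
qed

lemma minus_eq_zero_iff:
  "x \<in> carrier V \<Longrightarrow> y \<in> carrier V \<Longrightarrow> x \<ominus>\<^bsub>V\<^esub> y = \<zero>\<^bsub>V\<^esub> \<longleftrightarrow> x = y"
  using add_minus_cancel(1)[of x y] by (auto simp: a_minus_def M.r_neg)

lemma subrep_iff:
  "subrep G V W \<longleftrightarrow> W \<subseteq> carrier V \<and> \<zero>\<^bsub>V\<^esub> \<in> W \<and> (\<forall>x\<in>W. \<forall>y\<in>W. x \<oplus>\<^bsub>V\<^esub> y \<in> W) \<and>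
     (\<forall>c. \<forall>x\<in>W. c \<odot>\<^bsub>V\<^esub> x \<in> W) \<and> (\<forall>g\<in>carrier G. \<forall>x\<in>W. act V g x \<in> W)"
  (is "_ \<longleftrightarrow> ?R")
proof
  assume "subrep G V W"
  then have s: "submodule W complex_field V" and a: "\<forall>g\<in>carrier G. \<forall>x\<in>W. act V g x \<in> W"
    by (auto simp: subrep_def)
  have "\<zero>\<^bsub>V\<^esub> \<in> W"
    using subgroup.one_closed[OF submodule.axioms(1)[OF s]] by simp
  with a submoduleE[OF s] show ?R by auto
next
  assume R: ?R
  then have "\<ominus>\<^bsub>V\<^esub> x \<in> W" if "x \<in> W" for x
    using that by (auto simp: neg_eq_smult subsetD)
  with R show "subrep G V W"
    unfolding subrep_def by (intro conjI submoduleI) auto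
qed

lemma subrepI:
  assumes "W \<subseteq> carrier V" "\<zero>\<^bsub>V\<^esub> \<in> W" "\<And>x y. x \<in> W \<Longrightarrow> y \<in> W \<Longrightarrow> x \<oplus>\<^bsub>V\<^esub> y \<in> W"
    "\<And>c x. x \<in> W \<Longrightarrow> c \<odot>\<^bsub>V\<^esub> x \<in> W" "\<And>g x. g \<in> carrier G \<Longrightarrow> x \<in> W \<Longrightarrow> act V g x \<in> W"
  shows "subrep G V W"
  using assms by (simp add: subrep_iff)

lemma subrepD:
  assumes "subrep G V W"
  shows "W \<subseteq> carrier V" "\<zero>\<^bsub>V\<^esub> \<in> W" "\<And>x y. x \<in> W \<Longrightarrow> y \<in> W \<Longrightarrow> x \<oplus>\<^bsub>V\<^esub> y \<in> W"
    "\<And>c x. x \<in> W \<Longrightarrow> c \<odot>\<^bsub>V\<^esub> x \<in> W" "\<And>g x. g \<in> carrier G \<Longrightarrow> x \<in> W \<Longrightarrow> act V g x \<in> W"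
    "\<And>x. x \<in> W \<Longrightarrow> x \<in> carrier V"
  using assms by (auto simp: subrep_iff)

lemma subrep_minus: "subrep G V W \<Longrightarrow> x \<in> W \<Longrightarrow> y \<in> W \<Longrightarrow> x \<ominus>\<^bsub>V\<^esub> y \<in> W"
  by (auto simp: a_minus_def neg_eq_smult subrepD)

lemma subrep_cancel:
  assumes "subrep G V W" "x \<in> carrier V" "y \<in> W"
  shows "x \<oplus>\<^bsub>V\<^esub> y \<in> W \<longleftrightarrow> x \<in> W" "y \<oplus>\<^bsub>V\<^esub> x \<in> W \<longleftrightarrow> x \<in> W" "x \<ominus>\<^bsub>V\<^esub> y \<in> W \<longleftrightarrow> x \<in> W"
proof -
  note w = subrepD[OF assms(1)]
  have y: "y \<in> carrier V" by (rule w(6)[OF assms(3)])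
  note c = add_minus_cancel[OF assms(2) y]
  show "x \<oplus>\<^bsub>V\<^esub> y \<in> W \<longleftrightarrow> x \<in> W"
    using subrep_minus[OF assms(1), of "x \<oplus>\<^bsub>V\<^esub> y" y] w(3)[of x y] assms(3) c by auto
  then show "y \<oplus>\<^bsub>V\<^esub> x \<in> W \<longleftrightarrow> x \<in> W"
    using assms(2) y by (simp add: M.a_comm)
  show "x \<ominus>\<^bsub>V\<^esub> y \<in> W \<longleftrightarrow> x \<in> W"
    using subrep_minus[OF assms(1), of x y] w(3)[of "x \<ominus>\<^bsub>V\<^esub> y" y] assms(3) c by auto
qed

lemma subrep_carrier: "subrep G V (carrier V)"
  by (rule subrepI) (auto simp: act_closed)

lemma subrep_zero: "subrep G V {\<zero>\<^bsub>V\<^esub>}"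
  by (rule subrepI) (auto simp: act_zero)

lemma subrep_Int: "subrep G V A \<Longrightarrow> subrep G V B \<Longrightarrow> subrep G V (A \<inter> B)"
  unfolding subrep_iff by blast

lemma subrep_Inter:
  "A \<noteq> {} \<Longrightarrow> (\<And>W. W \<in> A \<Longrightarrow> subrep G V W) \<Longrightarrow> subrep G V (\<Inter>A)"
  unfolding subrep_iff by blast

text \<open>The chain condition is for sums: two vectors from different members both lie in the
  larger one. This is the upper bound in both applications of Zorn's lemma.\<close>

lemma subrep_Union_chain:
  assumes "\<C> \<noteq> {}" and ch: "subset.chain A \<C>" and s: "\<And>W. W \<in> \<C> \<Longrightarrow> subrep G V W"
  shows "subrep G V (\<Union>\<C>)"
proof (rule subrepI)
  fix x y assume "x \<in> \<Union>\<C>" "y \<in> \<Union>\<C>"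
  then obtain A B where "A \<in> \<C>" "x \<in> A" "B \<in> \<C>" "y \<in> B" by blast
  moreover from this have "A \<subseteq> B \<or> B \<subseteq> A"
    using ch unfolding subset_chain_def by blast
  ultimately obtain C where "C \<in> \<C>" "x \<in> C" "y \<in> C" by blast
  then show "x \<oplus>\<^bsub>V\<^esub> y \<in> \<Union>\<C>" using subrepD(3)[OF s] by blast
next
  show "\<zero>\<^bsub>V\<^esub> \<in> \<Union>\<C>" using assms(1) subrepD(2)[OF s] by blast
  show "\<Union>\<C> \<subseteq> carrier V" using subrepD(1)[OF s] by blast
next
  fix c x assume "x \<in> \<Union>\<C>"
  then show "c \<odot>\<^bsub>V\<^esub> x \<in> \<Union>\<C>" using subrepD(4)[OF s] by blast
next
  fix g x assume "g \<in> carrier G" "x \<in> \<Union>\<C>"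
  then show "act V g x \<in> \<Union>\<C>" using subrepD(5)[OF s] by blast
qed

lemma subrep_sum:
  assumes A: "subrep G V A" and B: "subrep G V B"
  shows "subrep G V (sum_set V A B)" "A \<subseteq> sum_set V A B" "B \<subseteq> sum_set V A B"
proof -
  note a = subrepD[OF A] and b = subrepD[OF B]
  have add: "(p \<oplus>\<^bsub>V\<^esub> q) \<oplus>\<^bsub>V\<^esub> (r \<oplus>\<^bsub>V\<^esub> s) = (p \<oplus>\<^bsub>V\<^esub> r) \<oplus>\<^bsub>V\<^esub> (q \<oplus>\<^bsub>V\<^esub> s)"
    if "p \<in> A" "q \<in> B" "r \<in> A" "s \<in> B" for p q r s
    using that a(6) b(6) by (simp add: M.a_ac)
  show "subrep G V (sum_set V A B)"
  proof (rule subrepI)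
    fix x y assume "x \<in> sum_set V A B" "y \<in> sum_set V A B"
    then obtain p q r s where *: "x = p \<oplus>\<^bsub>V\<^esub> q" "y = r \<oplus>\<^bsub>V\<^esub> s" "p \<in> A" "q \<in> B" "r \<in> A" "s \<in> B"
      by blast
    then show "x \<oplus>\<^bsub>V\<^esub> y \<in> sum_set V A B"
      using add[of p q r s] a(3)[of p r] b(3)[of q s] by blast
  next
    have "\<zero>\<^bsub>V\<^esub> = \<zero>\<^bsub>V\<^esub> \<oplus>\<^bsub>V\<^esub> \<zero>\<^bsub>V\<^esub>" by simp
    with a(2) b(2) show "\<zero>\<^bsub>V\<^esub> \<in> sum_set V A B" by blast
  next
    fix c x assume "x \<in> sum_set V A B"
    then obtain p q where "x = p \<oplus>\<^bsub>V\<^esub> q" "p \<in> A" "q \<in> B" by blast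
    then show "c \<odot>\<^bsub>V\<^esub> x \<in> sum_set V A B"
      using a(4)[of p c] b(4)[of q c] a(6) b(6) smult_add_right[of p q c] by blast
  next
    fix g x assume g: "g \<in> carrier G" and "x \<in> sum_set V A B"
    then obtain p q where "x = p \<oplus>\<^bsub>V\<^esub> q" "p \<in> A" "q \<in> B" by blast
    then show "act V g x \<in> sum_set V A B"
      using g a(5)[of g p] b(5)[of g q] a(6) b(6) act_add[of g p q] by blast
  qed (use a(6) b(6) in auto)
  show "A \<subseteq> sum_set V A B"
  proof
    fix x assume x: "x \<in> A"
    then have "x = x \<oplus>\<^bsub>V\<^esub> \<zero>\<^bsub>V\<^esub>" using a(6) by simp
    with x b(2) show "x \<in> sum_set V A B" by blast
  qed
  show "B \<subseteq> sum_set V A B"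
  proof
    fix x assume x: "x \<in> B"
    then have "x = \<zero>\<^bsub>V\<^esub> \<oplus>\<^bsub>V\<^esub> x" using b(6) by simp
    with x a(2) show "x \<in> sum_set V A B" by blast
  qed
qed

lemma complex_rep_restrict:
  assumes "subrep G V U"
  shows "complex_rep G (restrict_rep V U)"
proof -
  have s: "submodule U complex_field V" using assms by (simp add: subrep_def)
  note u = subrepD[OF assms]
  show ?thesis
    by (intro complex_rep.intro complex_rep_axioms.intro G.is_group
        submodule.submodule_is_module[OF s] module_axioms)
      (use u in \<open>auto simp: act_add act_smult act_one act_mult\<close>)
qed

lemma subrep_restrict_iff:
  assumes "subrep G V U"
  shows "subrep G (restrict_rep V U) W \<longleftrightarrow> subrep G V W \<and> W \<subseteq> U"
proof -
  interpret U: complex_rep G "restrict_rep V U" by (rule complex_rep_restrict[OF assms])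
  show ?thesis unfolding U.subrep_iff subrep_iff using subrepD(1)[OF assms] by auto
qed

text \<open>For the trivial subgroup, subrepresentations are the linear subspaces and homomorphisms
  are the linear maps, so results on representations specialize to linear algebra.\<close>

lemma subgroup_complex_rep:
  assumes "subgroup L G"
  shows "complex_rep (G\<lparr>carrier := L\<rparr>) V"
proof -
  interpret L: group "G\<lparr>carrier := L\<rparr>" by (rule subgroup.subgroup_is_group[OF assms G.is_group])
  show ?thesis
    by (intro complex_rep.intro complex_rep_axioms.intro L.is_group module_axioms)
      (use subgroup.subset[OF assms] in
        \<open>auto simp: act_closed act_add act_smult act_one act_mult subset_iff\<close>)
qed

end

lemma smooth_restrict:
  assumes "smooth_rep G X V" "subrep G V U"
  shows "smooth_rep G X (restrict_rep V U)"
proof -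
  interpret complex_rep G V using assms by (simp add: smooth_rep_def)
  have "stabilizer G (act (restrict_rep V U)) v = stabilizer G (act V) v" for v
    by (simp add: stabilizer_def)
  then show ?thesis
    using assms complex_rep_restrict[OF assms(2)] subrepD(1)[OF assms(2)]
    by (auto simp: smooth_rep_def)
qed

section \<open>Homomorphisms: images, kernels, factorization and gluing\<close>

lemma rep_homI:
  assumes "\<And>x. x \<in> carrier V \<Longrightarrow> f x \<in> carrier W"
    "\<And>x y. x \<in> carrier V \<Longrightarrow> y \<in> carrier V \<Longrightarrow> f (x \<oplus>\<^bsub>V\<^esub> y) = f x \<oplus>\<^bsub>W\<^esub> f y"
    "\<And>c x. x \<in> carrier V \<Longrightarrow> f (c \<odot>\<^bsub>V\<^esub> x) = c \<odot>\<^bsub>W\<^esub> f x"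
    "\<And>g x. g \<in> carrier G \<Longrightarrow> x \<in> carrier V \<Longrightarrow> f (act V g x) = act W g (f x)"
  shows "f \<in> rep_hom G V W"
  using assms by (auto simp: rep_hom_def)

lemma rep_homD:
  assumes "f \<in> rep_hom G V W"
  shows "\<And>x. x \<in> carrier V \<Longrightarrow> f x \<in> carrier W"
    "\<And>x y. x \<in> carrier V \<Longrightarrow> y \<in> carrier V \<Longrightarrow> f (x \<oplus>\<^bsub>V\<^esub> y) = f x \<oplus>\<^bsub>W\<^esub> f y"
    "\<And>c x. x \<in> carrier V \<Longrightarrow> f (c \<odot>\<^bsub>V\<^esub> x) = c \<odot>\<^bsub>W\<^esub> f x"
    "\<And>g x. g \<in> carrier G \<Longrightarrow> x \<in> carrier V \<Longrightarrow> f (act V g x) = act W g (f x)"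
  using assms by (auto simp: rep_hom_def)

lemma rep_hom_cong:
  assumes "complex_rep G V" "f \<in> rep_hom G V W" "\<And>x. x \<in> carrier V \<Longrightarrow> f x = f' x"
  shows "f' \<in> rep_hom G V W"
proof -
  interpret complex_rep G V by fact
  show ?thesis
    by (rule rep_homI)
      (use assms(3)[symmetric] rep_homD[OF assms(2)] in \<open>simp_all add: act_closed\<close>)
qed

lemma rep_hom_comp:
  assumes "f \<in> rep_hom G U V" "h \<in> rep_hom G V W"
  shows "(\<lambda>x. h (f x)) \<in> rep_hom G U W"
  by (rule rep_homI) (simp_all add: rep_homD[OF assms(1)] rep_homD[OF assms(2)])

lemma rep_hom_subset:
  assumes "f \<in> rep_hom G V W" "U \<subseteq> carrier V"
  shows "f \<in> rep_hom G (restrict_rep V U) W"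
  by (rule rep_homI) (use assms(2) in \<open>auto simp: rep_homD[OF assms(1)] subsetD\<close>)

lemma rep_hom_into:
  assumes "f \<in> rep_hom G V W" "f ` carrier V \<subseteq> U"
  shows "f \<in> rep_hom G V (restrict_rep W U)"
  by (rule rep_homI) (use assms(2) in \<open>auto simp: rep_homD[OF assms(1)]\<close>)

lemma rep_hom_id: "(\<lambda>x. x) \<in> rep_hom G V V"
  by (rule rep_homI) simp_all

locale rep_homomorphism = V: complex_rep G V + W: complex_rep G W
  for G :: "('g, 'b) monoid_scheme" and V :: "('g, 'v) rep" and W :: "('g, 'w) rep" +
  fixes f
  assumes hom: "f \<in> rep_hom G V W"
begin

lemmas hom_closed = rep_homD(1)[OF hom]
  and hom_add = rep_homD(2)[OF hom]
  and hom_smult = rep_homD(3)[OF hom]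
  and hom_act = rep_homD(4)[OF hom]

lemma hom_zero: "f \<zero>\<^bsub>V\<^esub> = \<zero>\<^bsub>W\<^esub>"
  using hom_smult[of "\<zero>\<^bsub>V\<^esub>" 0] hom_closed[of "\<zero>\<^bsub>V\<^esub>"] by simp

lemma hom_minus:
  "x \<in> carrier V \<Longrightarrow> y \<in> carrier V \<Longrightarrow> f (x \<ominus>\<^bsub>V\<^esub> y) = f x \<ominus>\<^bsub>W\<^esub> f y"
  by (simp add: a_minus_def V.neg_eq_smult W.neg_eq_smult hom_add hom_smult hom_closed)

lemma hom_eq_iff:
  "x \<in> carrier V \<Longrightarrow> y \<in> carrier V \<Longrightarrow> f x = f y \<longleftrightarrow> f (x \<ominus>\<^bsub>V\<^esub> y) = \<zero>\<^bsub>W\<^esub>"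
  by (simp add: hom_minus W.minus_eq_zero_iff hom_closed)

lemma subrep_image:
  assumes "subrep G V T"
  shows "subrep G W (f ` T)"
proof -
  note t = V.subrepD[OF assms]
  show ?thesis
  proof (rule W.subrepI)
    show "\<zero>\<^bsub>W\<^esub> \<in> f ` T" using t(2) hom_zero by (metis imageI)
  next
    fix x y assume "x \<in> f ` T" "y \<in> f ` T"
    then obtain u v where "x = f u" "y = f v" "u \<in> T" "v \<in> T" by blast
    then show "x \<oplus>\<^bsub>W\<^esub> y \<in> f ` T" using hom_add[of u v] t(3)[of u v] t(6) by (metis imageI)
  next
    fix c x assume "x \<in> f ` T"
    then obtain u where "x = f u" "u \<in> T" by blast
    then show "c \<odot>\<^bsub>W\<^esub> x \<in> f ` T" using hom_smult[of u c] t(4)[of u c] t(6) by (metis imageI)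
  next
    fix g x assume "g \<in> carrier G" "x \<in> f ` T"
    then obtain u where "x = f u" "u \<in> T" "g \<in> carrier G" by blast
    then show "act W g x \<in> f ` T" using hom_act[of g u] t(5)[of g u] t(6) by (metis imageI)
  qed (use t(6) hom_closed in auto)
qed

lemma subrep_vimage:
  assumes "subrep G W T"
  shows "subrep G V {x \<in> carrier V. f x \<in> T}"
  by (rule V.subrepI)
    (use W.subrepD[OF assms] in \<open>auto simp: hom_zero hom_add hom_smult hom_act V.act_closed\<close>)

lemma subrep_kernel: "subrep G V {x \<in> carrier V. f x = \<zero>\<^bsub>W\<^esub>}"
  using subrep_vimage[OF W.subrep_zero] by simp

end

text \<open>The kernel of \<open>q\<close> lies in that of \<open>h\<close>, so the value of
  \<open>h\<close> at a chosen preimage does not depend on the choice. It is applied to coset maps,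
  to maps onto their image, and, with \<open>h\<close> an inclusion and \<open>q\<close> injective,
  to invert \<open>q\<close>.\<close>

lemma rep_hom_factor:
  assumes V: "complex_rep G V" and Q: "complex_rep G Q" and W: "complex_rep G W"
    and q: "q \<in> rep_hom G V Q" and surj: "q ` carrier V = carrier Q" and h: "h \<in> rep_hom G V W"
    and ker: "\<And>x. x \<in> carrier V \<Longrightarrow> q x = \<zero>\<^bsub>Q\<^esub> \<Longrightarrow> h x = \<zero>\<^bsub>W\<^esub>"
  obtains k where "k \<in> rep_hom G Q W" "\<And>x. x \<in> carrier V \<Longrightarrow> k (q x) = h x"
proof -
  interpret q: rep_homomorphism G V Q q
    by (intro rep_homomorphism.intro rep_homomorphism_axioms.intro V Q q)
  interpret h: rep_homomorphism G V W h
    by (intro rep_homomorphism.intro rep_homomorphism_axioms.intro V W h)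
  define k where "k y = h (SOME x. x \<in> carrier V \<and> q x = y)" for y
  have k: "k (q x) = h x" if x: "x \<in> carrier V" for x
  proof -
    let ?y = "SOME y. y \<in> carrier V \<and> q y = q x"
    have "?y \<in> carrier V \<and> q ?y = q x"
      by (rule someI[of _ x]) (simp add: x)
    then show ?thesis
      using x ker[of "?y \<ominus>\<^bsub>V\<^esub> x"] q.hom_eq_iff[of ?y x] h.hom_eq_iff[of ?y x] by (simp add: k_def)
  qed
  have "k \<in> rep_hom G Q W"
  proof (rule rep_homI, unfold surj[symmetric], goal_cases)
    case 1 then show ?case by (auto simp: k h.hom_closed)
  next
    case (2 x y)
    then obtain u v where uv: "x = q u" "y = q v" "u \<in> carrier V" "v \<in> carrier V" by blast
    then have "k (q (u \<oplus>\<^bsub>V\<^esub> v)) = h u \<oplus>\<^bsub>W\<^esub> h v" by (simp add: k h.hom_add)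
    with uv show ?case by (simp add: k q.hom_add)
  next
    case (3 c x)
    then obtain u where u: "x = q u" "u \<in> carrier V" by blast
    then have "k (q (c \<odot>\<^bsub>V\<^esub> u)) = c \<odot>\<^bsub>W\<^esub> h u" by (simp add: k h.hom_smult)
    with u show ?case by (simp add: k q.hom_smult)
  next
    case (4 g x)
    then obtain u where u: "x = q u" "u \<in> carrier V" by blast
    with 4 have "k (q (act V g u)) = act W g (h u)" by (simp add: k h.hom_act q.V.act_closed)
    with u 4 show ?case by (simp add: k q.hom_act)
  qed
  with k show ?thesis using that by blast
qed

text \<open>Extension by zero across \<open>C\<close>: the map is \<open>k\<close> after the
  projection of \<open>C\<close> + \<open>U\<close> to \<open>U\<close>, which is determined only up
  to the intersection, where \<open>k\<close> vanishes.\<close>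

lemma rep_hom_glue:
  assumes V: "complex_rep G V" and W: "complex_rep G W"
    and C: "subrep G V C" and U: "subrep G V U" and k: "k \<in> rep_hom G (restrict_rep V U) W"
    and int: "\<And>x. x \<in> C \<Longrightarrow> x \<in> U \<Longrightarrow> k x = \<zero>\<^bsub>W\<^esub>"
  obtains \<phi> where "\<phi> \<in> rep_hom G (restrict_rep V (sum_set V C U)) W"
    "\<And>x. x \<in> U \<Longrightarrow> \<phi> x = k x" "\<And>x. x \<in> C \<Longrightarrow> \<phi> x = \<zero>\<^bsub>W\<^esub>"
proof -
  interpret V: complex_rep G V by fact
  interpret k: rep_homomorphism G "restrict_rep V U" W k
    by (intro rep_homomorphism.intro rep_homomorphism_axioms.intro V.complex_rep_restrict U W k)
  note c = V.subrepD[OF C] and u = V.subrepD[OF U]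
  define \<phi> where "\<phi> v = k (SOME x. x \<in> U \<and> (\<exists>y\<in>C. v = y \<oplus>\<^bsub>V\<^esub> x))" for v
  have \<phi>: "\<phi> (y \<oplus>\<^bsub>V\<^esub> x) = k x" if xy: "x \<in> U" "y \<in> C" for x y
  proof -
    let ?z = "SOME z. z \<in> U \<and> (\<exists>w\<in>C. y \<oplus>\<^bsub>V\<^esub> x = w \<oplus>\<^bsub>V\<^esub> z)"
    have "?z \<in> U \<and> (\<exists>w\<in>C. y \<oplus>\<^bsub>V\<^esub> x = w \<oplus>\<^bsub>V\<^esub> ?z)"
      by (rule someI[of _ x]) (use xy in blast)
    then obtain w where w: "?z \<in> U" "w \<in> C" "y \<oplus>\<^bsub>V\<^esub> x = w \<oplus>\<^bsub>V\<^esub> ?z" by blast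
    have cl: "?z \<in> carrier V" "w \<in> carrier V" "x \<in> carrier V" "y \<in> carrier V"
      using w xy u c by auto
    \<comment> \<open>Two decompositions of one vector have \<open>U\<close>-components that differ
      by an element of both \<open>C\<close> and \<open>U\<close>.\<close>
    have "x \<ominus>\<^bsub>V\<^esub> ?z = w \<ominus>\<^bsub>V\<^esub> y"
    proof -
      have "(y \<oplus>\<^bsub>V\<^esub> x) \<oplus>\<^bsub>V\<^esub> (\<ominus>\<^bsub>V\<^esub> y \<oplus>\<^bsub>V\<^esub> \<ominus>\<^bsub>V\<^esub> ?z) = (w \<oplus>\<^bsub>V\<^esub> ?z) \<oplus>\<^bsub>V\<^esub> (\<ominus>\<^bsub>V\<^esub> y \<oplus>\<^bsub>V\<^esub> \<ominus>\<^bsub>V\<^esub> ?z)"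
        using w by simp
      moreover have "(y \<oplus>\<^bsub>V\<^esub> x) \<oplus>\<^bsub>V\<^esub> (\<ominus>\<^bsub>V\<^esub> y \<oplus>\<^bsub>V\<^esub> \<ominus>\<^bsub>V\<^esub> ?z) = x \<ominus>\<^bsub>V\<^esub> ?z"
        using cl by (simp add: a_minus_def V.M.a_ac V.M.r_neg1 V.M.r_neg2)
      moreover have "(w \<oplus>\<^bsub>V\<^esub> ?z) \<oplus>\<^bsub>V\<^esub> (\<ominus>\<^bsub>V\<^esub> y \<oplus>\<^bsub>V\<^esub> \<ominus>\<^bsub>V\<^esub> ?z) = w \<ominus>\<^bsub>V\<^esub> y"
        using cl by (simp add: a_minus_def V.M.a_ac V.M.r_neg)
      ultimately show ?thesis by simp
    qed
    then have "x \<ominus>\<^bsub>V\<^esub> ?z \<in> C" "x \<ominus>\<^bsub>V\<^esub> ?z \<in> U"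
      using V.subrep_minus[OF C w(2) xy(2)] V.subrep_minus[OF U xy(1) w(1)] by simp_all
    then have "k (x \<ominus>\<^bsub>V\<^esub> ?z) = \<zero>\<^bsub>W\<^esub>" by (rule int)
    \<comment> \<open>The negative in a module record is sought in its carrier, so subtraction in
      \<open>restrict_rep V U\<close> is a priori another operation; writing negatives as multiples
      by -1 identifies the two.\<close>
    moreover have "x \<ominus>\<^bsub>restrict_rep V U\<^esub> ?z = x \<ominus>\<^bsub>V\<^esub> ?z"
      using w(1) cl xy u(4) by (simp add: a_minus_def k.V.neg_eq_smult V.neg_eq_smult)
    ultimately show ?thesis
      using k.hom_eq_iff[of x ?z] w(1) xy(1) by (simp add: \<phi>_def)
  qed
  have "\<phi> \<in> rep_hom G (restrict_rep V (sum_set V C U)) W"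
  proof (rule rep_homI, goal_cases)
    case 1 then show ?case using k.hom_closed by (auto simp: \<phi>)
  next
    case (2 x y)
    then obtain p q r s where *: "x = p \<oplus>\<^bsub>V\<^esub> q" "y = r \<oplus>\<^bsub>V\<^esub> s" "p \<in> C" "q \<in> U" "r \<in> C" "s \<in> U"
      by auto
    then have "x \<oplus>\<^bsub>V\<^esub> y = (p \<oplus>\<^bsub>V\<^esub> r) \<oplus>\<^bsub>V\<^esub> (q \<oplus>\<^bsub>V\<^esub> s)"
      using c(6) u(6) by (simp add: V.M.a_ac)
    then show ?case using * c(3) u(3) k.hom_add[of q s] by (simp add: \<phi>)
  next
    case (3 a x)
    then obtain p q where *: "x = p \<oplus>\<^bsub>V\<^esub> q" "p \<in> C" "q \<in> U" by auto
    then have "a \<odot>\<^bsub>V\<^esub> x = a \<odot>\<^bsub>V\<^esub> p \<oplus>\<^bsub>V\<^esub> a \<odot>\<^bsub>V\<^esub> q"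
      using c(6) u(6) by (simp add: V.smult_add_right)
    then show ?case using * c(4) u(4) k.hom_smult[of q a] by (simp add: \<phi>)
  next
    case (4 g x)
    then obtain p q where *: "x = p \<oplus>\<^bsub>V\<^esub> q" "p \<in> C" "q \<in> U" by auto
    then have "act V g x = act V g p \<oplus>\<^bsub>V\<^esub> act V g q"
      using c(6) u(6) 4 by (simp add: V.act_add)
    then show ?case using * 4 c(5) u(5) k.hom_act[of g q] by (simp add: \<phi>)
  qed
  moreover have "\<phi> x = k x" if "x \<in> U" for x
    using \<phi>[OF that c(2)] u(6)[OF that] by simp
  moreover have "\<phi> x = \<zero>\<^bsub>W\<^esub>" if "x \<in> C" for x
    using \<phi>[OF u(2) that] c(6)[OF that] k.hom_zero by simp
  ultimately show ?thesis using that by blast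
qed

text \<open>Zorn's lemma among the subrepresentations that meet \<open>U\<close> exactly in
  \<open>W\<close>; by \<open>step\<close>, a maximal one spans everything together with
  \<open>U\<close>. With \<open>W\<close> zero it is a complement, with \<open>W\<close> the kernel
  of a map on \<open>U\<close> it is the kernel of an extension of that map.\<close>

lemma (in complex_rep) maximal_complement:
  assumes U: "subrep G V U" and W: "subrep G V W" "W \<subseteq> U"
    and step: "\<And>C x. subrep G V C \<Longrightarrow> C \<inter> U = W \<Longrightarrow> x \<in> carrier V \<Longrightarrow> x \<notin> sum_set V C U \<Longrightarrow>
      \<exists>D. subrep G V D \<and> D \<inter> U = W \<and> C \<subset> D"
  obtains C where "subrep G V C" "C \<inter> U = W" "sum_set V C U = carrier V"
proof -
  let ?A = "{C. subrep G V C \<and> C \<inter> U = W}"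
  have "\<exists>C\<in>?A. \<forall>D\<in>?A. C \<subseteq> D \<longrightarrow> D = C"
  proof (rule subset_Zorn_nonempty)
    show "?A \<noteq> {}" using W by blast
  next
    fix \<C> assume c: "\<C> \<noteq> {}" "subset.chain ?A \<C>"
    then have "subrep G V (\<Union>\<C>)" 
      by (intro subrep_Union_chain[of \<C> ?A]) (auto simp: subset_chain_def)
    moreover have "\<Union>\<C> \<inter> U = W" using c unfolding subset_chain_def by blast
    ultimately show "\<Union>\<C> \<in> ?A" by simp
  qed
  then obtain C where C: "subrep G V C" "C \<inter> U = W"
    and max: "\<And>D. subrep G V D \<Longrightarrow> D \<inter> U = W \<Longrightarrow> C \<subseteq> D \<Longrightarrow> D = C" by blast
  have "x \<in> sum_set V C U" if "x \<in> carrier V" for x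
    using step[OF C that] max by blast
  then have "sum_set V C U = carrier V"
    using subrepD(1)[OF subrep_sum(1)[OF C(1) U]] by blast
  with C that show ?thesis by blast
qed

section \<open>The action of the group algebra\<close>

text \<open>Elements of the group algebra are represented by lists of coefficient/group element pairs.\<close>

primrec ev :: "('g, 'v) rep \<Rightarrow> (complex \<times> 'g) list \<Rightarrow> 'v \<Rightarrow> 'v" where
  "ev V [] x = \<zero>\<^bsub>V\<^esub>"
| "ev V (p # a) x = (fst p \<odot>\<^bsub>V\<^esub> act V (snd p) x) \<oplus>\<^bsub>V\<^esub> ev V a x"

definition combs :: "'g set \<Rightarrow> (complex \<times> 'g) list set" where
  "combs L = {a. snd ` set a \<subseteq> L}"

lemma combs_simps [simp]:
  "[] \<in> combs L" "p # a \<in> combs L \<longleftrightarrow> snd p \<in> L \<and> a \<in> combs L"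
  "a @ b \<in> combs L \<longleftrightarrow> a \<in> combs L \<and> b \<in> combs L"
  by (auto simp: combs_def)

lemma combs_mono: "L \<subseteq> L' \<Longrightarrow> a \<in> combs L \<Longrightarrow> a \<in> combs L'"
  by (auto simp: combs_def)

definition cyclic :: "('g, 'b) monoid_scheme \<Rightarrow> ('g, 'v) rep \<Rightarrow> 'v \<Rightarrow> 'v set" where
  "cyclic G V x = (\<lambda>a. ev V a x) ` combs (carrier G)"

context complex_rep
begin

lemma ev_mem:
  assumes "subrep G V W" "x \<in> W" "a \<in> combs (carrier G)"
  shows "ev V a x \<in> W"
  using assms(3) by (induction a) (simp_all add: subrepD[OF assms(1)] assms(2))

lemma ev_closed: "x \<in> carrier V \<Longrightarrow> a \<in> combs (carrier G) \<Longrightarrow> ev V a x \<in> carrier V"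
  by (rule ev_mem[OF subrep_carrier])

lemma ev_append:
  "x \<in> carrier V \<Longrightarrow> a \<in> combs (carrier G) \<Longrightarrow> b \<in> combs (carrier G) \<Longrightarrow>
    ev V (a @ b) x = ev V a x \<oplus>\<^bsub>V\<^esub> ev V b x"
  by (induction a) (simp_all add: ev_closed act_closed M.a_assoc)

lemma ev_scale:
  assumes "x \<in> carrier V" "a \<in> combs (carrier G)"
  shows "\<exists>b\<in>combs (carrier G). ev V b x = c \<odot>\<^bsub>V\<^esub> ev V a x"
  using assms(2)
proof (induction a)
  case Nil
  show ?case by (rule bexI[of _ "[]"]) simp_all
next
  case (Cons p a)
  then obtain b where b: "b \<in> combs (carrier G)" "ev V b x = c \<odot>\<^bsub>V\<^esub> ev V a x" by auto
  show ?case
    by (rule bexI[of _ "(c * fst p, snd p) # b"])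
      (use Cons.prems b assms in \<open>simp_all add: smult_add_right smult_smult act_closed ev_closed\<close>)
qed

lemma ev_translate:
  assumes "x \<in> carrier V" "a \<in> combs (carrier G)" "g \<in> carrier G"
  shows "\<exists>b\<in>combs (carrier G). ev V b x = act V g (ev V a x)"
  using assms(2)
proof (induction a)
  case Nil
  show ?case by (rule bexI[of _ "[]"]) (simp_all add: act_zero assms)
next
  case (Cons p a)
  then obtain b where b: "b \<in> combs (carrier G)" "ev V b x = act V g (ev V a x)" by auto
  show ?case
    by (rule bexI[of _ "(fst p, g \<otimes>\<^bsub>G\<^esub> snd p) # b"])
      (use Cons.prems b assms in \<open>simp_all add: act_add act_smult act_mult act_closed ev_closed\<close>)
qed

lemma ev_add:
  assumes "x \<in> carrier V" "y \<in> carrier V" "a \<in> combs (carrier G)"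
  shows "ev V a (x \<oplus>\<^bsub>V\<^esub> y) = ev V a x \<oplus>\<^bsub>V\<^esub> ev V a y"
  using assms(3)
proof (induction a)
  case (Cons p a)
  then show ?case
    using assms by (simp add: act_add smult_add_right act_closed ev_closed M.a_ac)
qed simp

lemma ev_smult:
  assumes "x \<in> carrier V" "a \<in> combs (carrier G)"
  shows "ev V a (c \<odot>\<^bsub>V\<^esub> x) = c \<odot>\<^bsub>V\<^esub> ev V a x"
  using assms(2)
  by (induction a)
    (simp_all add: assms(1) act_smult smult_add_right smult_smult act_closed ev_closed mult.commute)

lemma ev_minus:
  assumes "x \<in> carrier V" "y \<in> carrier V" "a \<in> combs (carrier G)"
  shows "ev V a (x \<ominus>\<^bsub>V\<^esub> y) = ev V a x \<ominus>\<^bsub>V\<^esub> ev V a y"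
  using assms by (simp add: a_minus_def neg_eq_smult ev_add ev_smult ev_closed)

lemma subrep_cyclic:
  assumes "x \<in> carrier V"
  shows "subrep G V (cyclic G V x)"
proof (rule subrepI)
  show "cyclic G V x \<subseteq> carrier V" using assms by (auto simp: cyclic_def ev_closed)
  have "ev V [] x \<in> cyclic G V x" unfolding cyclic_def by (rule imageI) simp
  then show "\<zero>\<^bsub>V\<^esub> \<in> cyclic G V x" by simp
next
  fix u v assume "u \<in> cyclic G V x" "v \<in> cyclic G V x"
  then obtain a b where "a \<in> combs (carrier G)" "u = ev V a x" "b \<in> combs (carrier G)" "v = ev V b x"
    by (auto simp: cyclic_def)
  moreover from this have "u \<oplus>\<^bsub>V\<^esub> v = ev V (a @ b) x" using assms by (simp add: ev_append)
  ultimately show "u \<oplus>\<^bsub>V\<^esub> v \<in> cyclic G V x" by (simp add: cyclic_def)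
next
  fix c u assume "u \<in> cyclic G V x"
  then show "c \<odot>\<^bsub>V\<^esub> u \<in> cyclic G V x"
    using ev_scale[OF assms, of _ c] by (force simp: cyclic_def)
next
  fix g u assume "g \<in> carrier G" "u \<in> cyclic G V x"
  then show "act V g u \<in> cyclic G V x"
    using ev_translate[OF assms, of _ g] by (force simp: cyclic_def)
qed

lemma cyclic_self:
  assumes "x \<in> carrier V"
  shows "x \<in> cyclic G V x"
proof -
  have "ev V [(1, \<one>\<^bsub>G\<^esub>)] x = x" using assms by (simp add: act_one)
  moreover have "[(1, \<one>\<^bsub>G\<^esub>)] \<in> combs (carrier G)" by simp
  ultimately show ?thesis unfolding cyclic_def by (metis imageI)
qed

lemma cyclic_subset: "subrep G V W \<Longrightarrow> x \<in> W \<Longrightarrow> cyclic G V x \<subseteq> W"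
  by (auto simp: cyclic_def ev_mem)

end

lemma (in rep_homomorphism) hom_ev:
  assumes "x \<in> carrier V" "a \<in> combs (carrier G)"
  shows "f (ev V a x) = ev W a (f x)"
  using assms(2)
  by (induction a)
    (simp_all add: hom_zero hom_add hom_smult hom_act assms(1) V.act_closed V.ev_closed)


section \<open>Smooth vectors and compact open subgroups\<close>

lemma smooth_repD:
  assumes "smooth_rep G X V"
  shows "complex_rep G V" "\<And>v. v \<in> carrier V \<Longrightarrow> openin X (stabilizer G (act V) v)"
  using assms by (auto simp: smooth_rep_def)

context topological_group
begin

text \<open>A nonempty fibre is a left translate of the open stabilizer of \<open>v\<close>, that
  is, its preimage under left multiplication by \<open>inv g0\<close>.\<close>

lemma openin_act_fibre:
  assumes V: "smooth_rep G X V" and v: "v \<in> carrier V"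
  shows "openin X {g \<in> carrier G. act V g v = w}"
proof (cases "\<exists>g0\<in>carrier G. act V g0 v = w")
  case False
  then have empty: "{g \<in> carrier G. act V g v = w} = {}" by blast
  show ?thesis unfolding empty by simp
next
  case True
  interpret V: complex_rep G V by (rule smooth_repD(1)[OF V])
  obtain g0 where g0: "g0 \<in> carrier G" "act V g0 v = w" using True by blast
  have "continuous_map X (prod_topology X X) (\<lambda>h. (inv g0, h))"
    using g0 by (intro continuous_map_pairedI) (simp_all add: topspace_eq)
  from continuous_map_compose[OF this continuous_mult]
  have "continuous_map X X (\<lambda>h. inv g0 \<otimes> h)" by (simp add: o_def)
  then have "openin X {h \<in> topspace X. inv g0 \<otimes> h \<in> stabilizer G (act V) v}"
    by (rule openin_continuous_map_preimage) (rule smooth_repD(2)[OF V v])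
  moreover have "act V (inv g0 \<otimes> h) v = v \<longleftrightarrow> act V h v = w" if "h \<in> carrier G" for h
  proof -
    have "act V (inv g0 \<otimes> h) v = act V (inv g0) (act V h v)"
      using that g0 v by (simp add: V.act_mult)
    then show ?thesis
      using V.act_inv_cancel[of g0 "act V h v"] V.act_inv_cancel(2)[of g0 v] g0 v that
      by (auto simp: V.act_closed)
  qed
  then have "{h \<in> topspace X. inv g0 \<otimes> h \<in> stabilizer G (act V) v} = {g \<in> carrier G. act V g v = w}"
    using g0 by (auto simp: topspace_eq stabilizer_def)
  ultimately show ?thesis by simp
qed

text \<open>The complement is the union of the other fibres of the orbit map, all open. Closedness
  keeps the intersection with a compact subgroup compact.\<close>

lemma closedin_stabilizer:
  assumes V: "smooth_rep G X V" and v: "v \<in> carrier V"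
  shows "closedin X (stabilizer G (act V) v)"
proof -
  have "topspace X - stabilizer G (act V) v = (\<Union>w\<in>-{v}. {g \<in> carrier G. act V g v = w})"
    by (auto simp: topspace_eq stabilizer_def)
  also have "openin X \<dots>"
    by (intro openin_Union) (use openin_act_fibre[OF assms] in blast)
  finally show ?thesis by (simp add: closedin_def topspace_eq stabilizer_def)
qed

text \<open>A group containing an open subgroup is a union of its open cosets, which here are fibres
  of the orbit map of \<open>v\<close>. The lemma transfers smoothness to quotients.\<close>

lemma openin_stabilizer_mono:
  assumes V: "smooth_rep G X V" and v: "v \<in> carrier V"
    and W: "complex_rep G W" and w: "w \<in> carrier W"
    and sub: "stabilizer G (act V) v \<subseteq> stabilizer G (act W) w"
  shows "openin X (stabilizer G (act W) w)"
proof -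
  interpret V: complex_rep G V by (rule smooth_repD(1)[OF V])
  interpret W: complex_rep G W by (rule W)
  have "stabilizer G (act W) w =
      (\<Union>g\<in>stabilizer G (act W) w. {h \<in> carrier G. act V h v = act V g v})" (is "_ = ?R")
  proof
    show "stabilizer G (act W) w \<subseteq> ?R" by (auto simp: stabilizer_def)
    show "?R \<subseteq> stabilizer G (act W) w"
    proof
      fix h assume "h \<in> ?R"
      then obtain g where g: "g \<in> carrier G" "act W g w = w" "h \<in> carrier G" "act V h v = act V g v"
        by (auto simp: stabilizer_def)
      then have "act V (inv g \<otimes> h) v = v"
        using v by (simp add: V.act_mult V.act_inv_cancel)
      then have "inv g \<otimes> h \<in> stabilizer G (act V) v" using g by (simp add: stabilizer_def)
      then have "inv g \<otimes> h \<in> stabilizer G (act W) w" using sub by blast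
      then have "act W g (act W (inv g \<otimes> h) w) = w" using g by (simp add: stabilizer_def)
      then have "act W h w = w"
        using g w by (simp add: W.act_mult W.act_inv_cancel W.act_closed)
      then show "h \<in> stabilizer G (act W) w" using g by (simp add: stabilizer_def)
    qed
  qed
  moreover have "openin X ?R"
    by (intro openin_Union) (use openin_act_fibre[OF V v] in blast)
  ultimately show ?thesis by simp
qed

text \<open>The fibres of the orbit map cover \<open>L\<close> by open sets, and finitely many of
  them suffice. Averages over compact subgroups thereby become finite sums.\<close>

lemma finite_orbit:
  assumes V: "smooth_rep G X V" and v: "v \<in> carrier V" and L: "compactin X L"
  shows "finite ((\<lambda>g. act V g v) ` L)"
proof -
  have LG: "L \<subseteq> carrier G" using compactin_subset_topspace[OF L] by (simp add: topspace_eq)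
  let ?U = "(\<lambda>w. {g \<in> carrier G. act V g v = w}) ` ((\<lambda>g. act V g v) ` L)"
  have "\<exists>\<F>. finite \<F> \<and> \<F> \<subseteq> ?U \<and> L \<subseteq> \<Union>\<F>"
    by (rule compactinD[OF L]) (use openin_act_fibre[OF V v] LG in auto)
  then obtain T where T: "finite T" "T \<subseteq> (\<lambda>g. act V g v) ` L"
    "L \<subseteq> (\<Union>w\<in>T. {g \<in> carrier G. act V g v = w})"
    by (metis (no_types, lifting) finite_subset_image)
  then have "(\<lambda>g. act V g v) ` L \<subseteq> T" by blast
  then show ?thesis using T(1) finite_subset by blast
qed

end

text \<open>Intersect a compact open subgroup with the stabilizer of \<open>v\<close>, which is both
  open and closed.\<close>

lemma (in lc_group) compact_open_fixing:
  assumes V: "smooth_rep G X V" and v: "v \<in> carrier V"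
  obtains K where "compact_open_subgroup G X K" "\<And>k. k \<in> K \<Longrightarrow> act V k v = v"
proof -
  interpret V: complex_rep G V by (rule smooth_repD(1)[OF V])
  let ?S = "stabilizer G (act V) v"
  obtain L where L: "subgroup L G" "compactin X L" "openin X L"
    using covered[of \<one>] by (auto simp: compact_open_subgroup_def)
  have "subgroup ?S G"
  proof (rule subgroupI)
    show "?S \<noteq> {}" using V.act_one[OF v] by (auto simp: stabilizer_def)
  next
    fix a assume "a \<in> ?S"
    then show "inv a \<in> ?S" using V.act_inv_cancel(2)[of a v] v by (auto simp: stabilizer_def)
  qed (use v in \<open>auto simp: stabilizer_def V.act_mult\<close>)
  then have "subgroup (L \<inter> ?S) G" using L subgroups_Inter_pair by blast
  moreover have "compactin X (L \<inter> ?S)"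
    using compact_Int_closedin L closedin_stabilizer[OF V v] by blast
  moreover have "openin X (L \<inter> ?S)" using L smooth_repD(2)[OF V v] by blast
  ultimately have "compact_open_subgroup G X (L \<inter> ?S)"
    by (simp add: compact_open_subgroup_def)
  then show ?thesis by (rule that) (simp add: stabilizer_def)
qed


section \<open>Dimension of subspaces\<close>

primrec span_list :: "('g, 'v) rep \<Rightarrow> 'v list \<Rightarrow> 'v set" where
  "span_list V [] = {\<zero>\<^bsub>V\<^esub>}"
| "span_list V (b # bs) = {(c \<odot>\<^bsub>V\<^esub> b) \<oplus>\<^bsub>V\<^esub> y | c y. y \<in> span_list V bs}"

text \<open>The dimension of a subspace \<open>Z\<close> of \<open>span_list V bs\<close> is the number of positions at which
  some vector of \<open>Z\<close> has its leading coefficient (as in an echelon form).\<close>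

primrec list_dim :: "('g, 'v) rep \<Rightarrow> 'v list \<Rightarrow> 'v set \<Rightarrow> nat" where
  "list_dim V [] Z = 0"
| "list_dim V (b # bs) Z =
    (if Z \<inter> span_list V (b # bs) \<subseteq> span_list V bs then 0 else 1) + list_dim V bs Z"

lemma list_dim_le_length: "list_dim V bs Z \<le> length bs"
  by (induction bs) auto

lemma list_dim_mono: "Z \<subseteq> Z' \<Longrightarrow> list_dim V bs Z \<le> list_dim V bs Z'"
  by (induction bs) (auto simp del: span_list.simps)

context complex_rep
begin

lemma span_list_closed:
  "set bs \<subseteq> carrier V \<Longrightarrow> span_list V bs \<subseteq> carrier V"
  by (induction bs) auto

lemma span_list_add_smult:
  assumes "set bs \<subseteq> carrier V"
  shows "x \<in> span_list V bs \<Longrightarrow> y \<in> span_list V bs \<Longrightarrow> x \<oplus>\<^bsub>V\<^esub> c \<odot>\<^bsub>V\<^esub> y \<in> span_list V bs"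
  using assms
proof (induction bs arbitrary: x y)
  case (Cons b bs)
  then obtain d u e v where *: "x = (d \<odot>\<^bsub>V\<^esub> b) \<oplus>\<^bsub>V\<^esub> u" "y = (e \<odot>\<^bsub>V\<^esub> b) \<oplus>\<^bsub>V\<^esub> v"
    "u \<in> span_list V bs" "v \<in> span_list V bs" by auto
  have cl: "u \<in> carrier V" "v \<in> carrier V" "b \<in> carrier V"
    using * span_list_closed[of bs] Cons.prems by auto
  then have "x \<oplus>\<^bsub>V\<^esub> c \<odot>\<^bsub>V\<^esub> y = ((d + c * e) \<odot>\<^bsub>V\<^esub> b) \<oplus>\<^bsub>V\<^esub> (u \<oplus>\<^bsub>V\<^esub> c \<odot>\<^bsub>V\<^esub> v)"
    by (simp add: * smult_add_left smult_add_right smult_smult M.a_ac)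
  moreover have "u \<oplus>\<^bsub>V\<^esub> c \<odot>\<^bsub>V\<^esub> v \<in> span_list V bs"
    using Cons.IH[OF *(3,4)] Cons.prems by simp
  ultimately show ?case unfolding span_list.simps by blast
qed simp

text \<open>Elimination as in an echelon form: equal dimension forces equal leading positions at
  every stage, so a vector of \<open>Z'\<close> can be reduced by a vector of \<open>Z\<close> with
  the same leading position.\<close>

lemma list_dim_eq:
  assumes Z: "subrep G V Z" and Z': "subrep G V Z'" and "Z \<subseteq> Z'" and bs: "set bs \<subseteq> carrier V"
    and "list_dim V bs Z' \<le> list_dim V bs Z"
  shows "Z' \<inter> span_list V bs \<subseteq> Z"
  using bs assms(5)
proof (induction bs)
  case Nil
  then show ?case using subrepD(2)[OF Z] by auto
next
  case (Cons b bs)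
  note z = subrepD[OF Z] and z' = subrepD[OF Z']
  have mono: "list_dim V bs Z \<le> list_dim V bs Z'" by (rule list_dim_mono[OF assms(3)])
  \<comment> \<open>A leading position of \<open>Z\<close> is also one of \<open>Z'\<close>, both at
    the head and in the tail. The inequality between the sums therefore forces equality of both
    summands.\<close>
  have imp: "Z \<inter> span_list V (b # bs) \<subseteq> span_list V bs" if "Z' \<inter> span_list V (b # bs) \<subseteq> span_list V bs"
    using that assms(3) by blast
  have IH: "Z' \<inter> span_list V bs \<subseteq> Z"
  proof (rule Cons.IH)
    show "list_dim V bs Z' \<le> list_dim V bs Z"
      using Cons.prems imp by (auto simp del: span_list.simps split: if_splits)
  qed (use Cons.prems in auto)
  have eq: "Z' \<inter> span_list V (b # bs) \<subseteq> span_list V bs" if "Z \<inter> span_list V (b # bs) \<subseteq> span_list V bs"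
    using Cons.prems mono that by (auto simp del: span_list.simps split: if_splits)
  show ?case
  proof (cases "Z' \<inter> span_list V (b # bs) \<subseteq> span_list V bs")
    case True
    then show ?thesis using IH by blast
  next
    case False
    then obtain x where x: "x \<in> Z" "x \<in> span_list V (b # bs)" "x \<notin> span_list V bs"
      using eq by blast
    then obtain c u where cu: "x = (c \<odot>\<^bsub>V\<^esub> b) \<oplus>\<^bsub>V\<^esub> u" "u \<in> span_list V bs" by auto
    have b: "b \<in> carrier V" "set bs \<subseteq> carrier V" using Cons.prems by auto
    have u: "u \<in> carrier V" using cu span_list_closed[OF b(2)] by auto
    have c: "c \<noteq> 0" using x cu u b by auto
    show ?thesis
    proof
      fix y assume y: "y \<in> Z' \<inter> span_list V (b # bs)"
      then obtain d v where dv: "y = (d \<odot>\<^bsub>V\<^esub> b) \<oplus>\<^bsub>V\<^esub> v" "v \<in> span_list V bs" by auto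
      have v: "v \<in> carrier V" using dv span_list_closed[OF b(2)] by auto
      \<comment> \<open>The factor is chosen to cancel the coefficient of \<open>b\<close>, which is
        \<open>d\<close> in \<open>y\<close> and \<open>c\<close> in \<open>x\<close>; what remains
        is covered by the induction hypothesis.\<close>
      let ?y = "y \<oplus>\<^bsub>V\<^esub> (- (d / c)) \<odot>\<^bsub>V\<^esub> x"
      have "?y = ((d \<odot>\<^bsub>V\<^esub> b) \<oplus>\<^bsub>V\<^esub> (- d) \<odot>\<^bsub>V\<^esub> b) \<oplus>\<^bsub>V\<^esub> (v \<oplus>\<^bsub>V\<^esub> (- (d / c)) \<odot>\<^bsub>V\<^esub> u)"
        using b u v c by (simp add: dv cu smult_add_right smult_smult M.a_ac)
      also have "(d \<odot>\<^bsub>V\<^esub> b) \<oplus>\<^bsub>V\<^esub> (- d) \<odot>\<^bsub>V\<^esub> b = \<zero>\<^bsub>V\<^esub>"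
        using smult_add_left[OF b(1), of d "- d"] b by simp
      finally have "?y = v \<oplus>\<^bsub>V\<^esub> (- (d / c)) \<odot>\<^bsub>V\<^esub> u" using u v by simp
      then have "?y \<in> span_list V bs" using span_list_add_smult[OF b(2) dv(2) cu(2)] by simp
      moreover have "?y \<in> Z'" by (intro z'(3,4)) (use x y assms(3) in auto)
      ultimately have "?y \<in> Z" using IH by blast
      moreover have "y \<in> carrier V" using y z'(6) by blast
      ultimately show "y \<in> Z"
        using subrep_cancel(1)[OF Z _ z(4)[OF x(1)]] by simp
    qed
  qed
qed

lemma finsum_in_span_list:
  assumes "set bs \<subseteq> carrier V" "distinct bs"
  shows "(\<Oplus>\<^bsub>V\<^esub>b\<in>set bs. c b \<odot>\<^bsub>V\<^esub> b) \<in> span_list V bs"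
  using assms
proof (induction bs)
  case (Cons b bs)
  then have "(\<Oplus>\<^bsub>V\<^esub>b\<in>set (b # bs). c b \<odot>\<^bsub>V\<^esub> b) = c b \<odot>\<^bsub>V\<^esub> b \<oplus>\<^bsub>V\<^esub> (\<Oplus>\<^bsub>V\<^esub>b\<in>set bs. c b \<odot>\<^bsub>V\<^esub> b)"
    by (simp add: Pi_def subset_iff)
  then show ?case using Cons by auto
qed simp

text \<open>All that is used of dimension: a bounded natural number that grows strictly along proper
  inclusions of subrepresentations inside \<open>W\<close>. It makes both ascending and descending
  chains stop.\<close>

lemma finite_dimensional_dim:
  assumes "finite_dimensional V W" "W \<subseteq> carrier V"
  shows "\<exists>(d :: 'v set \<Rightarrow> nat) n. (\<forall>Z. d Z \<le> n) \<and> (\<forall>Z Z'. subrep G V Z \<longrightarrow> subrep G V Z' \<longrightarrow>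
    Z \<subseteq> Z' \<longrightarrow> Z' \<subseteq> W \<longrightarrow> d Z' \<le> d Z \<longrightarrow> Z = Z')"
proof -
  obtain B where B: "finite B" "B \<subseteq> W" "\<And>w. w \<in> W \<Longrightarrow> \<exists>c. w = (\<Oplus>\<^bsub>V\<^esub>b\<in>B. c b \<odot>\<^bsub>V\<^esub> b)"
    using assms(1) unfolding finite_dimensional_def by blast
  obtain bs where bs: "set bs = B" "distinct bs" using finite_distinct_list[OF B(1)] by blast
  then have sb: "set bs \<subseteq> carrier V" using B assms by blast
  have W: "W \<subseteq> span_list V bs"
    using B(3) finsum_in_span_list[OF sb bs(2)] bs(1) by fastforce
  show ?thesis
  proof (rule exI[of _ "list_dim V bs"], rule exI[of _ "length bs"], intro conjI allI impI)
    fix Z Z' assume "subrep G V Z" "subrep G V Z'" "Z \<subseteq> Z'" "Z' \<subseteq> W"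
      "list_dim V bs Z' \<le> list_dim V bs Z"
    then show "Z = Z'" using list_dim_eq[of Z Z' bs] sb W by blast
  qed (rule list_dim_le_length)
qed

text \<open>Among finite subsets of \<open>A\<close>, take one whose generated subrepresentation
  \<open>S F\<close> has largest dimension; adjoining another element of \<open>A\<close> cannot
  enlarge it. The conclusion is phrased with an arbitrary \<open>Z\<close> so that a linear
  condition can be checked on \<open>F\<close> alone.\<close>

lemma finite_dimensional_generators:
  assumes fd: "finite_dimensional V W" and W: "subrep G V W" and A: "A \<subseteq> W"
  obtains F where "finite F" "F \<subseteq> A" "\<And>Z. subrep G V Z \<Longrightarrow> F \<subseteq> Z \<Longrightarrow> A \<subseteq> Z"
proof -
  obtain d :: "'v set \<Rightarrow> nat" and n where d: "\<And>Z. d Z \<le> n"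
    and deq: "\<And>Z Z'. subrep G V Z \<Longrightarrow> subrep G V Z' \<Longrightarrow> Z \<subseteq> Z' \<Longrightarrow> Z' \<subseteq> W \<Longrightarrow> d Z' \<le> d Z \<Longrightarrow> Z = Z'"
    using finite_dimensional_dim[OF fd subrepD(1)[OF W]] by metis
  define S where "S F = \<Inter>{Z. subrep G V Z \<and> F \<subseteq> Z}" for F
  have S: "subrep G V (S F)" "S F \<subseteq> W" if "F \<subseteq> A" for F
  proof -
    have FW: "F \<subseteq> W" using that A by blast
    show "subrep G V (S F)" unfolding S_def by (rule subrep_Inter) (use FW W in auto)
    show "S F \<subseteq> W" unfolding S_def using FW W by blast
  qed
  have "\<exists>F. (finite F \<and> F \<subseteq> A) \<and> (\<forall>E. finite E \<and> E \<subseteq> A \<longrightarrow> d (S E) \<le> d (S F))"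
    by (rule ex_has_greatest_nat[of _ "{}" _ "Suc n"]) (use d in \<open>auto simp: less_Suc_eq_le\<close>)
  then obtain F where F: "finite F" "F \<subseteq> A" and max: "\<And>E. finite E \<Longrightarrow> E \<subseteq> A \<Longrightarrow> d (S E) \<le> d (S F)"
    by blast
  have "A \<subseteq> S F"
  proof
    fix a assume a: "a \<in> A"
    then have "S F = S (insert a F)"
      using F by (intro deq S max) (auto simp: S_def)
    then show "a \<in> S F" by (auto simp: S_def)
  qed
  then have "A \<subseteq> Z" if "subrep G V Z" "F \<subseteq> Z" for Z using that unfolding S_def by blast
  with F that show ?thesis by blast
qed

end

section \<open>Injectivity of admissible irreducible representations\<close>

text \<open>The maximality argument over the trivial group gives a linear complement of
  \<open>T\<close>, and gluing the identity of \<open>T\<close> with zero on it gives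
  \<open>p\<close>. Its purpose is to extend maps from \<open>T\<close> linearly, regardless of the
  group, before averaging.\<close>

lemma (in complex_rep) linear_projection:
  assumes T: "subrep G V T"
  obtains p where "p \<in> rep_hom (G\<lparr>carrier := {\<one>\<^bsub>G\<^esub>}\<rparr>) V (restrict_rep V T)"
    "\<And>t. t \<in> T \<Longrightarrow> p t = t"
proof -
  let ?G = "G\<lparr>carrier := {\<one>\<^bsub>G\<^esub>}\<rparr>"
  interpret L: complex_rep ?G V by (rule subgroup_complex_rep[OF G.triv_subgroup])
  have T1: "subrep ?G V T"
    using T unfolding subrep_iff L.subrep_iff by auto
  note t = L.subrepD[OF T1]
  \<comment> \<open>Over the trivial group the group algebra acts by scalars, so the cyclic
    subrepresentation of \<open>x\<close> is a line.\<close>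
  have multiple: "\<exists>c. ev V a x = c \<odot>\<^bsub>V\<^esub> x" if "x \<in> carrier V" "a \<in> combs {\<one>\<^bsub>G\<^esub>}" for a x
    using that(2)
  proof (induction a)
    case Nil
    show ?case by (rule exI[of _ 0]) (simp add: that)
  next
    case (Cons p a)
    then obtain c where "ev V a x = c \<odot>\<^bsub>V\<^esub> x" by auto
    then show ?case
      using Cons.prems that by (intro exI[of _ "fst p + c"]) (simp add: act_one smult_add_left)
  qed
  obtain C where C: "subrep ?G V C" "C \<inter> T = {\<zero>\<^bsub>V\<^esub>}" "sum_set V C T = carrier V"
  proof (rule L.maximal_complement[OF T1 L.subrep_zero])
    show "{\<zero>\<^bsub>V\<^esub>} \<subseteq> T" using t(2) by simp
  next
    fix C x assume C: "subrep ?G V C" "C \<inter> T = {\<zero>\<^bsub>V\<^esub>}" and x: "x \<in> carrier V" "x \<notin> sum_set V C T"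
    note c = L.subrepD[OF C(1)] and S = L.subrepD[OF L.subrep_sum(1)[OF C(1) T1]]
    let ?D = "sum_set V C (cyclic ?G V x)"
    note D = L.subrep_sum[OF C(1) L.subrep_cyclic[OF x(1)]]
    have "v = \<zero>\<^bsub>V\<^esub>" if v: "v \<in> ?D" "v \<in> T" for v
    proof -
      obtain u a where u: "u \<in> C" "a \<in> combs {\<one>\<^bsub>G\<^esub>}" "v = u \<oplus>\<^bsub>V\<^esub> ev V a x"
        using v(1) by (auto simp: cyclic_def)
      then obtain b where b: "v = u \<oplus>\<^bsub>V\<^esub> b \<odot>\<^bsub>V\<^esub> x" using multiple[OF x(1) u(2)] by auto
      have ucl: "u \<in> carrier V" using c(6) u(1) by blast
      have "b \<odot>\<^bsub>V\<^esub> x \<in> sum_set V C T"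
      proof -
        have "v \<in> sum_set V C T" "u \<in> sum_set V C T"
          using v(2) u(1) L.subrep_sum(2,3)[OF C(1) T1] by blast+
        then show ?thesis
          using L.subrep_cancel(2)[OF L.subrep_sum(1)[OF C(1) T1], of "b \<odot>\<^bsub>V\<^esub> x" u] b x by simp
      qed
      \<comment> \<open>If \<open>b\<close> were nonzero, dividing by it would put \<open>x\<close>
        into \<open>C\<close> + \<open>T\<close>.\<close>
      then have "(1 / b) \<odot>\<^bsub>V\<^esub> (b \<odot>\<^bsub>V\<^esub> x) \<in> sum_set V C T" by (rule S(4))
      then have "b = 0" using x by (cases "b = 0") (simp_all add: smult_smult)
      then have "v = u" using b x ucl by simp
      then show ?thesis using C(2) v(2) u(1) by blast
    qed
    then have "?D \<inter> T = {\<zero>\<^bsub>V\<^esub>}" using t(2) L.subrepD(2)[OF D(1)] by blast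
    moreover have "x \<in> ?D" using D(3) L.cyclic_self[OF x(1)] by blast
    moreover have "x \<notin> C" using x(2) L.subrep_sum(2)[OF C(1) T1] by blast
    ultimately show "\<exists>D. subrep ?G V D \<and> D \<inter> T = {\<zero>\<^bsub>V\<^esub>} \<and> C \<subset> D"
      using D(1,2) by blast
  qed
  have "x = \<zero>\<^bsub>restrict_rep V T\<^esub>" if "x \<in> C" "x \<in> T" for x
    using C(2) that by auto
  note glue = rep_hom_glue[OF L.complex_rep_axioms L.complex_rep_restrict[OF T1] C(1) T1 rep_hom_id this]
  obtain \<phi> where "\<phi> \<in> rep_hom ?G (restrict_rep V (sum_set V C T)) (restrict_rep V T)"
    "\<And>x. x \<in> T \<Longrightarrow> \<phi> x = x"
    by (rule glue) blast+
  then show ?thesis using that C(3) by simp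
qed

lemma (in complex_rep) finsum_ev:
  assumes "finite S" "\<And>i. i \<in> S \<Longrightarrow> h i \<in> carrier V" "a \<in> combs (carrier G)"
  shows "ev V a (\<Oplus>\<^bsub>V\<^esub>i\<in>S. h i) = (\<Oplus>\<^bsub>V\<^esub>i\<in>S. ev V a (h i))"
  using assms(1,2)
proof (induction S)
  case empty
  then show ?case using ev_smult[of "\<zero>\<^bsub>V\<^esub>" a 0] assms(3) by (simp add: ev_closed)
next
  case (insert i S)
  then show ?case using assms(3) by (simp add: Pi_def ev_add ev_closed)
qed

lemma (in complex_rep) finsum_constant:
  assumes "finite S" "w \<in> carrier V"
  shows "(\<Oplus>\<^bsub>V\<^esub>i\<in>S. w) = of_nat (card S) \<odot>\<^bsub>V\<^esub> w"
  using assms(1)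
  by (induction S) (use assms(2) in \<open>simp_all add: Pi_def smult_add_left\<close>)

text \<open>A linear extension of \<open>\<phi>\<close> is averaged over its conjugates under \<open>L\<close>; restricted to the
  finite orbit of \<open>x\<close>, there are only finitely many of them.\<close>

lemma (in topological_group) averaged_solution:
  assumes V: "smooth_rep G X V" and W: "smooth_rep G X W"
    and L: "subgroup L G" "compactin X L"
    and T: "subrep G V T" and \<phi>: "\<phi> \<in> rep_hom G (restrict_rep V T) W" and x: "x \<in> carrier V"
  shows "\<exists>y\<in>carrier W. \<forall>a\<in>combs L. ev V a x \<in> T \<longrightarrow> ev W a y = \<phi> (ev V a x)"
proof -
  interpret V: complex_rep G V by (rule smooth_repD(1)[OF V])
  interpret W: complex_rep G W by (rule smooth_repD(1)[OF W])
  note LD = subgroup.subset[OF L(1)] subgroup.one_closed[OF L(1)] subgroup.m_inv_closed[OF L(1)]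
    subgroup.m_closed[OF L(1)]
  have LG: "g \<in> carrier G" if "g \<in> L" for g using that LD(1) by blast
  obtain p where p: "p \<in> rep_hom (G\<lparr>carrier := {\<one>}\<rparr>) V (restrict_rep V T)"
    and pT: "\<And>t. t \<in> T \<Longrightarrow> p t = t" by (rule V.linear_projection[OF T]) blast
  note pD = rep_homD(1-3)[OF p, simplified] and \<phi>D = rep_homD[OF \<phi>, simplified]
  note T' = V.subrepD[OF T]
  \<comment> \<open>The conjugate by \<open>l\<close> of the linear extension \<open>\<phi>\<close>
    after \<open>p\<close>. All conjugates agree with \<open>\<phi>\<close> on \<open>T\<close>,
    because \<open>T\<close> is stable and \<open>\<phi>\<close> is equivariant.\<close>
  define f where "f l v = act W l (\<phi> (p (act V (inv l) v)))" for l v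
  have f_closed: "f l v \<in> carrier W" if "l \<in> L" "v \<in> carrier V" for l v
    using that LG by (simp add: f_def W.act_closed V.act_closed pD \<phi>D)
  have f_add: "f l (c \<odot>\<^bsub>V\<^esub> u \<oplus>\<^bsub>V\<^esub> v) = c \<odot>\<^bsub>W\<^esub> f l u \<oplus>\<^bsub>W\<^esub> f l v"
    if "l \<in> L" "u \<in> carrier V" "v \<in> carrier V" for l u v c
    using that LG by (simp add: f_def V.act_add V.act_smult V.act_closed pD T' \<phi>D W.act_add W.act_smult)
  have f_T: "f l t = \<phi> t" if "l \<in> L" "t \<in> T" for l t
    using that LG T'(5,6) \<phi>D(4)[of l "act V (inv l) t"] by (simp add: f_def pT V.act_inv_cancel)
  have f_shift: "f (l \<otimes> m) (act V l v) = act W l (f m v)"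
    if "l \<in> L" "m \<in> L" "v \<in> carrier V" for l m v
    using that LG
    by (simp add: f_def inv_mult_group V.act_mult V.act_closed V.act_inv_cancel W.act_mult pD \<phi>D)
  define Orb where "Orb = (\<lambda>l. act V l x) ` L"
  have Orb: "v \<in> carrier V" "l \<in> L \<Longrightarrow> act V l v \<in> Orb" if "v \<in> Orb" for v l
    using that LG LD(4)[of l] x by (auto simp: Orb_def V.act_closed V.act_mult[symmetric])
  have xO: "x \<in> Orb"
    using V.act_one[OF x] LD(2) unfolding Orb_def by (metis imageI)
  \<comment> \<open>The average runs over the set of these restrictions rather than over
    \<open>L\<close>; the set is finite, so no Haar measure is involved.\<close>
  define fr where "fr l = restrict (f l) Orb" for l
  let ?F = "fr ` L"
  \<comment> \<open>The possible values: for \<open>v\<close> in the orbit, the translate of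
    \<open>v\<close> by \<open>inv l\<close> is in the orbit too, so \<open>f l v\<close> is an
    \<open>L\<close>-translate of one of finitely many vectors \<open>\<phi> (p v')\<close>, and
    each of these has a finite orbit.\<close>
  let ?R = "\<Union>v\<in>Orb. (\<lambda>l. act W l (\<phi> (p v))) ` L"
  have "finite Orb" unfolding Orb_def by (rule finite_orbit[OF V x L(2)])
  moreover have "finite ((\<lambda>l. act W l (\<phi> (p v))) ` L)" if "v \<in> Orb" for v
    by (rule finite_orbit[OF W _ L(2)]) (use Orb(1)[OF that] in \<open>simp add: pD \<phi>D\<close>)
  ultimately have "finite (Orb \<rightarrow>\<^sub>E ?R)" by (intro finite_PiE) auto
  moreover have "?F \<subseteq> Orb \<rightarrow>\<^sub>E ?R"
  proof (intro image_subsetI PiE_I)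
    fix l v assume l: "l \<in> L" and v: "v \<in> Orb"
    then have "act V (inv l) v \<in> Orb" by (intro Orb(2) LD(3))
    then show "fr l v \<in> ?R" using l v by (auto simp: fr_def f_def)
  qed (simp add: fr_def)
  ultimately have finF: "finite ?F" by (rule rev_finite_subset)
  have F_closed: "F v \<in> carrier W" if "F \<in> ?F" "v \<in> Orb" for F v
    using that Orb(1) by (auto simp: fr_def f_closed)
  have n: "(of_nat (card ?F) :: complex) \<noteq> 0" using finF LD(2) by auto
  let ?S = "\<Oplus>\<^bsub>W\<^esub>F\<in>?F. F x"
  have S: "?S \<in> carrier W" by (rule W.M.finsum_closed) (use F_closed xO in blast)
  \<comment> \<open>Translation by \<open>l\<close> permutes the restrictions:
    \<open>\<beta>\<close> sends \<open>fr m\<close> to \<open>fr (l \<otimes> m)\<close>.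
    Reindexing the sum along \<open>\<beta>\<close> gives equivariance at \<open>x\<close>.\<close>
  have shift: "(\<Oplus>\<^bsub>W\<^esub>F\<in>?F. act W l (F x)) = (\<Oplus>\<^bsub>W\<^esub>F\<in>?F. F (act V l x))" if l: "l \<in> L" for l
  proof -
    define \<beta> where "\<beta> F = (\<lambda>v\<in>Orb. act W l (F (act V (inv l) v)))" for F
    have b: "\<beta> (fr m) = fr (l \<otimes> m)" if m: "m \<in> L" for m
    proof
      fix v show "\<beta> (fr m) v = fr (l \<otimes> m) v"
      proof (cases "v \<in> Orb")
        case True
        then have "act V (inv l) v \<in> Orb" by (rule Orb(2)) (rule LD(3)[OF l])
        then show ?thesis
          using f_shift[OF l m, of "act V (inv l) v"] True Orb(1) LG[OF l]
          by (simp add: \<beta>_def fr_def V.act_inv_cancel)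
      qed (simp add: \<beta>_def fr_def)
    qed
    have "fr m \<in> \<beta> ` ?F" if m: "m \<in> L" for m
    proof -
      have "fr m = \<beta> (fr (inv l \<otimes> m))"
        using b[OF LD(4)[OF LD(3)[OF l] m]] LG l m by (simp add: m_assoc[symmetric])
      moreover have "inv l \<otimes> m \<in> L" using LD(3,4) l m by blast
      ultimately show ?thesis by blast
    qed
    then have surj: "\<beta> ` ?F = ?F" using b LD(4)[OF l] by auto
    then have inj: "inj_on \<beta> ?F" using finF by (intro eq_card_imp_inj_on) auto
    have lO: "act V l x \<in> Orb" by (rule Orb(2)[OF xO l])
    have "(\<Oplus>\<^bsub>W\<^esub>F\<in>?F. F (act V l x)) = (\<Oplus>\<^bsub>W\<^esub>F\<in>\<beta> ` ?F. F (act V l x))"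
      by (simp only: surj)
    also have "\<dots> = (\<Oplus>\<^bsub>W\<^esub>F\<in>?F. \<beta> F (act V l x))"
      by (rule W.M.finsum_reindex[OF _ inj]) (use F_closed lO surj in blast)
    also have "\<dots> = (\<Oplus>\<^bsub>W\<^esub>F\<in>?F. act W l (F x))"
      by (rule W.M.finsum_cong')
        (use F_closed xO lO LG[OF l] x in \<open>auto simp: \<beta>_def V.act_inv_cancel W.act_closed\<close>)
    finally show ?thesis by simp
  qed
  \<comment> \<open>\<open>E a F\<close> stands for the value at \<open>ev V a x\<close> of a linear
    function known only on the orbit. It is computed from the list \<open>a\<close>, so it makes
    sense for a restriction \<open>F\<close>.\<close>
  define E where "E a F = foldr (\<lambda>p s. (fst p \<odot>\<^bsub>W\<^esub> F (act V (snd p) x)) \<oplus>\<^bsub>W\<^esub> s) a \<zero>\<^bsub>W\<^esub>"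
    for a :: "(complex \<times> 'g) list" and F
  have E_simps: "E [] F = \<zero>\<^bsub>W\<^esub>"
    "E (p # a) F = (fst p \<odot>\<^bsub>W\<^esub> F (act V (snd p) x)) \<oplus>\<^bsub>W\<^esub> E a F" for p a F
    by (simp_all add: E_def)
  have E_fr: "E a (fr m) = f m (ev V a x)" if m: "m \<in> L" and a: "a \<in> combs L" for a m
    using a
  proof (induction a)
    case Nil
    have c: "f m \<zero>\<^bsub>V\<^esub> \<in> carrier W" using f_closed[OF m] by simp
    have "f m \<zero>\<^bsub>V\<^esub> = (- 1) \<odot>\<^bsub>W\<^esub> f m \<zero>\<^bsub>V\<^esub> \<oplus>\<^bsub>W\<^esub> f m \<zero>\<^bsub>V\<^esub>"
      using f_add[OF m, of "\<zero>\<^bsub>V\<^esub>" "\<zero>\<^bsub>V\<^esub>" "-1"] by simp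
    also have "\<dots> = \<zero>\<^bsub>W\<^esub>" using c by (simp add: W.neg_eq_smult[symmetric] W.M.l_neg)
    finally show ?case by (simp add: E_simps)
  next
    case (Cons p a)
    then have "f m (ev V (p # a) x) = fst p \<odot>\<^bsub>W\<^esub> f m (act V (snd p) x) \<oplus>\<^bsub>W\<^esub> f m (ev V a x)"
      using m x LG combs_mono[OF LD(1)] by (simp add: f_add V.act_closed V.ev_closed)
    then show ?case
      using Cons Orb(2)[OF xO] by (simp add: E_simps fr_def)
  qed
  have E_closed: "E a F \<in> carrier W" if "F \<in> ?F" "a \<in> combs L" for a F
    using that E_fr combs_mono[OF LD(1)] x by (auto simp: f_closed V.ev_closed)
  have ev_S: "ev W a ?S = (\<Oplus>\<^bsub>W\<^esub>F\<in>?F. E a F)" if "a \<in> combs L" for a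
    using that
  proof (induction a)
    case Nil
    then show ?case by (simp add: E_simps)
  next
    case (Cons p a)
    then have l: "snd p \<in> L" and a: "a \<in> combs L" by auto
    have lO: "act V (snd p) x \<in> Orb" by (rule Orb(2)[OF xO l])
    have "act W (snd p) ?S = ev W [(1, snd p)] ?S"
      using S LG[OF l] by (simp add: W.act_closed)
    also have "\<dots> = (\<Oplus>\<^bsub>W\<^esub>F\<in>?F. ev W [(1, snd p)] (F x))"
      by (rule W.finsum_ev[OF finF]) (use F_closed xO LG[OF l] in auto)
    also have "\<dots> = (\<Oplus>\<^bsub>W\<^esub>F\<in>?F. act W (snd p) (F x))"
      by (rule W.M.finsum_cong') (use F_closed xO LG[OF l] in \<open>auto simp: W.act_closed\<close>)
    also note shift[OF l]
    finally have "fst p \<odot>\<^bsub>W\<^esub> act W (snd p) ?S = (\<Oplus>\<^bsub>W\<^esub>F\<in>?F. fst p \<odot>\<^bsub>W\<^esub> F (act V (snd p) x))"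
      using W.finsum_smult_ldistr[OF finF, of "fst p" "\<lambda>F. F (act V (snd p) x)"] F_closed lO
      by (auto simp: Pi_def)
    then have "ev W (p # a) ?S =
        (\<Oplus>\<^bsub>W\<^esub>F\<in>?F. fst p \<odot>\<^bsub>W\<^esub> F (act V (snd p) x)) \<oplus>\<^bsub>W\<^esub> (\<Oplus>\<^bsub>W\<^esub>F\<in>?F. E a F)"
      using Cons by simp
    also have "\<dots> = (\<Oplus>\<^bsub>W\<^esub>F\<in>?F. E (p # a) F)"
      unfolding E_simps
      by (rule W.M.finsum_addf[symmetric]) (use F_closed lO E_closed a in auto)
    finally show ?case .
  qed
  \<comment> \<open>For \<open>ev V a x\<close> in \<open>T\<close>, every member of
    \<open>?F\<close> contributes the same vector \<open>\<phi> (ev V a x)\<close>, so the sum is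
    off by the factor \<open>card ?F\<close>.\<close>
  let ?c = "1 / of_nat (card ?F) :: complex"
  show ?thesis
  proof (intro bexI[of _ "?c \<odot>\<^bsub>W\<^esub> ?S"] ballI impI)
    fix a assume a: "a \<in> combs L" and aT: "ev V a x \<in> T"
    have w: "\<phi> (ev V a x) \<in> carrier W" using aT by (simp add: \<phi>D)
    have "ev W a ?S = (\<Oplus>\<^bsub>W\<^esub>F\<in>?F. \<phi> (ev V a x))"
      unfolding ev_S[OF a]
      by (rule W.M.finsum_cong') (use a aT w in \<open>auto simp: E_fr f_T\<close>)
    also have "\<dots> = of_nat (card ?F) \<odot>\<^bsub>W\<^esub> \<phi> (ev V a x)" by (rule W.finsum_constant[OF finF w])
    finally show "ev W a (?c \<odot>\<^bsub>W\<^esub> ?S) = \<phi> (ev V a x)"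
      using n w S combs_mono[OF LD(1) a] by (simp add: W.ev_smult W.smult_smult)
  qed (use S in simp)
qed

section \<open>From compact open subgroups to the whole group\<close>

text \<open>A list involves finitely many group elements: covering puts each into a compact open
  subgroup, and directedness merges these. Every single equation over \<open>G\<close> is thus an
  equation over some compact open subgroup.\<close>

lemma (in lc_group) combs_in_compact_open:
  assumes "compact_open_subgroup G X L" "a \<in> combs (carrier G)"
  shows "\<exists>H. compact_open_subgroup G X H \<and> L \<subseteq> H \<and> a \<in> combs H"
  using assms(2)
proof (induction a)
  case Nil
  then show ?case using assms(1) by auto
next
  case (Cons p a)
  then obtain H where H: "compact_open_subgroup G X H" "L \<subseteq> H" "a \<in> combs H" by auto
  obtain K where K: "compact_open_subgroup G X K" "snd p \<in> K" using covered Cons.prems by auto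
  obtain J where J: "compact_open_subgroup G X J" "H \<subseteq> J" "K \<subseteq> J" using directed[OF H(1) K(1)] by blast
  then have "p # a \<in> combs J" using H K combs_mono[OF J(2) H(3)] by auto
  with H J show ?case by blast
qed

text \<open>The solutions over the compact open subgroups form a decreasing family of affine subspaces
  of a finite-dimensional space, which becomes stationary.\<close>

lemma (in lc_group) global_solution:
  assumes V: "smooth_rep G X V" and W: "admissible_rep G X W"
    and T: "subrep G V T" and \<phi>: "\<phi> \<in> rep_hom G (restrict_rep V T) W" and x: "x \<in> carrier V"
  shows "\<exists>y\<in>carrier W. \<forall>a\<in>combs (carrier G). ev V a x \<in> T \<longrightarrow> ev W a y = \<phi> (ev V a x)"
proof -
  have sW: "smooth_rep G X W" using W by (simp add: admissible_rep_def)
  interpret V: complex_rep G V by (rule smooth_repD(1)[OF V])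
  interpret W: complex_rep G W by (rule smooth_repD(1)[OF sW])
  let ?G = "G\<lparr>carrier := {\<one>}\<rparr>"
  interpret W1: complex_rep ?G W by (rule W.subgroup_complex_rep[OF triv_subgroup])
  obtain K where K: "compact_open_subgroup G X K" and Kx: "\<And>k. k \<in> K \<Longrightarrow> act V k x = x"
    by (rule compact_open_fixing[OF V x]) blast
  have sub: "L \<subseteq> carrier G" if "compact_open_subgroup G X L" for L
    using that by (auto simp: compact_open_subgroup_def dest: subgroup.subset)
  let ?W = "fixed_vectors W K"
  have "finite_dimensional W ?W" using W K by (simp add: admissible_rep_def)
  moreover have "?W \<subseteq> carrier W" by (auto simp: fixed_vectors_def)
  ultimately obtain d :: "_ \<Rightarrow> nat" where d: "\<And>Z Z'. subrep ?G W Z \<Longrightarrow> subrep ?G W Z' \<Longrightarrow> Z \<subseteq> Z' \<Longrightarrow>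
      Z' \<subseteq> ?W \<Longrightarrow> d Z' \<le> d Z \<Longrightarrow> Z = Z'"
    using W1.finite_dimensional_dim by metis
  \<comment> \<open>The homogeneous solutions, that is, the space of directions of the affine space
    of solutions over \<open>L\<close>.\<close>
  define Z where "Z L = {z \<in> carrier W. \<forall>a\<in>combs L. ev V a x \<in> T \<longrightarrow> ev W a z = \<zero>\<^bsub>W\<^esub>}" for L
  have Z_subrep: "subrep ?G W (Z L)" if "compact_open_subgroup G X L" for L
  proof (rule W1.subrepI)
    have z: "ev W a \<zero>\<^bsub>W\<^esub> = \<zero>\<^bsub>W\<^esub>" if "a \<in> combs L" for a
      using W.ev_mem[OF W.subrep_zero _ combs_mono[OF sub that]] \<open>compact_open_subgroup G X L\<close> by auto
    then show "\<zero>\<^bsub>W\<^esub> \<in> Z L" by (simp add: Z_def)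
  qed (use combs_mono[OF sub[OF that]] in \<open>auto simp: Z_def W.ev_add W.ev_smult W.act_one\<close>)
  have Z_fixed: "Z L \<subseteq> ?W" if L: "compact_open_subgroup G X L" "K \<subseteq> L" for L
  proof
    fix z assume z: "z \<in> Z L"
    then have zW: "z \<in> carrier W"
      and zL: "\<And>a. a \<in> combs L \<Longrightarrow> ev V a x \<in> T \<Longrightarrow> ev W a z = \<zero>\<^bsub>W\<^esub>"
      by (simp_all add: Z_def)
    have "act W k z = z" if k: "k \<in> K" for k
    proof -
      \<comment> \<open>The element k - 1 of the group algebra kills \<open>x\<close>, and zero lies
        in \<open>T\<close>; so the homogeneous equation for it says that \<open>k\<close> fixes
        \<open>z\<close>. This bounds \<open>Z L\<close> by the finite-dimensional
        \<open>?W\<close>.\<close>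
      let ?a = "[(1, k), (- 1, \<one>)] :: (complex \<times> 'a) list"
      have kG: "k \<in> carrier G" using k sub[OF K] by blast
      have "?a \<in> combs L"
        using k L subgroup.one_closed[of L G] by (auto simp: compact_open_subgroup_def)
      moreover have "ev V ?a x = \<zero>\<^bsub>V\<^esub>"
        using x Kx[OF k] by (simp add: V.act_one V.neg_eq_smult[symmetric] V.M.r_neg)
      ultimately have "ev W ?a z = \<zero>\<^bsub>W\<^esub>" using zL[of ?a] V.subrepD(2)[OF T] by metis
      then have "act W k z \<ominus>\<^bsub>W\<^esub> z = \<zero>\<^bsub>W\<^esub>"
        using zW kG by (simp add: W.act_one W.act_closed W.neg_eq_smult a_minus_def)
      then show ?thesis using zW kG by (simp add: W.minus_eq_zero_iff W.act_closed)
    qed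
    with zW show "z \<in> ?W" by (simp add: fixed_vectors_def)
  qed
  \<comment> \<open>Choose \<open>L\<close> with \<open>Z L\<close> of least dimension. For a larger
    \<open>H\<close>, the inclusion of \<open>Z H\<close> in \<open>Z L\<close> is then an
    equality.\<close>
  have "\<exists>L. (compact_open_subgroup G X L \<and> K \<subseteq> L) \<and>
      (\<forall>H. compact_open_subgroup G X H \<and> K \<subseteq> H \<longrightarrow> d (Z L) \<le> d (Z H))"
    by (rule ex_has_least_nat) (use K in blast)
  then obtain L where L: "compact_open_subgroup G X L" "K \<subseteq> L"
    and min: "\<And>H. compact_open_subgroup G X H \<Longrightarrow> K \<subseteq> H \<Longrightarrow> d (Z L) \<le> d (Z H)" by blast
  have local: "\<exists>y\<in>carrier W. \<forall>a\<in>combs H. ev V a x \<in> T \<longrightarrow> ev W a y = \<phi> (ev V a x)"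
    if "compact_open_subgroup G X H" for H
    using that by (intro averaged_solution[OF V sW _ _ T \<phi> x]) (auto simp: compact_open_subgroup_def)
  obtain y where y: "y \<in> carrier W"
    and yL: "\<And>a. a \<in> combs L \<Longrightarrow> ev V a x \<in> T \<Longrightarrow> ev W a y = \<phi> (ev V a x)"
    using local[OF L(1)] by blast
  have "ev W a y = \<phi> (ev V a x)" if a: "a \<in> combs (carrier G)" "ev V a x \<in> T" for a
  proof -
    obtain H where H: "compact_open_subgroup G X H" "L \<subseteq> H" "a \<in> combs H"
      using combs_in_compact_open[OF L(1) a(1)] by blast
    have KH: "K \<subseteq> H" using H L by blast
    have "Z H \<subseteq> Z L" using combs_mono[OF H(2)] by (auto simp: Z_def)
    then have ZH: "Z H = Z L"
      by (intro d Z_subrep Z_fixed min H L KH)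
    obtain z where z: "z \<in> carrier W"
      and zH: "\<And>a. a \<in> combs H \<Longrightarrow> ev V a x \<in> T \<Longrightarrow> ev W a z = \<phi> (ev V a x)"
      using local[OF H(1)] by blast
    \<comment> \<open>A solution \<open>z\<close> over \<open>H\<close> also solves the equations
      over \<open>L\<close>, so \<open>y\<close> and \<open>z\<close> differ by an element of
      \<open>Z L\<close>, which equals \<open>Z H\<close>. Hence \<open>y\<close>, chosen for
      \<open>L\<close> before \<open>a\<close> was given, satisfies the equation for
      \<open>a\<close>.\<close>
    have "y \<ominus>\<^bsub>W\<^esub> z \<in> Z L"
      unfolding Z_def
    proof (intro CollectI conjI ballI impI)
      fix b assume b: "b \<in> combs L" "ev V b x \<in> T"
      have bG: "b \<in> combs (carrier G)" by (rule combs_mono[OF sub[OF L(1)] b(1)])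
      then show "ev W b (y \<ominus>\<^bsub>W\<^esub> z) = \<zero>\<^bsub>W\<^esub>"
        using y z yL[OF b] zH[OF combs_mono[OF H(2) b(1)] b(2)]
        by (simp add: W.ev_minus W.minus_eq_zero_iff W.ev_closed rep_homD(1)[OF \<phi>] b(2))
    qed (use y z in simp)
    then have "ev W a (y \<ominus>\<^bsub>W\<^esub> z) = \<zero>\<^bsub>W\<^esub>"
      using ZH H(3) a(2) by (auto simp: Z_def)
    then have "ev W a y = ev W a z"
      using y z a by (simp add: W.ev_minus W.minus_eq_zero_iff W.ev_closed)
    then show ?thesis using zH[OF H(3) a(2)] by simp
  qed
  with y show ?thesis by blast
qed

lemma smooth_irrep_image:
  assumes W: "smooth_irrep G X W" and V: "complex_rep G V" and k: "k \<in> rep_hom G V W"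
    and x: "x \<in> carrier V" "k x \<noteq> \<zero>\<^bsub>W\<^esub>"
  shows "k ` carrier V = carrier W"
proof -
  have "complex_rep G W" using W by (simp add: smooth_irrep_def smooth_rep_def)
  then interpret k: rep_homomorphism G V W k
    using V k by (intro rep_homomorphism.intro rep_homomorphism_axioms.intro)
  have "k ` carrier V = {\<zero>\<^bsub>W\<^esub>} \<or> k ` carrier V = carrier W"
    using W k.subrep_image[OF k.V.subrep_carrier] by (simp add: smooth_irrep_def)
  then show ?thesis using x by blast
qed

text \<open>The injectivity of \<open>W\<close>. The extension is found through its kernel
  \<open>C\<close>, which must meet \<open>U\<close> in \<open>W0\<close> = ker \<open>k\<close> and
  together with \<open>U\<close> span \<open>V\<close>; gluing \<open>k\<close> with zero on
  \<open>C\<close> recovers the map. Enlarging \<open>C\<close> by one step is where the system of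
  equations is solved.\<close>

lemma (in lc_group) irrep_hom_extends:
  assumes V: "smooth_rep G X V" and adm: "admissible_rep G X W" and irr: "smooth_irrep G X W"
    and U: "subrep G V U" and k: "k \<in> rep_hom G (restrict_rep V U) W"
  shows "\<exists>h\<in>rep_hom G V W. \<forall>u\<in>U. h u = k u"
proof -
  have sW: "smooth_rep G X W" using adm by (simp add: admissible_rep_def)
  interpret V: complex_rep G V by (rule smooth_repD(1)[OF V])
  interpret W: complex_rep G W by (rule smooth_repD(1)[OF sW])
  interpret k: rep_homomorphism G "restrict_rep V U" W k
    by (intro rep_homomorphism.intro rep_homomorphism_axioms.intro V.complex_rep_restrict U k
        W.complex_rep_axioms)
  note u = V.subrepD[OF U]
  define W0 where "W0 = {x \<in> U. k x = \<zero>\<^bsub>W\<^esub>}"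
  have W0: "subrep G V W0"
    using k.subrep_kernel V.subrep_restrict_iff[OF U] by (simp add: W0_def)
  show ?thesis
  proof (cases "\<exists>v\<in>U. k v \<noteq> \<zero>\<^bsub>W\<^esub>")
    \<comment> \<open>The zero map extends by zero. It is treated apart because the other case needs
      \<open>k\<close> onto, which irreducibility gives for nonzero \<open>k\<close>.\<close>
    case False
    have "(\<lambda>_. \<zero>\<^bsub>W\<^esub>) \<in> rep_hom G V W"
      by (rule rep_homI) (simp_all add: W.act_zero)
    with False show ?thesis by (intro bexI[of _ "\<lambda>_. \<zero>\<^bsub>W\<^esub>"]) auto
  next
    case True
    then have surj: "k ` U = carrier W"
      using smooth_irrep_image[OF irr k.V.complex_rep_axioms k] by auto
    obtain C where C: "subrep G V C" "C \<inter> U = W0" "sum_set V C U = carrier V"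
    proof (rule V.maximal_complement[OF U W0])
      show "W0 \<subseteq> U" by (auto simp: W0_def)
    next
      fix C x assume C: "subrep G V C" "C \<inter> U = W0" and x: "x \<in> carrier V" "x \<notin> sum_set V C U"
      let ?T = "sum_set V C U"
      note c = V.subrepD[OF C(1)]
      note T = V.subrep_sum[OF C(1) U]
      note t = V.subrepD[OF T(1)]
      have "k x = \<zero>\<^bsub>W\<^esub>" if "x \<in> C" "x \<in> U" for x
        using C(2) that by (auto simp: W0_def)
      note glue = rep_hom_glue[OF V.complex_rep_axioms W.complex_rep_axioms C(1) U k this]
      obtain \<phi> where \<phi>: "\<phi> \<in> rep_hom G (restrict_rep V ?T) W"
        and \<phi>U: "\<And>x. x \<in> U \<Longrightarrow> \<phi> x = k x" and \<phi>C: "\<And>x. x \<in> C \<Longrightarrow> \<phi> x = \<zero>\<^bsub>W\<^esub>"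
        by (rule glue) blast+
      interpret \<phi>: rep_homomorphism G "restrict_rep V ?T" W \<phi>
        by (intro rep_homomorphism.intro rep_homomorphism_axioms.intro V.complex_rep_restrict T(1) \<phi>
            W.complex_rep_axioms)
      obtain y where y: "y \<in> carrier W"
        and sol: "\<And>a. a \<in> combs (carrier G) \<Longrightarrow> ev V a x \<in> ?T \<Longrightarrow> ev W a y = \<phi> (ev V a x)"
        using global_solution[OF V adm T(1) \<phi> x(1)] by blast
      \<comment> \<open>An extension of \<open>\<phi>\<close> may send \<open>x\<close> to
        \<open>y\<close>. As \<open>y\<close> is also the value of \<open>k\<close> at some
        \<open>v\<close> in \<open>U\<close>, the vector x - v would go to zero, so the
        subrepresentation it generates can be added to the kernel \<open>C\<close>.\<close>
      have "y \<in> k ` U" using y surj by simp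
      then obtain v where v: "v \<in> U" "k v = y" by (elim imageE) simp
      have vV: "v \<in> carrier V" by (rule u(6)[OF v(1)])
      have vT: "v \<in> ?T" by (rule subsetD[OF T(3) v(1)])
      let ?x = "x \<ominus>\<^bsub>V\<^esub> v"
      have xV: "?x \<in> carrier V" using x vV by simp
      let ?D = "sum_set V C (cyclic G V ?x)"
      note D = V.subrep_sum[OF C(1) V.subrep_cyclic[OF xV]]
      \<comment> \<open>For w = c0 + a(x - v) in \<open>U\<close>, the vector a x lies in
        \<open>?T\<close>. Evaluating \<open>\<phi>\<close> on w + a v = c0 + a x in two ways gives
        k w + a y = a y, hence k w = 0.\<close>
      have "w \<in> W0" if w: "w \<in> ?D" "w \<in> U" for w
      proof -
        obtain c0 a where ca: "c0 \<in> C" "a \<in> combs (carrier G)" "w = c0 \<oplus>\<^bsub>V\<^esub> ev V a ?x"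
          using w(1) by (auto simp: cyclic_def)
        have aU: "ev V a v \<in> U" using V.ev_mem[OF U v(1) ca(2)] .
        have c0: "c0 \<in> carrier V" "c0 \<in> ?T" using c(6)[OF ca(1)] subsetD[OF T(2) ca(1)] .
        have ax: "ev V a x \<in> carrier V" "ev V a v \<in> carrier V"
          using x vV ca(2) by (simp_all add: V.ev_closed)
        have weq: "w = (c0 \<oplus>\<^bsub>V\<^esub> ev V a x) \<ominus>\<^bsub>V\<^esub> ev V a v"
          unfolding ca(3) V.ev_minus[OF x(1) vV ca(2)] using c0(1) ax by (simp add: a_minus_def V.M.a_assoc)
        have axT: "ev V a x \<in> ?T"
        proof -
          have "w \<in> ?T" "ev V a v \<in> ?T" using subsetD[OF T(3) w(2)] subsetD[OF T(3) aU] .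
          then have "c0 \<oplus>\<^bsub>V\<^esub> ev V a x \<in> ?T"
            using weq V.subrep_cancel(3)[OF T(1), of "c0 \<oplus>\<^bsub>V\<^esub> ev V a x" "ev V a v"] c0 ax by simp
          then show ?thesis using V.subrep_cancel(2)[OF T(1) ax(1) c0(2)] by simp
        qed
        have eq: "w \<oplus>\<^bsub>V\<^esub> ev V a v = c0 \<oplus>\<^bsub>V\<^esub> ev V a x"
          unfolding weq using c0 ax by (simp add: V.add_minus_cancel)
        have "\<phi> (w \<oplus>\<^bsub>V\<^esub> ev V a v) = k w \<oplus>\<^bsub>W\<^esub> ev W a y"
        proof -
          have "w \<oplus>\<^bsub>V\<^esub> ev V a v \<in> U" by (rule u(3)[OF w(2) aU])
          then have "\<phi> (w \<oplus>\<^bsub>V\<^esub> ev V a v) = k w \<oplus>\<^bsub>W\<^esub> k (ev V a v)"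
            using k.hom_add[of w "ev V a v"] w(2) aU by (simp add: \<phi>U)
          moreover have "k (ev V a v) = ev W a (k v)"
          proof -
            have "ev (restrict_rep V U) a v = ev V a v" by (induction a) simp_all
            then show ?thesis using k.hom_ev[of v a] v(1) ca(2) by simp
          qed
          ultimately show ?thesis using v(2) by simp
        qed
        moreover have "\<phi> (c0 \<oplus>\<^bsub>V\<^esub> ev V a x) = ev W a y"
        proof -
          have "\<phi> (c0 \<oplus>\<^bsub>V\<^esub> ev V a x) = \<phi> c0 \<oplus>\<^bsub>W\<^esub> \<phi> (ev V a x)"
            using \<phi>.hom_add[of c0 "ev V a x"] c0(2) axT by simp
          also have "\<dots> = \<zero>\<^bsub>W\<^esub> \<oplus>\<^bsub>W\<^esub> ev W a y"
            by (simp only: \<phi>C[OF ca(1)] sol[OF ca(2) axT])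
          finally show ?thesis using W.ev_closed[OF y ca(2)] by simp
        qed
        ultimately have "k w \<oplus>\<^bsub>W\<^esub> ev W a y = ev W a y" using eq by simp
        moreover have "k w \<in> carrier W" using k.hom_closed[of w] w(2) by simp
        ultimately have "k w = \<zero>\<^bsub>W\<^esub>"
          using W.M.add.r_cancel_one'[of "ev W a y" "k w"] W.ev_closed[OF y ca(2)] by metis
        then show ?thesis using w(2) by (simp add: W0_def)
      qed
      then have "?D \<inter> U \<subseteq> W0" by (meson IntE subsetI)
      moreover have "W0 \<subseteq> ?D \<inter> U" unfolding C(2)[symmetric] by (intro Int_mono D(2) order_refl)
      ultimately have "?D \<inter> U = W0" by (rule equalityI)
      moreover have "?x \<in> ?D" by (rule subsetD[OF D(3) V.cyclic_self[OF xV]])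
      moreover have "?x \<notin> C"
      proof
        assume "?x \<in> C"
        then have "?x \<in> ?T" by (rule subsetD[OF T(2)])
        then have "x \<in> ?T" by (rule iffD1[OF V.subrep_cancel(3)[OF T(1) x(1) vT]])
        with x(2) show False by (rule notE)
      qed
      ultimately have "subrep G V ?D \<and> ?D \<inter> U = W0 \<and> C \<subset> ?D"
        using D(1,2) by (intro conjI psubsetI) metis+
      then show "\<exists>D. subrep G V D \<and> D \<inter> U = W0 \<and> C \<subset> D" by (rule exI)
    qed
    have "k x = \<zero>\<^bsub>W\<^esub>" if "x \<in> C" "x \<in> U" for x
      using C(2) that by (auto simp: W0_def)
    note glue = rep_hom_glue[OF V.complex_rep_axioms W.complex_rep_axioms C(1) U k this]
    obtain \<phi> where "\<phi> \<in> rep_hom G (restrict_rep V (sum_set V C U)) W" "\<And>x. x \<in> U \<Longrightarrow> \<phi> x = k x"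
      by (rule glue) blast+
    then show ?thesis using C(3) by auto
  qed
qed

section \<open>Quotients\<close>

text \<open>The axioms pass to a surjective image that respects the operations. For a quotient,
  every check is thereby reduced to representatives.\<close>

lemma complex_rep_image:
  assumes V: "complex_rep G V" and surj: "q ` carrier V = carrier Q" and zero: "q \<zero>\<^bsub>V\<^esub> = \<zero>\<^bsub>Q\<^esub>"
    and add: "\<And>x y. x \<in> carrier V \<Longrightarrow> y \<in> carrier V \<Longrightarrow> q x \<oplus>\<^bsub>Q\<^esub> q y = q (x \<oplus>\<^bsub>V\<^esub> y)"
    and smult: "\<And>c x. x \<in> carrier V \<Longrightarrow> c \<odot>\<^bsub>Q\<^esub> q x = q (c \<odot>\<^bsub>V\<^esub> x)"
    and act: "\<And>g x. g \<in> carrier G \<Longrightarrow> x \<in> carrier V \<Longrightarrow> act Q g (q x) = q (act V g x)"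
  shows "complex_rep G Q"
proof -
  interpret complex_rep G V by fact
  note [simp] = surj[symmetric] zero[symmetric] add smult act
  have "abelian_group Q"
  proof (rule abelian_groupI, goal_cases)
    case (6 x)
    then obtain v where v: "x = q v" "v \<in> carrier V" by auto
    then have "q (\<ominus>\<^bsub>V\<^esub> v) \<oplus>\<^bsub>Q\<^esub> x = q \<zero>\<^bsub>V\<^esub>"
      by (simp add: M.l_neg)
    with v show ?case by auto
  qed (auto simp: M.a_ac)
  then have "Module.module complex_field Q"
    by (intro moduleI complex_field_cring)
      (auto simp: smult_add_left smult_add_right smult_smult)
  then show ?thesis
    by (intro complex_rep.intro complex_rep_axioms.intro G.is_group)
      (auto simp: act_closed act_add act_smult act_one act_mult)
qed

context complex_rep
begin

lemma minus_zero: "x \<in> carrier V \<Longrightarrow> x \<ominus>\<^bsub>V\<^esub> \<zero>\<^bsub>V\<^esub> = x"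
  by (simp add: a_minus_def neg_eq_smult)

lemma minus_add_minus:
  "x \<in> carrier V \<Longrightarrow> y \<in> carrier V \<Longrightarrow> z \<in> carrier V \<Longrightarrow> (z \<ominus>\<^bsub>V\<^esub> x) \<oplus>\<^bsub>V\<^esub> (x \<ominus>\<^bsub>V\<^esub> y) = z \<ominus>\<^bsub>V\<^esub> y"
  by (simp add: a_minus_def M.a_assoc M.r_neg1)

lemma minus_sym:
  assumes "subrep G V W" "x \<in> carrier V" "y \<in> carrier V" "x \<ominus>\<^bsub>V\<^esub> y \<in> W"
  shows "y \<ominus>\<^bsub>V\<^esub> x \<in> W"
proof -
  have "(x \<ominus>\<^bsub>V\<^esub> y) \<oplus>\<^bsub>V\<^esub> (y \<ominus>\<^bsub>V\<^esub> x) = \<zero>\<^bsub>V\<^esub>"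
    using minus_add_minus[of y x x] minus_eq_zero_iff[of x x] assms by simp
  then show ?thesis
    using subrep_cancel(2)[OF assms(1), of "y \<ominus>\<^bsub>V\<^esub> x" "x \<ominus>\<^bsub>V\<^esub> y"] subrepD(2)[OF assms(1)] assms by simp
qed

lemma coset_iff:
  assumes "subrep G V W" "x \<in> carrier V"
  shows "z \<in> W +>\<^bsub>V\<^esub> x \<longleftrightarrow> z \<in> carrier V \<and> z \<ominus>\<^bsub>V\<^esub> x \<in> W"
proof
  assume "z \<in> W +>\<^bsub>V\<^esub> x"
  then obtain w where "w \<in> W" "z = w \<oplus>\<^bsub>V\<^esub> x" by (auto simp: a_r_coset_def')
  then show "z \<in> carrier V \<and> z \<ominus>\<^bsub>V\<^esub> x \<in> W"
    using assms(2) subrepD(6)[OF assms(1)] by (simp add: add_minus_cancel)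
next
  assume "z \<in> carrier V \<and> z \<ominus>\<^bsub>V\<^esub> x \<in> W"
  then show "z \<in> W +>\<^bsub>V\<^esub> x"
    using add_minus_cancel(1)[of z x] assms(2) by (auto simp: a_r_coset_def' intro!: bexI[of _ "z \<ominus>\<^bsub>V\<^esub> x"])
qed

lemma coset_self: "subrep G V W \<Longrightarrow> x \<in> carrier V \<Longrightarrow> x \<in> W +>\<^bsub>V\<^esub> x"
  using minus_eq_zero_iff[of x x] by (simp add: coset_iff subrepD(2))

lemma coset_eq_iff:
  assumes W: "subrep G V W" and x: "x \<in> carrier V" and y: "y \<in> carrier V"
  shows "W +>\<^bsub>V\<^esub> x = W +>\<^bsub>V\<^esub> y \<longleftrightarrow> x \<ominus>\<^bsub>V\<^esub> y \<in> W"
proof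
  assume "W +>\<^bsub>V\<^esub> x = W +>\<^bsub>V\<^esub> y"
  then show "x \<ominus>\<^bsub>V\<^esub> y \<in> W" using coset_self[OF W x] by (simp add: coset_iff[OF W y])
next
  have *: "W +>\<^bsub>V\<^esub> x \<subseteq> W +>\<^bsub>V\<^esub> y" if "x \<ominus>\<^bsub>V\<^esub> y \<in> W" "x \<in> carrier V" "y \<in> carrier V" for x y
  proof
    fix z assume "z \<in> W +>\<^bsub>V\<^esub> x"
    then have z: "z \<in> carrier V" "z \<ominus>\<^bsub>V\<^esub> x \<in> W" using that by (simp_all add: coset_iff[OF W])
    then have "(z \<ominus>\<^bsub>V\<^esub> x) \<oplus>\<^bsub>V\<^esub> (x \<ominus>\<^bsub>V\<^esub> y) \<in> W" using that by (intro subrepD(3)[OF W])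
    then show "z \<in> W +>\<^bsub>V\<^esub> y" using z that by (simp add: coset_iff[OF W] minus_add_minus)
  qed
  assume "x \<ominus>\<^bsub>V\<^esub> y \<in> W"
  then show "W +>\<^bsub>V\<^esub> x = W +>\<^bsub>V\<^esub> y"
    using *[of x y] *[of y x] minus_sym[OF W x y] x y by (intro equalityI) simp_all
qed

text \<open>The operations of \<open>quot_rep\<close> are unions over all representatives of a
  coset; independence of the representative collapses such a union to one value.\<close>

lemma coset_Union:
  assumes "subrep G V W" "x \<in> carrier V"
    and "\<And>y. y \<in> carrier V \<Longrightarrow> y \<ominus>\<^bsub>V\<^esub> x \<in> W \<Longrightarrow> F y = F x"
  shows "(\<Union>y\<in>W +>\<^bsub>V\<^esub> x. F y) = F x"
proof (rule SUP_eq_const)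
  show "W +>\<^bsub>V\<^esub> x \<noteq> {}" using coset_self[OF assms(1,2)] by (metis empty_iff)
next
  fix y assume "y \<in> W +>\<^bsub>V\<^esub> x"
  then have "y \<in> carrier V \<and> y \<ominus>\<^bsub>V\<^esub> x \<in> W" by (rule iffD1[OF coset_iff[OF assms(1,2)]])
  then show "F y = F x" by (elim conjE) (rule assms(3))
qed

lemma quot_rep_simps:
  assumes W: "subrep G V W"
  shows "carrier (quot_rep V W) = (\<lambda>v. W +>\<^bsub>V\<^esub> v) ` carrier V"
    "\<zero>\<^bsub>quot_rep V W\<^esub> = W +>\<^bsub>V\<^esub> \<zero>\<^bsub>V\<^esub>"
    "\<And>x y. x \<in> carrier V \<Longrightarrow> y \<in> carrier V \<Longrightarrow>
      (W +>\<^bsub>V\<^esub> x) \<oplus>\<^bsub>quot_rep V W\<^esub> (W +>\<^bsub>V\<^esub> y) = W +>\<^bsub>V\<^esub> (x \<oplus>\<^bsub>V\<^esub> y)"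
    "\<And>c x. x \<in> carrier V \<Longrightarrow> c \<odot>\<^bsub>quot_rep V W\<^esub> (W +>\<^bsub>V\<^esub> x) = W +>\<^bsub>V\<^esub> (c \<odot>\<^bsub>V\<^esub> x)"
    "\<And>g x. g \<in> carrier G \<Longrightarrow> x \<in> carrier V \<Longrightarrow>
      act (quot_rep V W) g (W +>\<^bsub>V\<^esub> x) = W +>\<^bsub>V\<^esub> act V g x"
proof -
  show "carrier (quot_rep V W) = (\<lambda>v. W +>\<^bsub>V\<^esub> v) ` carrier V"
    by (auto simp: quot_rep_def A_RCOSETS_def')
  have "W = W +>\<^bsub>V\<^esub> \<zero>\<^bsub>V\<^esub>"
    using subrepD(6)[OF W] by (auto simp: coset_iff[OF W] minus_zero)
  then show "\<zero>\<^bsub>quot_rep V W\<^esub> = W +>\<^bsub>V\<^esub> \<zero>\<^bsub>V\<^esub>" by (simp add: quot_rep_def)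
  have "subgroup W (add_monoid V)"
    using W by (auto simp: subrep_def dest: submodule.axioms(1))
  then interpret W: abelian_subgroup W V
    by (intro abelian_subgroupI3 additive_subgroup.intro M.abelian_group_axioms)
  show "(W +>\<^bsub>V\<^esub> x) \<oplus>\<^bsub>quot_rep V W\<^esub> (W +>\<^bsub>V\<^esub> y) = W +>\<^bsub>V\<^esub> (x \<oplus>\<^bsub>V\<^esub> y)"
    if "x \<in> carrier V" "y \<in> carrier V" for x y
    using W.a_rcos_sum[OF that] by (simp add: quot_rep_def)
  show "c \<odot>\<^bsub>quot_rep V W\<^esub> (W +>\<^bsub>V\<^esub> x) = W +>\<^bsub>V\<^esub> (c \<odot>\<^bsub>V\<^esub> x)" if x: "x \<in> carrier V" for c x
  proof -
    have "W +>\<^bsub>V\<^esub> (c \<odot>\<^bsub>V\<^esub> y) = W +>\<^bsub>V\<^esub> (c \<odot>\<^bsub>V\<^esub> x)" if "y \<in> carrier V" "y \<ominus>\<^bsub>V\<^esub> x \<in> W" for y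
    proof -
      have "c \<odot>\<^bsub>V\<^esub> y \<ominus>\<^bsub>V\<^esub> c \<odot>\<^bsub>V\<^esub> x = c \<odot>\<^bsub>V\<^esub> (y \<ominus>\<^bsub>V\<^esub> x)"
        using x that by (simp add: a_minus_def neg_eq_smult smult_add_right smult_smult)
      then show ?thesis using x that subrepD(4)[OF W that(2), of c] by (simp add: coset_eq_iff[OF W])
    qed
    then show ?thesis
      unfolding quot_rep_def using coset_Union[OF W x, of "\<lambda>y. W +>\<^bsub>V\<^esub> (c \<odot>\<^bsub>V\<^esub> y)"] by simp
  qed
  show "act (quot_rep V W) g (W +>\<^bsub>V\<^esub> x) = W +>\<^bsub>V\<^esub> act V g x"
    if g: "g \<in> carrier G" and x: "x \<in> carrier V" for g x
  proof -
    have "W +>\<^bsub>V\<^esub> act V g y = W +>\<^bsub>V\<^esub> act V g x" if "y \<in> carrier V" "y \<ominus>\<^bsub>V\<^esub> x \<in> W" for y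
    proof -
      have "act V g y \<ominus>\<^bsub>V\<^esub> act V g x = act V g (y \<ominus>\<^bsub>V\<^esub> x)"
        using g x that by (simp add: a_minus_def neg_eq_smult act_add act_smult act_closed)
      then show ?thesis using g x that subrepD(5)[OF W g that(2)] by (simp add: coset_eq_iff[OF W] act_closed)
    qed
    then show ?thesis
      unfolding quot_rep_def using coset_Union[OF W x, of "\<lambda>y. W +>\<^bsub>V\<^esub> act V g y"] by simp
  qed
qed

lemma complex_rep_quot:
  assumes "subrep G V W"
  shows "complex_rep G (quot_rep V W)"
  by (rule complex_rep_image[OF complex_rep_axioms, where q = "\<lambda>v. W +>\<^bsub>V\<^esub> v"])
    (simp_all add: quot_rep_simps[OF assms])

lemma quot_hom: "subrep G V W \<Longrightarrow> (\<lambda>v. W +>\<^bsub>V\<^esub> v) \<in> rep_hom G V (quot_rep V W)"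
  by (rule rep_homI) (simp_all add: quot_rep_simps)

lemma quot_eq_zero_iff:
  assumes "subrep G V W" "x \<in> carrier V"
  shows "W +>\<^bsub>V\<^esub> x = \<zero>\<^bsub>quot_rep V W\<^esub> \<longleftrightarrow> x \<in> W"
  using assms by (simp add: quot_rep_simps coset_eq_iff minus_zero)

end

text \<open>Whatever fixes a representative fixes its coset, so the stabilizer of the coset contains
  an open stabilizer.\<close>

lemma (in topological_group) smooth_quot:
  assumes V: "smooth_rep G X V" and W: "subrep G V W"
  shows "smooth_rep G X (quot_rep V W)"
proof -
  interpret V: complex_rep G V by (rule smooth_repD(1)[OF V])
  have "openin X (stabilizer G (act (quot_rep V W)) y)" if y: "y \<in> carrier (quot_rep V W)" for y
  proof -
    obtain v where v: "v \<in> carrier V" "y = W +>\<^bsub>V\<^esub> v" using y by (auto simp: V.quot_rep_simps[OF W])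
    show ?thesis
      by (rule openin_stabilizer_mono[OF V v(1) V.complex_rep_quot[OF W] y])
        (auto simp: stabilizer_def v V.quot_rep_simps[OF W])
  qed
  then show ?thesis using V.complex_rep_quot[OF W] by (simp add: smooth_rep_def)
qed


section \<open>Separation by irreducible representations\<close>

text \<open>An irreducible subquotient that sees \<open>y\<close> is cut out by Zorn's lemma: if
  \<open>C\<close> is maximal among the subrepresentations that contain \<open>U\<close> and avoid
  \<open>y\<close>, and \<open>T\<close> is generated by \<open>C\<close> and \<open>y\<close>, then
  T/C is irreducible. Its quotient map, viewed as a map to some \<pi>, is extended from
  \<open>T\<close> to \<open>V\<close> by injectivity.\<close>

lemma (in lc_group) dual_separates:
  assumes tame: "tame G X" and V: "smooth_rep G X V" and U: "subrep G V U"
    and y: "y \<in> carrier V" "y \<notin> U"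
  shows "\<exists>\<pi>\<in>smooth_dual G X. \<exists>k\<in>rep_hom G V \<pi>. (\<forall>u\<in>U. k u = \<zero>\<^bsub>\<pi>\<^esub>) \<and> k y \<noteq> \<zero>\<^bsub>\<pi>\<^esub>"
proof -
  interpret V: complex_rep G V by (rule smooth_repD(1)[OF V])
  let ?A = "{C. subrep G V C \<and> U \<subseteq> C \<and> y \<notin> C}"
  have "\<exists>C\<in>?A. \<forall>D\<in>?A. C \<subseteq> D \<longrightarrow> D = C"
  proof (rule subset_Zorn_nonempty)
    show "?A \<noteq> {}" using U y by blast
  next
    fix \<C> assume c: "\<C> \<noteq> {}" "subset.chain ?A \<C>"
    then have "subrep G V (\<Union>\<C>)"
      by (intro V.subrep_Union_chain[of \<C> ?A]) (auto simp: subset_chain_def)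
    moreover have "U \<subseteq> \<Union>\<C>" "y \<notin> \<Union>\<C>" using c unfolding subset_chain_def by blast+
    ultimately show "\<Union>\<C> \<in> ?A" by simp
  qed
  then obtain C where CA: "C \<in> ?A" and max': "\<forall>D\<in>?A. C \<subseteq> D \<longrightarrow> D = C" by (elim bexE)
  then have C: "subrep G V C" "U \<subseteq> C" "y \<notin> C" by simp_all
  have max: "D = C" if "subrep G V D" "y \<notin> D" "C \<subseteq> D" for D
    using bspec[OF max', of D] that C(2) by simp
  define T where "T = sum_set V C (cyclic G V y)"
  have T: "subrep G V T" "C \<subseteq> T" "cyclic G V y \<subseteq> T"
    unfolding T_def by (rule V.subrep_sum[OF C(1) V.subrep_cyclic[OF y(1)]])+
  have T_min: "T \<subseteq> S" if S: "subrep G V S" "C \<subseteq> S" "y \<in> S" for S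
  proof
    fix t assume "t \<in> T"
    then obtain c v where "t = c \<oplus>\<^bsub>V\<^esub> v" "c \<in> C" "v \<in> cyclic G V y" unfolding T_def by blast
    then show "t \<in> S"
      using V.subrepD(3)[OF S(1), of c v] subsetD[OF S(2)] subsetD[OF V.cyclic_subset[OF S(1,3)]] by simp
  qed
  have yT: "y \<in> T" by (rule subsetD[OF T(3) V.cyclic_self[OF y(1)]])
  let ?T = "restrict_rep V T"
  let ?Q = "quot_rep ?T C"
  let ?q = "\<lambda>v. C +>\<^bsub>?T\<^esub> v"
  have sT: "smooth_rep G X ?T" by (rule smooth_restrict[OF V T(1)])
  interpret T: complex_rep G ?T by (rule smooth_repD(1)[OF sT])
  have CT: "subrep G ?T C" using V.subrep_restrict_iff[OF T(1)] C(1) T(2) by simp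
  interpret Q: complex_rep G ?Q by (rule T.complex_rep_quot[OF CT])
  interpret q: rep_homomorphism G ?T ?Q ?q
    by (intro rep_homomorphism.intro rep_homomorphism_axioms.intro T.quot_hom CT
        T.complex_rep_axioms Q.complex_rep_axioms)
  have q_zero: "?q v = \<zero>\<^bsub>?Q\<^esub> \<longleftrightarrow> v \<in> C" if "v \<in> T" for v
    using T.quot_eq_zero_iff[OF CT] that by simp
  have irr: "smooth_irrep G X ?Q"
    unfolding smooth_irrep_def
  proof (intro conjI allI impI)
    show "smooth_rep G X ?Q" by (rule smooth_quot[OF sT CT])
    have "?q y \<in> carrier ?Q" "?q y \<noteq> \<zero>\<^bsub>?Q\<^esub>" using q.hom_closed[of y] yT q_zero[OF yT] C(3) by simp_all
    then show "carrier ?Q \<noteq> {\<zero>\<^bsub>?Q\<^esub>}" by auto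
  next
    fix S assume S: "subrep G ?Q S"
    \<comment> \<open>The preimage of \<open>S\<close> contains \<open>C\<close>. If it contains
      \<open>y\<close> it is all of \<open>T\<close>; otherwise maximality makes it equal to
      \<open>C\<close>.\<close>
    let ?S = "{v \<in> T. ?q v \<in> S}"
    have S': "subrep G V ?S" "?S \<subseteq> T"
      using q.subrep_vimage[OF S] V.subrep_restrict_iff[OF T(1), of ?S] by simp_all
    have CS: "C \<subseteq> ?S"
    proof
      fix c assume c: "c \<in> C"
      then have "c \<in> T" by (rule subsetD[OF T(2)])
      with c show "c \<in> ?S" using iffD2[OF q_zero, of c] Q.subrepD(2)[OF S] by simp
    qed
    have im: "S = ?q ` ?S"
      using Q.subrepD(1)[OF S] T.quot_rep_simps(1)[OF CT] by auto
    show "S = {\<zero>\<^bsub>?Q\<^esub>} \<or> S = carrier ?Q"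
    proof (cases "y \<in> ?S")
      case True
      then have "?S = T" using T_min[OF S'(1) CS] S'(2) by (intro equalityI)
      then show ?thesis using im T.quot_rep_simps(1)[OF CT] by simp
    next
      case False
      then have "?S = C" by (rule max[OF S'(1) _ CS])
      then have "S = ?q ` C" using im by simp
      also have "\<dots> = {\<zero>\<^bsub>?Q\<^esub>}"
      proof
        show "?q ` C \<subseteq> {\<zero>\<^bsub>?Q\<^esub>}"
        proof (intro image_subsetI)
          fix c assume c: "c \<in> C"
          then have "c \<in> T" by (rule subsetD[OF T(2)])
          then show "?q c \<in> {\<zero>\<^bsub>?Q\<^esub>}" using iffD2[OF q_zero c] by simp
        qed
        show "{\<zero>\<^bsub>?Q\<^esub>} \<subseteq> ?q ` C"
          using V.subrepD(2)[OF C(1)] T.quot_rep_simps(2)[OF CT] by simp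
      qed
      finally show ?thesis by simp
    qed
  qed
  \<comment> \<open>The quotient lives on sets of vectors; an isomorphic copy in
    \<open>smooth_dual\<close> is needed for tameness to apply.\<close>
  obtain \<pi> h where \<pi>: "\<pi> \<in> smooth_dual G X" and h: "h \<in> rep_hom G ?Q \<pi>" "bij_betw h (carrier ?Q) (carrier \<pi>)"
    using smooth_dual_exhaustive[OF irr] by blast
  have irr\<pi>: "smooth_irrep G X \<pi>" and adm: "admissible_rep G X \<pi>"
    using \<pi> tame by (simp_all add: smooth_dual_def tame_def)
  have s\<pi>: "smooth_rep G X \<pi>" using adm by (simp add: admissible_rep_def)
  interpret h: rep_homomorphism G ?Q \<pi> h
    by (intro rep_homomorphism.intro rep_homomorphism_axioms.intro smooth_repD(1)[OF s\<pi>] h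
        Q.complex_rep_axioms)
  obtain k where k: "k \<in> rep_hom G V \<pi>" "\<And>t. t \<in> T \<Longrightarrow> k t = h (?q t)"
    using irrep_hom_extends[OF V adm irr\<pi> T(1) rep_hom_comp[OF q.hom h(1)]] by blast
  have "k u = \<zero>\<^bsub>\<pi>\<^esub>" if "u \<in> U" for u
  proof -
    have "u \<in> C" "u \<in> T" using that C(2) T(2) by blast+
    then show ?thesis using k(2)[of u] q_zero[of u] h.hom_zero by simp
  qed
  moreover have "k y \<noteq> \<zero>\<^bsub>\<pi>\<^esub>"
  proof
    assume "k y = \<zero>\<^bsub>\<pi>\<^esub>"
    then have "h (?q y) = h \<zero>\<^bsub>?Q\<^esub>" using k(2)[OF yT] h.hom_zero by simp
    moreover have "?q y \<in> carrier ?Q" using q.hom_closed[of y] yT by simp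
    ultimately have "?q y = \<zero>\<^bsub>?Q\<^esub>"
      using h(2) Q.M.zero_closed by (metis bij_betw_def inj_onD)
    then show False using q_zero[OF yT] C(3) by simp
  qed
  ultimately show ?thesis using \<pi> k(1) by blast
qed

section \<open>Semisimplicity of representations separated by homomorphisms to one
  irreducible\<close>

text \<open>The homomorphisms to \<pi> embed \<open>S\<close> into a product of copies of \<pi>. The
  product may be infinite, so semisimplicity is not immediate.\<close>

definition separated :: "('g, 'b) monoid_scheme \<Rightarrow> ('g, 'w) rep \<Rightarrow> ('g, 'v) rep \<Rightarrow> bool" where
  "separated G \<pi> S \<longleftrightarrow> (\<forall>s\<in>carrier S. s \<noteq> \<zero>\<^bsub>S\<^esub> \<longrightarrow> (\<exists>h\<in>rep_hom G S \<pi>. h s \<noteq> \<zero>\<^bsub>\<pi>\<^esub>))"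

text \<open>Finitely many \<open>h\<^sub>i : S \<rightarrow> \<pi>\<close> have values \<open>h\<^sub>i x\<close> spanning all \<open>h x\<close> (these lie in some
  \<open>\<pi>\<^sup>K\<close>), hence they embed the subrepresentation generated by \<open>x\<close> into a finite power of \<open>\<pi>\<close>.\<close>

lemma (in lc_group) finite_separating_homs:
  assumes S: "smooth_rep G X S" and adm: "admissible_rep G X \<pi>" and sep: "separated G \<pi> S"
    and x: "x \<in> carrier S"
  shows "\<exists>F\<subseteq>rep_hom G S \<pi>. finite F \<and>
    (\<forall>e\<in>cyclic G S x. (\<forall>h\<in>F. h e = \<zero>\<^bsub>\<pi>\<^esub>) \<longrightarrow> e = \<zero>\<^bsub>S\<^esub>)"
proof -
  have s\<pi>: "smooth_rep G X \<pi>" using adm by (simp add: admissible_rep_def)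
  interpret S: complex_rep G S by (rule smooth_repD(1)[OF S])
  interpret P: complex_rep G \<pi> by (rule smooth_repD(1)[OF s\<pi>])
  let ?G = "G\<lparr>carrier := {\<one>}\<rparr>"
  interpret P1: complex_rep ?G \<pi> by (rule P.subgroup_complex_rep[OF triv_subgroup])
  obtain K where K: "compact_open_subgroup G X K" and Kx: "\<And>k. k \<in> K \<Longrightarrow> act S k x = x"
    by (rule compact_open_fixing[OF S x]) blast
  have KG: "k \<in> carrier G" if "k \<in> K" for k
    using K that subgroup.subset by (auto simp: compact_open_subgroup_def)
  let ?W = "fixed_vectors \<pi> K" and ?H = "rep_hom G S \<pi>"
  have fd: "finite_dimensional \<pi> ?W" using adm K by (simp add: admissible_rep_def)
  have W: "subrep ?G \<pi> ?W"
    by (rule P1.subrepI)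
      (auto simp: fixed_vectors_def KG P.act_zero P.act_add P.act_smult P.act_one)
  have A: "(\<lambda>h. h x) ` ?H \<subseteq> ?W"
  proof (intro image_subsetI)
    fix h assume h: "h \<in> ?H"
    have "act \<pi> k (h x) = h x" if "k \<in> K" for k
      using rep_homD(4)[OF h KG[OF that] x] Kx[OF that] by simp
    then show "h x \<in> ?W" using rep_homD(1)[OF h x] by (simp add: fixed_vectors_def)
  qed
  obtain F0 where F0: "finite F0" "F0 \<subseteq> (\<lambda>h. h x) ` ?H"
    and gen: "\<And>Z. subrep ?G \<pi> Z \<Longrightarrow> F0 \<subseteq> Z \<Longrightarrow> (\<lambda>h. h x) ` ?H \<subseteq> Z"
    by (rule P1.finite_dimensional_generators[OF fd W A]) blast
  obtain F where F: "F \<subseteq> ?H" "finite F" "F0 = (\<lambda>h. h x) ` F"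
    using finite_subset_image[OF F0] by blast
  have "e = \<zero>\<^bsub>S\<^esub>" if e: "e \<in> cyclic G S x" "\<forall>h\<in>F. h e = \<zero>\<^bsub>\<pi>\<^esub>" for e
  proof (rule ccontr)
    assume ne: "e \<noteq> \<zero>\<^bsub>S\<^esub>"
    obtain a where a: "a \<in> combs (carrier G)" "e = ev S a x" using e(1) by (auto simp: cyclic_def)
    have eS: "e \<in> carrier S" using a x by (simp add: S.ev_closed)
    then obtain h where h: "h \<in> ?H" "h e \<noteq> \<zero>\<^bsub>\<pi>\<^esub>"
      using sep ne unfolding separated_def by blast
    have h_ev: "k e = ev \<pi> a (k x)" if "k \<in> ?H" for k
    proof -
      interpret k: rep_homomorphism G S \<pi> k
        by (intro rep_homomorphism.intro rep_homomorphism_axioms.intro that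
            S.complex_rep_axioms P.complex_rep_axioms)
      show ?thesis using k.hom_ev[OF x a(1)] a(2) by simp
    qed
    \<comment> \<open>For e = a x, the condition h e = 0 says that \<open>h x\<close> lies in the
      linear subspace \<open>?Z\<close>. It therefore passes from the generators \<open>F0\<close>
      to the values at \<open>x\<close> of all homomorphisms.\<close>
    let ?Z = "{w \<in> carrier \<pi>. ev \<pi> a w = \<zero>\<^bsub>\<pi>\<^esub>}"
    have "subrep ?G \<pi> ?Z"
    proof (rule P1.subrepI)
      have "ev \<pi> a \<zero>\<^bsub>\<pi>\<^esub> \<in> {\<zero>\<^bsub>\<pi>\<^esub>}" by (rule P.ev_mem[OF P.subrep_zero _ a(1)]) simp
      then show "\<zero>\<^bsub>\<pi>\<^esub> \<in> ?Z" by simp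
    qed (use a(1) in \<open>auto simp: P.ev_add P.ev_smult P.act_one\<close>)
    moreover have "F0 \<subseteq> ?Z"
      unfolding F(3)
    proof (intro image_subsetI)
      fix k assume "k \<in> F"
      then show "k x \<in> ?Z" using F(1) h_ev[of k] e(2) rep_homD(1)[of k G S \<pi> x] x by auto
    qed
    ultimately have "h x \<in> ?Z" using gen h(1) by blast
    then show False using h_ev[OF h(1)] h(2) by simp
  qed
  with F show ?thesis by blast
qed

text \<open>The cyclic subrepresentation \<open>E\<close> of \<open>x\<close> is a sum of finitely
  many copies \<open>D h\<close> of \<pi>. As \<open>x\<close> is outside \<open>T\<close>, some
  copy is not contained in \<open>T\<close>, and being irreducible it meets \<open>T\<close> in
  zero.\<close>

lemma (in lc_group) exists_disjoint_subrep:
  assumes S: "smooth_rep G X S" and adm: "admissible_rep G X \<pi>" and irr: "smooth_irrep G X \<pi>"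
    and sep: "separated G \<pi> S" and T: "subrep G S T" and x: "x \<in> carrier S" "x \<notin> T"
  shows "\<exists>D. subrep G S D \<and> D \<inter> T = {\<zero>\<^bsub>S\<^esub>} \<and> D \<noteq> {\<zero>\<^bsub>S\<^esub>}"
proof -
  have s\<pi>: "smooth_rep G X \<pi>" using adm by (simp add: admissible_rep_def)
  interpret S: complex_rep G S by (rule smooth_repD(1)[OF S])
  interpret P: complex_rep G \<pi> by (rule smooth_repD(1)[OF s\<pi>])
  have hom: "rep_homomorphism G S \<pi> h" if "h \<in> rep_hom G S \<pi>" for h
    by (intro rep_homomorphism.intro rep_homomorphism_axioms.intro that
        S.complex_rep_axioms P.complex_rep_axioms)
  define E where "E = cyclic G S x"
  have E: "subrep G S E" "x \<in> E"
    unfolding E_def by (rule S.subrep_cyclic[OF x(1)], rule S.cyclic_self[OF x(1)])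
  note e = S.subrepD[OF E(1)]
  define Sep where "Sep F \<longleftrightarrow> F \<subseteq> rep_hom G S \<pi> \<and> finite F \<and>
    (\<forall>e\<in>E. (\<forall>h\<in>F. h e = \<zero>\<^bsub>\<pi>\<^esub>) \<longrightarrow> e = \<zero>\<^bsub>S\<^esub>)" for F
  have "\<exists>F. Sep F"
    using finite_separating_homs[OF S adm sep x(1)] unfolding Sep_def E_def by blast
  \<comment> \<open>A smallest separating family is irredundant: without \<open>h\<close> some
    nonzero vector of \<open>E\<close> is killed by all the others. This makes \<open>D h\<close>
    nonzero.\<close>
  then have "\<exists>F. Sep F \<and> (\<forall>F'. Sep F' \<longrightarrow> card F \<le> card F')"
    using ex_has_least_nat[of Sep _ card] by blast
  then obtain F where F: "Sep F" and min: "\<And>F'. Sep F' \<Longrightarrow> card F \<le> card F'" by blast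
  have FH: "h \<in> rep_hom G S \<pi>" if "h \<in> F" for h using that F unfolding Sep_def by blast
  have Ffin: "finite F" using F unfolding Sep_def by blast
  have F_sep: "v = \<zero>\<^bsub>S\<^esub>" if "v \<in> E" "\<And>h. h \<in> F \<Longrightarrow> h v = \<zero>\<^bsub>\<pi>\<^esub>" for v
    using that F unfolding Sep_def by blast
  \<comment> \<open>The part of \<open>E\<close> on which every member of \<open>F\<close> other
    than \<open>h\<close> vanishes. Separation makes \<open>h\<close> injective on it and
    irreducibility makes \<open>h\<close> onto, so it is a copy of \<pi>.\<close>
  define D where "D h = {v \<in> E. \<forall>k\<in>F - {h}. k v = \<zero>\<^bsub>\<pi>\<^esub>}" for h
  have D_subrep: "subrep G S (D h)" for h
  proof -
    let ?N = "\<lambda>k. {v \<in> carrier S. k v = \<zero>\<^bsub>\<pi>\<^esub>}"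
    have "subrep G S (\<Inter>(insert E (?N ` (F - {h}))))"
    proof (rule S.subrep_Inter)
      fix Z assume "Z \<in> insert E (?N ` (F - {h}))"
      then consider "Z = E" | k where "k \<in> F" "Z = ?N k" by blast
      then show "subrep G S Z"
        using E(1) rep_homomorphism.subrep_kernel[OF hom[OF FH]] by cases simp_all
    qed simp
    moreover have "\<Inter>(insert E (?N ` (F - {h}))) = D h"
      using e(1) by (auto simp: D_def)
    ultimately show ?thesis by simp
  qed
  have D_inj: "v = \<zero>\<^bsub>S\<^esub>" if "h \<in> F" "v \<in> D h" "h v = \<zero>\<^bsub>\<pi>\<^esub>" for h v
    using that by (intro F_sep) (auto simp: D_def)
  have D_ne: "\<exists>v\<in>D h. h v \<noteq> \<zero>\<^bsub>\<pi>\<^esub>" if h: "h \<in> F" for h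
  proof (rule ccontr)
    assume neg: "\<not> ?thesis"
    have "v = \<zero>\<^bsub>S\<^esub>" if "v \<in> E" "\<forall>k\<in>F - {h}. k v = \<zero>\<^bsub>\<pi>\<^esub>" for v
    proof -
      have "v \<in> D h" using that by (simp add: D_def)
      then show ?thesis using D_inj[OF h] neg by blast
    qed
    then have "Sep (F - {h})" using F unfolding Sep_def by blast
    then have "card F \<le> card (F - {h})" by (rule min)
    then show False using h Ffin card_Diff1_less[of F h] by simp
  qed
  have image: "h ` Z = carrier \<pi>" if "h \<in> F" "subrep G S Z" "v \<in> Z" "h v \<noteq> \<zero>\<^bsub>\<pi>\<^esub>" for h Z v
    using smooth_irrep_image[OF irr S.complex_rep_restrict[OF that(2)]
        rep_hom_subset[OF FH[OF that(1)] S.subrepD(1)[OF that(2)]], of v] that by simp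
  have D_image: "h ` D h = carrier \<pi>" if h: "h \<in> F" for h
  proof -
    obtain v where "v \<in> D h" "h v \<noteq> \<zero>\<^bsub>\<pi>\<^esub>" using D_ne[OF h] by blast
    then show ?thesis by (rule image[OF h D_subrep])
  qed
  have sum: "v \<in> T" if sub: "\<And>h. h \<in> F \<Longrightarrow> D h \<subseteq> T" and v: "v \<in> E" for v
  proof -
    \<comment> \<open>\<open>J\<close> holds the members of \<open>F\<close> that may be nonzero at
      \<open>v\<close>. Subtracting a vector of \<open>D h\<close> with the same value under
      \<open>h\<close> removes \<open>h\<close> from this set and leaves the values of the other
      members unchanged.\<close>
    have "v \<in> T" if "finite J" "v \<in> E" "\<And>h. h \<in> F \<Longrightarrow> h \<notin> J \<Longrightarrow> h v = \<zero>\<^bsub>\<pi>\<^esub>" for J v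
      using that
    proof (induction J arbitrary: v)
      case empty
      then have "v = \<zero>\<^bsub>S\<^esub>" by (intro F_sep) auto
      then show ?case using S.subrepD(2)[OF T] by simp
    next
      case (insert h J)
      show ?case
      proof (cases "h \<in> F")
        case False
        then show ?thesis using insert by (metis insertE)
      next
        case True
        have vS: "v \<in> carrier S" using insert.prems e(6) by blast
        have "h v \<in> h ` D h" using rep_homD(1)[OF FH[OF True] vS] D_image[OF True] by simp
        then obtain d where d: "d \<in> D h" "h d = h v" by (elim imageE) simp
        have dE: "d \<in> E" and dS: "d \<in> carrier S" using d(1) e(6) by (auto simp: D_def)
        have "v \<ominus>\<^bsub>S\<^esub> d \<in> T"
        proof (rule insert.IH)
          show "v \<ominus>\<^bsub>S\<^esub> d \<in> E" using S.subrep_minus[OF E(1)] insert.prems dE by blast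
        next
          fix k assume k: "k \<in> F" "k \<notin> J"
          interpret k: rep_homomorphism G S \<pi> k by (rule hom[OF FH[OF k(1)]])
          have "k v = k d"
            using d k insert.prems(2)[of k] by (cases "k = h") (auto simp: D_def)
          then show "k (v \<ominus>\<^bsub>S\<^esub> d) = \<zero>\<^bsub>\<pi>\<^esub>" using k.hom_eq_iff[OF vS dS] by simp
        qed
        moreover have "d \<in> T" using sub[OF True] d(1) by blast
        ultimately show ?thesis using S.subrep_cancel(3)[OF T vS] by simp
      qed
    qed
    from this[OF Ffin v] show ?thesis by blast
  qed
  obtain h where h: "h \<in> F" "\<not> D h \<subseteq> T"
    using sum[OF _ E(2)] x(2) by blast
  interpret h: rep_homomorphism G S \<pi> h by (rule hom[OF FH[OF h(1)]])
  have DT: "subrep G S (D h \<inter> T)" by (rule S.subrep_Int[OF D_subrep T])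
  \<comment> \<open>A nonzero intersection with \<open>T\<close> would already have all of \<pi> as
    its image under \<open>h\<close>; since \<open>h\<close> is injective on \<open>D h\<close>, it
    would be all of \<open>D h\<close>.\<close>
  have "v = \<zero>\<^bsub>S\<^esub>" if v: "v \<in> D h \<inter> T" for v
  proof (rule ccontr)
    assume "v \<noteq> \<zero>\<^bsub>S\<^esub>"
    then have "h v \<noteq> \<zero>\<^bsub>\<pi>\<^esub>" using D_inj[OF h(1)] v by blast
    then have im: "h ` (D h \<inter> T) = carrier \<pi>" by (rule image[OF h(1) DT v])
    have "D h \<subseteq> T"
    proof
      fix d assume d: "d \<in> D h"
      have dS: "d \<in> carrier S" by (rule S.subrepD(6)[OF D_subrep d])
      then have "h d \<in> h ` (D h \<inter> T)" using im h.hom_closed by simp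
      then obtain t where t: "t \<in> D h" "t \<in> T" "h d = h t" by (elim imageE IntE) simp
      have "h (d \<ominus>\<^bsub>S\<^esub> t) = \<zero>\<^bsub>\<pi>\<^esub>"
        using h.hom_eq_iff[OF dS S.subrepD(6)[OF T t(2)]] t(3) by simp
      then have "d \<ominus>\<^bsub>S\<^esub> t = \<zero>\<^bsub>S\<^esub>" by (rule D_inj[OF h(1) S.subrep_minus[OF D_subrep d t(1)]])
      then have "d = t" using S.minus_eq_zero_iff[OF dS S.subrepD(6)[OF T t(2)]] by simp
      then show "d \<in> T" using t(2) by simp
    qed
    then show False using h(2) by simp
  qed
  then have "D h \<inter> T = {\<zero>\<^bsub>S\<^esub>}" using S.subrepD(2)[OF DT] by blast
  moreover have "D h \<noteq> {\<zero>\<^bsub>S\<^esub>}"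
    using h(2) S.subrepD(2)[OF T] by auto
  ultimately show ?thesis using D_subrep by blast
qed

text \<open>If \<open>C\<close> + \<open>U\<close> is not everything, there is a nonzero
  \<open>D\<close> that meets \<open>C\<close> + \<open>U\<close> in zero. Then \<open>C\<close> +
  \<open>D\<close> is larger than \<open>C\<close> and still meets \<open>U\<close> in zero.\<close>

lemma (in lc_group) separated_complement:
  assumes S: "smooth_rep G X S" and adm: "admissible_rep G X \<pi>" and irr: "smooth_irrep G X \<pi>"
    and sep: "separated G \<pi> S" and U: "subrep G S U"
  obtains C where "subrep G S C" "C \<inter> U = {\<zero>\<^bsub>S\<^esub>}" "sum_set S C U = carrier S"
proof -
  interpret S: complex_rep G S by (rule smooth_repD(1)[OF S])
  show ?thesis
  proof (rule S.maximal_complement[OF U S.subrep_zero])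
    show "{\<zero>\<^bsub>S\<^esub>} \<subseteq> U" using S.subrepD(2)[OF U] by simp
  next
    fix C x assume C: "subrep G S C" "C \<inter> U = {\<zero>\<^bsub>S\<^esub>}" and x: "x \<in> carrier S" "x \<notin> sum_set S C U"
    let ?T = "sum_set S C U"
    note T = S.subrep_sum[OF C(1) U]
    obtain D where D: "subrep G S D" "D \<inter> ?T = {\<zero>\<^bsub>S\<^esub>}" "D \<noteq> {\<zero>\<^bsub>S\<^esub>}"
      using exists_disjoint_subrep[OF S adm irr sep T(1) x] by (elim exE conjE)
    note CD = S.subrep_sum[OF C(1) D(1)]
    have zero: "v = \<zero>\<^bsub>S\<^esub>" if v: "v \<in> sum_set S C D" "v \<in> U" for v
    proof -
      obtain c d where cd: "c \<in> C" "d \<in> D" "v = c \<oplus>\<^bsub>S\<^esub> d" using v(1) by blast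
      have dS: "d \<in> carrier S" by (rule S.subrepD(6)[OF D(1) cd(2)])
      have "d \<in> ?T"
        by (rule iffD1[OF S.subrep_cancel(2)[OF T(1) dS subsetD[OF T(2) cd(1)]]])
          (use subsetD[OF T(3) v(2)] cd(3) in simp)
      then have "d \<in> D \<inter> ?T" using cd(2) by (rule IntI[rotated])
      then have "d = \<zero>\<^bsub>S\<^esub>" unfolding D(2) by simp
      then have "v = c" using cd(1,3) S.subrepD(6)[OF C(1)] by simp
      then have "v \<in> C \<inter> U" using cd(1) v(2) by simp
      then show ?thesis unfolding C(2) by simp
    qed
    have 1: "sum_set S C D \<inter> U = {\<zero>\<^bsub>S\<^esub>}"
    proof (intro equalityI subsetI)
      fix v assume "v \<in> sum_set S C D \<inter> U"
      then have "v = \<zero>\<^bsub>S\<^esub>" by (elim IntE) (rule zero)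
      then show "v \<in> {\<zero>\<^bsub>S\<^esub>}" by (rule iffD2[OF singleton_iff])
    next
      fix v assume "v \<in> {\<zero>\<^bsub>S\<^esub>}"
      then have "v = \<zero>\<^bsub>S\<^esub>" by (rule singletonD)
      then show "v \<in> sum_set S C D \<inter> U"
        using IntI[OF S.subrepD(2)[OF CD(1)] S.subrepD(2)[OF U]] by (rule ssubst)
    qed
    have 2: "C \<noteq> sum_set S C D"
    proof
      assume "C = sum_set S C D"
      then have "D \<subseteq> C" using CD(3) by simp
      then have "D \<subseteq> ?T" using T(2) by (rule subset_trans)
      then have "D = {\<zero>\<^bsub>S\<^esub>}" using D(2) by (simp only: Int_absorb2)
      with D(3) show False by (rule notE)
    qed
    show "\<exists>D. subrep G S D \<and> D \<inter> U = {\<zero>\<^bsub>S\<^esub>} \<and> C \<subset> D"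
      by (intro exI[of _ "sum_set S C D"] conjI psubsetI CD 1 2)
  qed (rule that)
qed

section \<open>Lifting and exactness of Hom(\<pi>, -)\<close>

text \<open>On a complement \<open>D\<close> of ker \<open>h\<close> inside \<open>T\<close>, the
  map \<open>h\<close> is injective with the same image as on \<open>T\<close>, and its inverse
  there is composed with \<open>\<psi>\<close>. The subrepresentation \<open>T\<close> is a
  parameter so that a lift can be forced into a kernel.\<close>

lemma (in lc_group) separated_lift:
  assumes S: "smooth_rep G X S" and adm: "admissible_rep G X \<pi>" and irr: "smooth_irrep G X \<pi>"
    and sep: "separated G \<pi> S" and R: "complex_rep G R" and T: "subrep G S T"
    and h: "h \<in> rep_hom G S R" and \<psi>: "\<psi> \<in> rep_hom G W R" and im: "\<psi> ` carrier W \<subseteq> h ` T"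
  shows "\<exists>\<theta>\<in>rep_hom G W S. \<forall>v\<in>carrier W. \<theta> v \<in> T \<and> h (\<theta> v) = \<psi> v"
proof -
  interpret S: complex_rep G S by (rule smooth_repD(1)[OF S])
  interpret R: complex_rep G R by (rule R)
  interpret h: rep_homomorphism G S R h
    by (intro rep_homomorphism.intro rep_homomorphism_axioms.intro h
        S.complex_rep_axioms R.complex_rep_axioms)
  let ?K = "T \<inter> {x \<in> carrier S. h x = \<zero>\<^bsub>R\<^esub>}"
  have K: "subrep G S ?K" by (rule S.subrep_Int[OF T h.subrep_kernel])
  obtain C where C: "subrep G S C" "C \<inter> ?K = {\<zero>\<^bsub>S\<^esub>}" "sum_set S C ?K = carrier S"
    by (rule separated_complement[OF S adm irr sep K])
  \<comment> \<open>By the modular law, intersecting with \<open>T\<close> turns a complement of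
    \<open>?K\<close> in \<open>S\<close> into a complement of \<open>?K\<close> in
    \<open>T\<close>, because \<open>?K\<close> lies in \<open>T\<close>.\<close>
  define D where "D = C \<inter> T"
  have D: "subrep G S D" unfolding D_def by (rule S.subrep_Int[OF C(1) T])
  have hD: "h ` T \<subseteq> h ` D"
  proof (intro image_subsetI)
    fix t assume t: "t \<in> T"
    have tS: "t \<in> carrier S" by (rule S.subrepD(6)[OF T t])
    then have "t \<in> sum_set S C ?K" unfolding C(3) .
    then obtain c k where ck: "c \<in> C" "k \<in> T" "k \<in> carrier S" "h k = \<zero>\<^bsub>R\<^esub>" "t = c \<oplus>\<^bsub>S\<^esub> k" by blast
    have cS: "c \<in> carrier S" by (rule S.subrepD(6)[OF C(1) ck(1)])
    have "c \<in> T" using S.subrep_cancel(1)[OF T cS ck(2)] t ck(5) by simp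
    then have "c \<in> D" using ck(1) by (simp add: D_def)
    moreover have "h t = h c" using ck cS h.hom_closed[OF cS] by (simp add: h.hom_add)
    ultimately show "h t \<in> h ` D" by simp
  qed
  have D_inj: "v = \<zero>\<^bsub>S\<^esub>" if "v \<in> D" "h v = \<zero>\<^bsub>R\<^esub>" for v
  proof -
    have "v \<in> C \<inter> ?K" using that S.subrepD(6)[OF D] by (simp add: D_def)
    then show ?thesis unfolding C(2) by simp
  qed
  have hDs: "subrep G R (h ` D)" by (rule h.subrep_image[OF D])
  have "h \<in> rep_hom G (restrict_rep S D) (restrict_rep R (h ` D))"
    by (rule rep_hom_into[OF rep_hom_subset[OF h S.subrepD(1)[OF D]]]) simp
  moreover have "(\<lambda>x. x) \<in> rep_hom G (restrict_rep S D) S"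
    by (rule rep_hom_subset[OF rep_hom_id S.subrepD(1)[OF D]])
  ultimately obtain s where s: "s \<in> rep_hom G (restrict_rep R (h ` D)) S"
    and s_eq: "\<And>x. x \<in> D \<Longrightarrow> s (h x) = x"
    using rep_hom_factor[OF S.complex_rep_restrict[OF D] R.complex_rep_restrict[OF hDs]
        S.complex_rep_axioms, of h "\<lambda>x. x"] D_inj by auto
  have "\<psi> \<in> rep_hom G W (restrict_rep R (h ` D))"
    by (rule rep_hom_into[OF \<psi> subset_trans[OF im hD]])
  then have "(\<lambda>v. s (\<psi> v)) \<in> rep_hom G W S" by (rule rep_hom_comp[OF _ s])
  moreover have "s (\<psi> v) \<in> T \<and> h (s (\<psi> v)) = \<psi> v" if v: "v \<in> carrier W" for v
  proof -
    have "\<psi> v \<in> h ` D" by (rule subsetD[OF subset_trans[OF im hD] imageI[OF v]])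
    then obtain d where d: "d \<in> D" "\<psi> v = h d" by (elim imageE)
    then show ?thesis using s_eq[OF d(1)] by (simp add: D_def)
  qed
  ultimately show ?thesis by (intro bexI[of _ "\<lambda>v. s (\<psi> v)"]) simp_all
qed

text \<open>S/U is isomorphic to a complement of \<open>U\<close>, so it inherits separation: a
  homomorphism that sees the component of \<open>y\<close> in the complement is extended by zero on
  \<open>U\<close>.\<close>

lemma (in lc_group) separated_quotient_hom:
  assumes S: "smooth_rep G X S" and adm: "admissible_rep G X \<pi>" and irr: "smooth_irrep G X \<pi>"
    and sep: "separated G \<pi> S" and U: "subrep G S U" and y: "y \<in> carrier S" "y \<notin> U"
  shows "\<exists>k\<in>rep_hom G S \<pi>. (\<forall>u\<in>U. k u = \<zero>\<^bsub>\<pi>\<^esub>) \<and> k y \<noteq> \<zero>\<^bsub>\<pi>\<^esub>"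
proof -
  have s\<pi>: "smooth_rep G X \<pi>" using adm by (simp add: admissible_rep_def)
  interpret S: complex_rep G S by (rule smooth_repD(1)[OF S])
  interpret P: complex_rep G \<pi> by (rule smooth_repD(1)[OF s\<pi>])
  obtain C where C: "subrep G S C" "C \<inter> U = {\<zero>\<^bsub>S\<^esub>}" "sum_set S C U = carrier S"
    by (rule separated_complement[OF S adm irr sep U])
  \<comment> \<open>\<open>rep_hom_glue\<close> keeps the map on the second summand and puts zero on
    the first, so the two summands are exchanged.\<close>
  have full: "sum_set S U C = carrier S"
  proof -
    have "sum_set S C U \<subseteq> sum_set S U C"
    proof
      fix v assume "v \<in> sum_set S C U"
      then obtain c u where cu: "v = c \<oplus>\<^bsub>S\<^esub> u" "c \<in> C" "u \<in> U" by blast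
      have "v = u \<oplus>\<^bsub>S\<^esub> c"
        using cu S.M.a_comm[OF S.subrepD(6)[OF C(1) cu(2)] S.subrepD(6)[OF U cu(3)]] by simp
      then show "v \<in> sum_set S U C" using cu by blast
    qed
    then show ?thesis
      using S.subrepD(1)[OF S.subrep_sum(1)[OF U C(1)]] unfolding C(3) by (rule equalityI[rotated])
  qed
  have "y \<in> sum_set S U C" unfolding full by (rule y(1))
  then obtain u c where uc: "y = u \<oplus>\<^bsub>S\<^esub> c" "u \<in> U" "c \<in> C" by blast
  have cl: "u \<in> carrier S" "c \<in> carrier S" using S.subrepD(6)[OF U uc(2)] S.subrepD(6)[OF C(1) uc(3)] .
  have "c \<noteq> \<zero>\<^bsub>S\<^esub>" using uc(1,2) y(2) cl by auto
  then obtain h where h: "h \<in> rep_hom G S \<pi>" "h c \<noteq> \<zero>\<^bsub>\<pi>\<^esub>"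
    using sep cl(2) unfolding separated_def by blast
  interpret h: rep_homomorphism G S \<pi> h
    by (intro rep_homomorphism.intro rep_homomorphism_axioms.intro h
        S.complex_rep_axioms P.complex_rep_axioms)
  have "h v = \<zero>\<^bsub>\<pi>\<^esub>" if "v \<in> U" "v \<in> C" for v
  proof -
    have "v \<in> C \<inter> U" using that by simp
    then have "v = \<zero>\<^bsub>S\<^esub>" unfolding C(2) by simp
    then show ?thesis by (simp add: h.hom_zero)
  qed
  note glue = rep_hom_glue[OF S.complex_rep_axioms P.complex_rep_axioms U C(1)
      rep_hom_subset[OF h(1) S.subrepD(1)[OF C(1)]] this]
  obtain k where k: "k \<in> rep_hom G (restrict_rep S (sum_set S U C)) \<pi>"
    and kC: "\<And>v. v \<in> C \<Longrightarrow> k v = h v" and kU: "\<And>v. v \<in> U \<Longrightarrow> k v = \<zero>\<^bsub>\<pi>\<^esub>"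
    by (rule glue) blast+
  have k': "k \<in> rep_hom G S \<pi>" using k unfolding full by simp
  have "k y = h c"
    using rep_homD(2)[OF k' cl] uc kC[OF uc(3)] kU[OF uc(2)] h.hom_closed[OF cl(2)] by simp
  then show ?thesis using k' kU h(2) by (intro bexI[of _ k]) simp_all
qed

text \<open>Homomorphisms are taken extensional to match the carrier of \<^const>\<open>stalk\<close>.\<close>

lemma (in lc_group) exact_iff_hom_exact:
  assumes S1: "smooth_rep G X S1" and S2: "smooth_rep G X S2" and S3: "smooth_rep G X S3"
    and sep1: "separated G \<pi> S1" and sep2: "separated G \<pi> S2" and sep3: "separated G \<pi> S3"
    and adm: "admissible_rep G X \<pi>" and irr: "smooth_irrep G X \<pi>"
    and f: "f \<in> rep_hom G S1 S2" and g: "g \<in> rep_hom G S2 S3"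
  shows "f ` carrier S1 = {x \<in> carrier S2. g x = \<zero>\<^bsub>S3\<^esub>} \<longleftrightarrow>
    (\<lambda>\<phi>. \<lambda>v\<in>carrier \<pi>. f (\<phi> v)) ` (rep_hom G \<pi> S1 \<inter> extensional (carrier \<pi>)) =
      {\<psi> \<in> rep_hom G \<pi> S2 \<inter> extensional (carrier \<pi>).
        (\<lambda>v\<in>carrier \<pi>. g (\<psi> v)) = (\<lambda>v\<in>carrier \<pi>. \<zero>\<^bsub>S3\<^esub>)}" (is "?L \<longleftrightarrow> ?A = ?B")
proof -
  have s\<pi>: "smooth_rep G X \<pi>" using adm by (simp add: admissible_rep_def)
  interpret S1: complex_rep G S1 by (rule smooth_repD(1)[OF S1])
  interpret S2: complex_rep G S2 by (rule smooth_repD(1)[OF S2])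
  interpret S3: complex_rep G S3 by (rule smooth_repD(1)[OF S3])
  interpret P: complex_rep G \<pi> by (rule smooth_repD(1)[OF s\<pi>])
  interpret f: rep_homomorphism G S1 S2 f
    by (intro rep_homomorphism.intro rep_homomorphism_axioms.intro f
        S1.complex_rep_axioms S2.complex_rep_axioms)
  interpret g: rep_homomorphism G S2 S3 g
    by (intro rep_homomorphism.intro rep_homomorphism_axioms.intro g
        S2.complex_rep_axioms S3.complex_rep_axioms)
  have restr: "restrict \<psi> (carrier \<pi>) \<in> rep_hom G \<pi> S2 \<inter> extensional (carrier \<pi>)"
    if "\<psi> \<in> rep_hom G \<pi> S2" for \<psi>
    using rep_hom_cong[OF P.complex_rep_axioms that, of "restrict \<psi> (carrier \<pi>)"] by simp
  have B_iff: "\<psi> \<in> ?B \<longleftrightarrow> \<psi> \<in> rep_hom G \<pi> S2 \<inter> extensional (carrier \<pi>) \<and>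
      (\<forall>v\<in>carrier \<pi>. g (\<psi> v) = \<zero>\<^bsub>S3\<^esub>)" for \<psi>
    by (auto simp: fun_eq_iff restrict_def)
  show ?thesis
  proof
    assume L: ?L
    show "?A = ?B"
    proof (intro equalityI subsetI)
      fix \<psi> assume "\<psi> \<in> ?A"
      then obtain \<phi> where \<phi>: "\<phi> \<in> rep_hom G \<pi> S1" "\<psi> = (\<lambda>v\<in>carrier \<pi>. f (\<phi> v))"
        by (elim imageE IntE)
      have "g (f x) = \<zero>\<^bsub>S3\<^esub>" if "x \<in> carrier S1" for x
      proof -
        have "f x \<in> {x \<in> carrier S2. g x = \<zero>\<^bsub>S3\<^esub>}" unfolding L[symmetric] by (rule imageI[OF that])
        then show ?thesis by simp
      qed
      then show "\<psi> \<in> ?B"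
        unfolding B_iff \<phi>(2)
        using restr[OF rep_hom_comp[OF \<phi>(1) f]] rep_homD(1)[OF \<phi>(1)] by simp
    next
      fix \<psi> assume "\<psi> \<in> ?B"
      then have \<psi>: "\<psi> \<in> rep_hom G \<pi> S2" "\<psi> \<in> extensional (carrier \<pi>)"
        and g0: "\<And>v. v \<in> carrier \<pi> \<Longrightarrow> g (\<psi> v) = \<zero>\<^bsub>S3\<^esub>" unfolding B_iff by simp_all
      \<comment> \<open>A map killed by \<open>g\<close> takes values in the image of
        \<open>f\<close>, and semisimplicity of \<open>S1\<close> lifts it along
        \<open>f\<close>.\<close>
      have "\<psi> ` carrier \<pi> \<subseteq> f ` carrier S1"
        unfolding L using rep_homD(1)[OF \<psi>(1)] g0 by (intro image_subsetI) simp
      then obtain \<theta> where \<theta>: "\<theta> \<in> rep_hom G \<pi> S1" "\<And>v. v \<in> carrier \<pi> \<Longrightarrow> f (\<theta> v) = \<psi> v"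
        using separated_lift[OF S1 adm irr sep1 S2.complex_rep_axioms S1.subrep_carrier f \<psi>(1)] by blast
      have "\<psi> = (\<lambda>v\<in>carrier \<pi>. f (restrict \<theta> (carrier \<pi>) v))"
        using \<theta>(2) \<psi>(2) by (intro extensionalityI[of _ "carrier \<pi>"]) simp_all
      moreover have "restrict \<theta> (carrier \<pi>) \<in> rep_hom G \<pi> S1 \<inter> extensional (carrier \<pi>)"
        using rep_hom_cong[OF P.complex_rep_axioms \<theta>(1), of "restrict \<theta> (carrier \<pi>)"] by simp
      ultimately show "\<psi> \<in> ?A" by (rule image_eqI)
    qed
  next
    assume AB: "?A = ?B"
    have gf: "g (f s) = \<zero>\<^bsub>S3\<^esub>" if s: "s \<in> carrier S1" for s
    proof (rule ccontr)
      assume "g (f s) \<noteq> \<zero>\<^bsub>S3\<^esub>"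
      moreover have "g (f s) \<in> carrier S3" by (intro g.hom_closed f.hom_closed s)
      ultimately obtain h where h: "h \<in> rep_hom G S3 \<pi>" "h (g (f s)) \<noteq> \<zero>\<^bsub>\<pi>\<^esub>"
        using sep3 unfolding separated_def by blast
      interpret h: rep_homomorphism G S3 \<pi> h
        by (intro rep_homomorphism.intro rep_homomorphism_axioms.intro h
            S3.complex_rep_axioms P.complex_rep_axioms)
      \<comment> \<open>The composite \<open>?H\<close> is onto \<pi>, so the identity of \<pi>
        lifts to \<open>\<theta>\<close> with \<open>?H\<close> after \<open>\<theta>\<close> the
        identity. But f after \<open>\<theta>\<close> belongs to \<open>?A\<close>, hence to
        \<open>?B\<close>, and is killed by \<open>g\<close>.\<close>
      let ?H = "\<lambda>x. h (g (f x))"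
      have H: "?H \<in> rep_hom G S1 \<pi>" by (rule rep_hom_comp[OF rep_hom_comp[OF f g] h(1)])
      have "?H ` carrier S1 = carrier \<pi>"
        by (rule smooth_irrep_image[OF irr S1.complex_rep_axioms H s h(2)])
      then have "(\<lambda>x. x) ` carrier \<pi> \<subseteq> ?H ` carrier S1" by simp
      then obtain \<theta> where \<theta>: "\<theta> \<in> rep_hom G \<pi> S1" "\<And>v. v \<in> carrier \<pi> \<Longrightarrow> ?H (\<theta> v) = v"
        using separated_lift[OF S1 adm irr sep1 P.complex_rep_axioms S1.subrep_carrier H rep_hom_id]
        by blast
      have "restrict \<theta> (carrier \<pi>) \<in> rep_hom G \<pi> S1 \<inter> extensional (carrier \<pi>)"
        using rep_hom_cong[OF P.complex_rep_axioms \<theta>(1), of "restrict \<theta> (carrier \<pi>)"] by simp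
      then have "(\<lambda>v\<in>carrier \<pi>. f (restrict \<theta> (carrier \<pi>) v)) \<in> ?A" by (rule imageI)
      then have 0: "\<And>v. v \<in> carrier \<pi> \<Longrightarrow> g (f (\<theta> v)) = \<zero>\<^bsub>S3\<^esub>" unfolding AB B_iff by simp
      have "?H s \<in> carrier \<pi>" by (rule rep_homD(1)[OF H s])
      from \<theta>(2)[OF this] 0[OF this] show False using h(2) by (simp add: h.hom_zero)
    qed
    have "y \<in> f ` carrier S1" if y: "y \<in> carrier S2" "g y = \<zero>\<^bsub>S3\<^esub>" for y
    proof (rule ccontr)
      assume neg: "y \<notin> f ` carrier S1"
      obtain k where k: "k \<in> rep_hom G S2 \<pi>" "\<And>u. u \<in> f ` carrier S1 \<Longrightarrow> k u = \<zero>\<^bsub>\<pi>\<^esub>" "k y \<noteq> \<zero>\<^bsub>\<pi>\<^esub>"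
        using separated_quotient_hom[OF S2 adm irr sep2 f.subrep_image[OF S1.subrep_carrier] y(1) neg]
        by blast
      \<comment> \<open>As \<open>k\<close> maps the kernel of \<open>g\<close> onto \<pi>, the
        identity of \<pi> lifts to \<open>\<theta>\<close> with values in that kernel. Then
        \<open>\<theta>\<close> belongs to \<open>?B\<close>, hence to \<open>?A\<close>, so its
        values lie in the image of \<open>f\<close>, which \<open>k\<close> kills; yet
        \<open>k\<close> after \<open>\<theta>\<close> is the identity.\<close>
      let ?T = "{x \<in> carrier S2. g x = \<zero>\<^bsub>S3\<^esub>}"
      have T: "subrep G S2 ?T" by (rule g.subrep_kernel)
      have "k ` ?T = carrier \<pi>"
        using smooth_irrep_image[OF irr S2.complex_rep_restrict[OF T]
            rep_hom_subset[OF k(1) S2.subrepD(1)[OF T]], of y] y k(3) by simp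
      then have "(\<lambda>x. x) ` carrier \<pi> \<subseteq> k ` ?T" by simp
      then obtain \<theta> where \<theta>: "\<theta> \<in> rep_hom G \<pi> S2"
        "\<And>v. v \<in> carrier \<pi> \<Longrightarrow> \<theta> v \<in> ?T \<and> k (\<theta> v) = v"
        using separated_lift[OF S2 adm irr sep2 P.complex_rep_axioms T k(1) rep_hom_id] by blast
      have "restrict \<theta> (carrier \<pi>) \<in> ?A"
        unfolding AB B_iff using restr[OF \<theta>(1)] \<theta>(2) by simp
      then obtain \<phi> where \<phi>: "\<phi> \<in> rep_hom G \<pi> S1"
        "restrict \<theta> (carrier \<pi>) = (\<lambda>v\<in>carrier \<pi>. f (\<phi> v))" by (elim imageE IntE)
      have ky: "k y \<in> carrier \<pi>" by (rule rep_homD(1)[OF k(1) y(1)])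
      have "\<theta> (k y) = f (\<phi> (k y))" using fun_cong[OF \<phi>(2), of "k y"] ky by simp
      then have "\<theta> (k y) \<in> f ` carrier S1" using rep_homD(1)[OF \<phi>(1) ky] by (metis imageI)
      then have "k (\<theta> (k y)) = \<zero>\<^bsub>\<pi>\<^esub>" by (rule k(2))
      then show False using \<theta>(2)[OF ky] k(3) by simp
    qed
    then show ?L using gf f.hom_closed by (intro equalityI subsetI) auto
  qed
qed


section \<open>Isotypic quotients and stalks\<close>

text \<open>The zero map makes the family of kernels nonempty, so that their intersection stays
  inside \<open>carrier M\<close>.\<close>

lemma common_kernel_iff:
  assumes M: "complex_rep G M" and \<pi>: "complex_rep G \<pi>"
  shows "x \<in> common_kernel G M \<pi> \<longleftrightarrow> x \<in> carrier M \<and> (\<forall>h\<in>rep_hom G M \<pi>. h x = \<zero>\<^bsub>\<pi>\<^esub>)"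
proof -
  interpret P: complex_rep G \<pi> by (rule \<pi>)
  have "(\<lambda>_. \<zero>\<^bsub>\<pi>\<^esub>) \<in> rep_hom G M \<pi>" by (rule rep_homI) (simp_all add: P.act_zero)
  then show ?thesis by (auto simp: common_kernel_def a_kernel_def')
qed

lemma subrep_common_kernel:
  assumes M: "complex_rep G M" and \<pi>: "complex_rep G \<pi>"
  shows "subrep G M (common_kernel G M \<pi>)"
proof -
  interpret M: complex_rep G M by (rule M)
  have "subrep G M (\<Inter>(insert (carrier M) ((\<lambda>h. {x \<in> carrier M. h x = \<zero>\<^bsub>\<pi>\<^esub>}) ` rep_hom G M \<pi>)))"
  proof (rule M.subrep_Inter)
    fix Z assume "Z \<in> insert (carrier M) ((\<lambda>h. {x \<in> carrier M. h x = \<zero>\<^bsub>\<pi>\<^esub>}) ` rep_hom G M \<pi>)"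
    then consider "Z = carrier M" | h where "h \<in> rep_hom G M \<pi>" "Z = {x \<in> carrier M. h x = \<zero>\<^bsub>\<pi>\<^esub>}" by blast
    then show "subrep G M Z"
    proof cases
      case (2 h)
      then interpret h: rep_homomorphism G M \<pi> h
        by (intro rep_homomorphism.intro rep_homomorphism_axioms.intro M \<pi>)
      show ?thesis using h.subrep_kernel 2(2) by simp
    qed (simp add: M.subrep_carrier)
  qed simp
  moreover have "\<Inter>(insert (carrier M) ((\<lambda>h. {x \<in> carrier M. h x = \<zero>\<^bsub>\<pi>\<^esub>}) ` rep_hom G M \<pi>)) =
      common_kernel G M \<pi>"
    by (auto simp: common_kernel_iff[OF M \<pi>])
  ultimately show ?thesis by simp
qed

text \<open>A homomorphism to \<pi> that does not vanish at a representative kills the common kernel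
  and hence descends to the quotient.\<close>

lemma separated_isotypic_quot:
  assumes M: "complex_rep G M" and \<pi>: "complex_rep G \<pi>"
  shows "separated G \<pi> (isotypic_quot G M \<pi>)"
  unfolding separated_def isotypic_quot_def
proof (intro ballI impI)
  interpret M: complex_rep G M by (rule M)
  let ?I = "common_kernel G M \<pi>"
  note I = subrep_common_kernel[OF M \<pi>]
  fix s assume s: "s \<in> carrier (quot_rep M ?I)" "s \<noteq> \<zero>\<^bsub>quot_rep M ?I\<^esub>"
  then obtain x where x: "x \<in> carrier M" "s = ?I +>\<^bsub>M\<^esub> x" by (auto simp: M.quot_rep_simps[OF I])
  then have "x \<notin> ?I" using s(2) M.quot_eq_zero_iff[OF I x(1)] by simp
  then obtain h where h: "h \<in> rep_hom G M \<pi>" "h x \<noteq> \<zero>\<^bsub>\<pi>\<^esub>"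
    using x(1) by (auto simp: common_kernel_iff[OF M \<pi>])
  obtain k where "k \<in> rep_hom G (quot_rep M ?I) \<pi>" "\<And>y. y \<in> carrier M \<Longrightarrow> k (?I +>\<^bsub>M\<^esub> y) = h y"
  proof (rule rep_hom_factor[OF M M.complex_rep_quot[OF I] \<pi> M.quot_hom[OF I] _ h(1)])
    show "(\<lambda>v. ?I +>\<^bsub>M\<^esub> v) ` carrier M = carrier (quot_rep M ?I)" by (simp add: M.quot_rep_simps[OF I])
    show "h y = \<zero>\<^bsub>\<pi>\<^esub>" if "y \<in> carrier M" "?I +>\<^bsub>M\<^esub> y = \<zero>\<^bsub>quot_rep M ?I\<^esub>" for y
      using that h(1) M.quot_eq_zero_iff[OF I that(1)] by (simp add: common_kernel_iff[OF M \<pi>])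
  qed blast
  then show "\<exists>h\<in>rep_hom G (quot_rep M ?I) \<pi>. h s \<noteq> \<zero>\<^bsub>\<pi>\<^esub>" using h(2) x by metis
qed

text \<open>\<open>f\<close> carries common kernel to common kernel, because every h : N -> \<pi>
  composed with \<open>f\<close> is a homomorphism on \<open>M\<close>. This makes the union in the
  definition a single coset.\<close>

lemma isotypic_quot_map_coset:
  assumes M: "complex_rep G M" and N: "complex_rep G N" and \<pi>: "complex_rep G \<pi>"
    and f: "f \<in> rep_hom G M N" and x: "x \<in> carrier M"
  shows "isotypic_quot_map G \<pi> N f (common_kernel G M \<pi> +>\<^bsub>M\<^esub> x) = common_kernel G N \<pi> +>\<^bsub>N\<^esub> f x"
proof -
  interpret M: complex_rep G M by (rule M)
  interpret N: complex_rep G N by (rule N)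
  interpret f: rep_homomorphism G M N f
    by (intro rep_homomorphism.intro rep_homomorphism_axioms.intro M N f)
  note I = subrep_common_kernel[OF M \<pi>] and J = subrep_common_kernel[OF N \<pi>]
  show ?thesis
    unfolding isotypic_quot_map_def
  proof (rule M.coset_Union[OF I x])
    fix y assume y: "y \<in> carrier M" "y \<ominus>\<^bsub>M\<^esub> x \<in> common_kernel G M \<pi>"
    have "f (y \<ominus>\<^bsub>M\<^esub> x) \<in> common_kernel G N \<pi>"
      unfolding common_kernel_iff[OF N \<pi>]
    proof (intro conjI ballI)
      have z: "y \<ominus>\<^bsub>M\<^esub> x \<in> carrier M"
        and k0: "\<forall>k\<in>rep_hom G M \<pi>. k (y \<ominus>\<^bsub>M\<^esub> x) = \<zero>\<^bsub>\<pi>\<^esub>"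
        using y(2) by (simp_all add: common_kernel_iff[OF M \<pi>])
      show "f (y \<ominus>\<^bsub>M\<^esub> x) \<in> carrier N" by (rule f.hom_closed[OF z])
      show "h (f (y \<ominus>\<^bsub>M\<^esub> x)) = \<zero>\<^bsub>\<pi>\<^esub>" if "h \<in> rep_hom G N \<pi>" for h
        using bspec[OF k0 rep_hom_comp[OF f that]] .
    qed
    then show "common_kernel G N \<pi> +>\<^bsub>N\<^esub> f y = common_kernel G N \<pi> +>\<^bsub>N\<^esub> f x"
      using x y(1) by (simp add: N.coset_eq_iff[OF J] f.hom_closed f.hom_minus)
  qed
qed

lemma isotypic_quot_map_hom:
  assumes M: "complex_rep G M" and N: "complex_rep G N" and \<pi>: "complex_rep G \<pi>"
    and f: "f \<in> rep_hom G M N"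
  shows "isotypic_quot_map G \<pi> N f \<in> rep_hom G (isotypic_quot G M \<pi>) (isotypic_quot G N \<pi>)"
proof -
  interpret M: complex_rep G M by (rule M)
  interpret N: complex_rep G N by (rule N)
  interpret f: rep_homomorphism G M N f
    by (intro rep_homomorphism.intro rep_homomorphism_axioms.intro M N f)
  note I = subrep_common_kernel[OF M \<pi>] and J = subrep_common_kernel[OF N \<pi>]
  note [simp] = M.quot_rep_simps[OF I] N.quot_rep_simps[OF J] isotypic_quot_map_coset[OF M N \<pi> f]
    f.hom_closed f.hom_add f.hom_smult f.hom_act M.act_closed
  show ?thesis
    unfolding isotypic_quot_def by (rule rep_homI) auto
qed

text \<open>The isotypic quotients are separated, so Hom(\<pi>, -) preserves and detects exactness
  there. The outcome is phrased with cosets of vectors of \<open>N\<close>, the form in which it can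
  be compared with the original sequence.\<close>

lemma (in lc_group) stalk_exact_iff:
  assumes tame: "tame G X" and M: "smooth_rep G X M" and N: "smooth_rep G X N" and P: "smooth_rep G X P"
    and f: "f \<in> rep_hom G M N" and g: "g \<in> rep_hom G N P" and \<pi>: "\<pi> \<in> smooth_dual G X"
  shows "exact_at (stalk G \<pi> M) (stalk_map G \<pi> N f) (stalk G \<pi> N) (stalk_map G \<pi> P g) (stalk G \<pi> P) \<longleftrightarrow>
    (\<lambda>x. common_kernel G N \<pi> +>\<^bsub>N\<^esub> f x) ` carrier M =
      (\<lambda>y. common_kernel G N \<pi> +>\<^bsub>N\<^esub> y) ` {y \<in> carrier N. g y \<in> common_kernel G P \<pi>}"
proof -
  have irr: "smooth_irrep G X \<pi>" and adm: "admissible_rep G X \<pi>"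
    using \<pi> tame by (simp_all add: smooth_dual_def tame_def)
  have c\<pi>: "complex_rep G \<pi>" using adm by (simp add: admissible_rep_def smooth_rep_def)
  note cM = smooth_repD(1)[OF M] and cN = smooth_repD(1)[OF N] and cP = smooth_repD(1)[OF P]
  interpret M: complex_rep G M by (rule cM)
  interpret N: complex_rep G N by (rule cN)
  interpret P: complex_rep G P by (rule cP)
  note I = subrep_common_kernel[OF cM c\<pi>] and J = subrep_common_kernel[OF cN c\<pi>]
    and K = subrep_common_kernel[OF cP c\<pi>]
  let ?f = "isotypic_quot_map G \<pi> N f" and ?g = "isotypic_quot_map G \<pi> P g"
  let ?M = "isotypic_quot G M \<pi>" and ?N = "isotypic_quot G N \<pi>" and ?P = "isotypic_quot G P \<pi>"
  have "smooth_rep G X ?M" "smooth_rep G X ?N" "smooth_rep G X ?P"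
    unfolding isotypic_quot_def by (rule smooth_quot[OF M I] smooth_quot[OF N J] smooth_quot[OF P K])+
  then have "?f ` carrier ?M = {x \<in> carrier ?N. ?g x = \<zero>\<^bsub>?P\<^esub>} \<longleftrightarrow>
    (\<lambda>\<phi>. \<lambda>v\<in>carrier \<pi>. ?f (\<phi> v)) ` (rep_hom G \<pi> ?M \<inter> extensional (carrier \<pi>)) =
      {\<psi> \<in> rep_hom G \<pi> ?N \<inter> extensional (carrier \<pi>).
        (\<lambda>v\<in>carrier \<pi>. ?g (\<psi> v)) = (\<lambda>v\<in>carrier \<pi>. \<zero>\<^bsub>?P\<^esub>)}"
    by (rule exact_iff_hom_exact)
      (intro separated_isotypic_quot isotypic_quot_map_hom cM cN cP c\<pi> adm irr f g)+
  also have "\<dots> \<longleftrightarrow> exact_at (stalk G \<pi> M) (stalk_map G \<pi> N f) (stalk G \<pi> N) (stalk_map G \<pi> P g) (stalk G \<pi> P)"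
    by (simp add: exact_at_def a_kernel_def' stalk_def stalk_map_def[abs_def])
  finally have 1: "exact_at (stalk G \<pi> M) (stalk_map G \<pi> N f) (stalk G \<pi> N) (stalk_map G \<pi> P g) (stalk G \<pi> P)
      \<longleftrightarrow> ?f ` carrier ?M = {x \<in> carrier ?N. ?g x = \<zero>\<^bsub>?P\<^esub>}" by (rule sym)
  have 2: "?f ` carrier ?M = (\<lambda>x. common_kernel G N \<pi> +>\<^bsub>N\<^esub> f x) ` carrier M"
    by (simp add: isotypic_quot_def M.quot_rep_simps(1)[OF I] image_image
        isotypic_quot_map_coset[OF cM cN c\<pi> f])
  have "?g (common_kernel G N \<pi> +>\<^bsub>N\<^esub> y) = \<zero>\<^bsub>?P\<^esub> \<longleftrightarrow> g y \<in> common_kernel G P \<pi>" if "y \<in> carrier N" for y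
    unfolding isotypic_quot_map_coset[OF cN cP c\<pi> g that] isotypic_quot_def
    by (rule P.quot_eq_zero_iff[OF K rep_homD(1)[OF g that]])
  then have 3: "{x \<in> carrier ?N. ?g x = \<zero>\<^bsub>?P\<^esub>} =
      (\<lambda>y. common_kernel G N \<pi> +>\<^bsub>N\<^esub> y) ` {y \<in> carrier N. g y \<in> common_kernel G P \<pi>}"
    unfolding isotypic_quot_def N.quot_rep_simps(1)[OF J] by auto
  show ?thesis unfolding 1 2 3 ..
qed

section \<open>Comparison of a sequence with its isotypic quotients\<close>

text \<open>Otherwise some \<open>k\<close> on the isotypic quotient of \<open>N\<close> kills the
  image of \<open>M\<close> and sees the coset of \<open>y\<close>. On \<open>N\<close> it kills ker
  \<open>g\<close>, so it factors through the image of \<open>g\<close>, and by injectivity the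
  factor extends to \<open>P\<close>. The extension is nonzero at \<open>g y\<close>, although
  \<open>g y\<close> is in the common kernel.\<close>

lemma (in lc_group) exact_imp_isotypic_exact:
  assumes N: "smooth_rep G X N" and P: "smooth_rep G X P" and M: "complex_rep G M"
    and f: "f \<in> rep_hom G M N" and g: "g \<in> rep_hom G N P"
    and adm: "admissible_rep G X \<pi>" and irr: "smooth_irrep G X \<pi>"
    and ex: "f ` carrier M = {y \<in> carrier N. g y = \<zero>\<^bsub>P\<^esub>}"
    and y: "y \<in> carrier N" "g y \<in> common_kernel G P \<pi>"
  shows "\<exists>x\<in>carrier M. common_kernel G N \<pi> +>\<^bsub>N\<^esub> y = common_kernel G N \<pi> +>\<^bsub>N\<^esub> f x"
proof (rule ccontr)
  assume neg: "\<not> ?thesis"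
  have c\<pi>: "complex_rep G \<pi>" using adm by (simp add: admissible_rep_def smooth_rep_def)
  note cN = smooth_repD(1)[OF N] and cP = smooth_repD(1)[OF P]
  interpret N: complex_rep G N by (rule cN)
  interpret P: complex_rep G P by (rule cP)
  interpret M: complex_rep G M by (rule M)
  let ?J = "common_kernel G N \<pi>"
  note J = subrep_common_kernel[OF cN c\<pi>]
  let ?q = "\<lambda>v. ?J +>\<^bsub>N\<^esub> v" and ?Q = "quot_rep N ?J"
  interpret q: rep_homomorphism G N ?Q ?q
    by (intro rep_homomorphism.intro rep_homomorphism_axioms.intro cN N.complex_rep_quot J N.quot_hom)
  interpret g: rep_homomorphism G N P g
    by (intro rep_homomorphism.intro rep_homomorphism_axioms.intro cN cP g)
  interpret f: rep_homomorphism G M N f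
    by (intro rep_homomorphism.intro rep_homomorphism_axioms.intro M cN f)
  have U: "subrep G ?Q (?q ` f ` carrier M)"
    by (intro q.subrep_image f.subrep_image M.subrep_carrier)
  have "?q y \<notin> ?q ` f ` carrier M" using neg by auto
  then obtain k where k: "k \<in> rep_hom G ?Q \<pi>" "\<And>u. u \<in> ?q ` f ` carrier M \<Longrightarrow> k u = \<zero>\<^bsub>\<pi>\<^esub>"
    "k (?q y) \<noteq> \<zero>\<^bsub>\<pi>\<^esub>"
    using separated_quotient_hom[OF smooth_quot[OF N J] adm irr
        separated_isotypic_quot[OF cN c\<pi>, unfolded isotypic_quot_def] U q.hom_closed[OF y(1)]] by blast
  have gN: "subrep G P (g ` carrier N)" by (rule g.subrep_image[OF N.subrep_carrier])
  have ker: "k (?q n) = \<zero>\<^bsub>\<pi>\<^esub>" if "n \<in> carrier N" "g n = \<zero>\<^bsub>restrict_rep P (g ` carrier N)\<^esub>" for n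
  proof -
    have "n \<in> f ` carrier M" unfolding ex using that by simp
    then show ?thesis by (intro k(2) imageI)
  qed
  obtain k' where k': "k' \<in> rep_hom G (restrict_rep P (g ` carrier N)) \<pi>"
    "\<And>n. n \<in> carrier N \<Longrightarrow> k' (g n) = k (?q n)"
    by (rule rep_hom_factor[OF cN P.complex_rep_restrict[OF gN] c\<pi> rep_hom_into[OF g order_refl] _
        rep_hom_comp[OF q.hom k(1)] ker]) auto
  obtain h where h: "h \<in> rep_hom G P \<pi>" "\<And>u. u \<in> g ` carrier N \<Longrightarrow> h u = k' u"
    using irrep_hom_extends[OF P adm irr gN k'(1)] by blast
  have "h (g y) = k (?q y)" using h(2)[OF imageI[OF y(1)]] k'(2)[OF y(1)] by simp
  then show False using y(2) h(1) k(3) by (simp add: common_kernel_iff[OF cP c\<pi>])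
qed

theorem lemma1p7:
  fixes G :: "('g, 'b) monoid_scheme" and X :: "'g topology"
    and M :: "('g, 'm) rep" and N :: "('g, 'n) rep" and P :: "('g, 'p) rep"
    and f :: "'m \<Rightarrow> 'n" and g :: "'n \<Rightarrow> 'p"
  assumes "lc_group G X" and "tame G X"
    and "smooth_rep G X M" and "smooth_rep G X N" and "smooth_rep G X P"
    and "f \<in> rep_hom G M N" and "g \<in> rep_hom G N P"
  shows "exact_at M f N g P \<longleftrightarrow>
    (\<forall>\<pi>\<in>smooth_dual G X.
      exact_at (stalk G \<pi> M) (stalk_map G \<pi> N f) (stalk G \<pi> N) (stalk_map G \<pi> P g) (stalk G \<pi> P))"
proof -
  interpret lc_group G X by fact
  note tame = assms(2) and M = assms(3) and N = assms(4) and P = assms(5) and f = assms(6) and g = assms(7)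
  note cM = smooth_repD(1)[OF M] and cN = smooth_repD(1)[OF N] and cP = smooth_repD(1)[OF P]
  interpret M: complex_rep G M by (rule cM)
  interpret N: complex_rep G N by (rule cN)
  interpret P: complex_rep G P by (rule cP)
  interpret f: rep_homomorphism G M N f
    by (intro rep_homomorphism.intro rep_homomorphism_axioms.intro cM cN f)
  interpret g: rep_homomorphism G N P g
    by (intro rep_homomorphism.intro rep_homomorphism_axioms.intro cN cP g)
  have ex: "exact_at M f N g P \<longleftrightarrow> f ` carrier M = {y \<in> carrier N. g y = \<zero>\<^bsub>P\<^esub>}"
    by (simp add: exact_at_def a_kernel_def')
  have dual: "smooth_irrep G X \<pi>" "admissible_rep G X \<pi>" "complex_rep G \<pi>"
    if "\<pi> \<in> smooth_dual G X" for \<pi>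
    using that tame by (auto simp: smooth_dual_def tame_def admissible_rep_def smooth_rep_def)
  let ?J = "common_kernel G N" and ?K = "common_kernel G P"
  \<comment> \<open>Exactness of the isotypic sequence at \<pi>, in the form supplied by
    \<open>stalk_exact_iff\<close>.\<close>
  let ?E = "\<lambda>\<pi>. (\<lambda>x. ?J \<pi> +>\<^bsub>N\<^esub> f x) ` carrier M = (\<lambda>y. ?J \<pi> +>\<^bsub>N\<^esub> y) ` {y \<in> carrier N. g y \<in> ?K \<pi>}"
  have "f ` carrier M = {y \<in> carrier N. g y = \<zero>\<^bsub>P\<^esub>} \<longleftrightarrow> (\<forall>\<pi>\<in>smooth_dual G X. ?E \<pi>)"
  proof
    assume eq: "f ` carrier M = {y \<in> carrier N. g y = \<zero>\<^bsub>P\<^esub>}"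
    show "\<forall>\<pi>\<in>smooth_dual G X. ?E \<pi>"
    proof (intro ballI equalityI image_subsetI)
      fix \<pi> x assume \<pi>: "\<pi> \<in> smooth_dual G X" and x: "x \<in> carrier M"
      have "f x \<in> {y \<in> carrier N. g y = \<zero>\<^bsub>P\<^esub>}" unfolding eq[symmetric] by (rule imageI[OF x])
      then have "f x \<in> {y \<in> carrier N. g y \<in> ?K \<pi>}"
        using P.subrepD(2)[OF subrep_common_kernel[OF cP dual(3)[OF \<pi>]]] by simp
      then show "?J \<pi> +>\<^bsub>N\<^esub> f x \<in> (\<lambda>y. ?J \<pi> +>\<^bsub>N\<^esub> y) ` {y \<in> carrier N. g y \<in> ?K \<pi>}" by (rule imageI)
    next
      fix \<pi> y assume \<pi>: "\<pi> \<in> smooth_dual G X" and "y \<in> {y \<in> carrier N. g y \<in> ?K \<pi>}"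
      then have y: "y \<in> carrier N" "g y \<in> ?K \<pi>" by simp_all
      show "?J \<pi> +>\<^bsub>N\<^esub> y \<in> (\<lambda>x. ?J \<pi> +>\<^bsub>N\<^esub> f x) ` carrier M"
        using exact_imp_isotypic_exact[OF N P cM f g dual(2,1)[OF \<pi>] eq y] by (rule bexE) (rule image_eqI)
    qed
  next
    assume E: "\<forall>\<pi>\<in>smooth_dual G X. ?E \<pi>"
    have gf: "g (f x) = \<zero>\<^bsub>P\<^esub>" if x: "x \<in> carrier M" for x
    proof (rule ccontr)
      assume "g (f x) \<noteq> \<zero>\<^bsub>P\<^esub>"
      then obtain \<pi> h where \<pi>: "\<pi> \<in> smooth_dual G X" and h: "h \<in> rep_hom G P \<pi>" "h (g (f x)) \<noteq> \<zero>\<^bsub>\<pi>\<^esub>"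
        using dual_separates[OF tame P P.subrep_zero g.hom_closed[OF f.hom_closed[OF x]]] by blast
      note J = subrep_common_kernel[OF cN dual(3)[OF \<pi>]]
      \<comment> \<open>Exactness at \<pi> replaces \<open>f x\<close> by some \<open>y\<close> with
        the same coset and with \<open>g y\<close> in the common kernel. Then \<open>h\<close> after
        \<open>g\<close> agrees on \<open>f x\<close> and \<open>y\<close>, and vanishes at
        \<open>y\<close>.\<close>
      have "?J \<pi> +>\<^bsub>N\<^esub> f x \<in> (\<lambda>x. ?J \<pi> +>\<^bsub>N\<^esub> f x) ` carrier M" by (rule imageI[OF x])
      then have "?J \<pi> +>\<^bsub>N\<^esub> f x \<in> (\<lambda>y. ?J \<pi> +>\<^bsub>N\<^esub> y) ` {y \<in> carrier N. g y \<in> ?K \<pi>}"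
        unfolding bspec[OF E \<pi>] .
      then obtain y where y: "y \<in> carrier N" "g y \<in> ?K \<pi>" "?J \<pi> +>\<^bsub>N\<^esub> f x = ?J \<pi> +>\<^bsub>N\<^esub> y"
        by (elim imageE CollectE conjE)
      then have "f x \<ominus>\<^bsub>N\<^esub> y \<in> ?J \<pi>" using N.coset_eq_iff[OF J f.hom_closed[OF x] y(1)] by simp
      moreover have "(\<lambda>v. h (g v)) \<in> rep_hom G N \<pi>" by (rule rep_hom_comp[OF g h(1)])
      ultimately have hg0: "h (g (f x \<ominus>\<^bsub>N\<^esub> y)) = \<zero>\<^bsub>\<pi>\<^esub>" by (auto simp: common_kernel_iff[OF cN dual(3)[OF \<pi>]])
      interpret hg: rep_homomorphism G N \<pi> "\<lambda>v. h (g v)"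
        by (intro rep_homomorphism.intro rep_homomorphism_axioms.intro cN dual(3)[OF \<pi>]
            rep_hom_comp[OF g h(1)])
      have "h (g (f x)) = h (g y)"
        using hg.hom_eq_iff[OF f.hom_closed[OF x] y(1)] hg0 by simp
      then show False using y(2) h by (simp add: common_kernel_iff[OF cP dual(3)[OF \<pi>]])
    qed
    have "y \<in> f ` carrier M" if y: "y \<in> carrier N" "g y = \<zero>\<^bsub>P\<^esub>" for y
    proof (rule ccontr)
      assume neg: "y \<notin> f ` carrier M"
      obtain \<pi> k where \<pi>: "\<pi> \<in> smooth_dual G X" and k: "k \<in> rep_hom G N \<pi>"
        "\<And>u. u \<in> f ` carrier M \<Longrightarrow> k u = \<zero>\<^bsub>\<pi>\<^esub>" "k y \<noteq> \<zero>\<^bsub>\<pi>\<^esub>"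
        using dual_separates[OF tame N f.subrep_image[OF M.subrep_carrier] y(1) neg] by blast
      note J = subrep_common_kernel[OF cN dual(3)[OF \<pi>]] and K = subrep_common_kernel[OF cP dual(3)[OF \<pi>]]
      interpret k: rep_homomorphism G N \<pi> k
        by (intro rep_homomorphism.intro rep_homomorphism_axioms.intro cN dual(3)[OF \<pi>] k)
      \<comment> \<open>Exactness at \<pi> gives \<open>x\<close> such that \<open>y\<close> and
        \<open>f x\<close> differ by an element of the common kernel. Hence \<open>k\<close> agrees
        on them, although it kills the image of \<open>f\<close> and not \<open>y\<close>.\<close>
      have "y \<in> {y \<in> carrier N. g y \<in> ?K \<pi>}" using y P.subrepD(2)[OF K] by simp
      then have "?J \<pi> +>\<^bsub>N\<^esub> y \<in> (\<lambda>y. ?J \<pi> +>\<^bsub>N\<^esub> y) ` {y \<in> carrier N. g y \<in> ?K \<pi>}" by (rule imageI)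
      then have "?J \<pi> +>\<^bsub>N\<^esub> y \<in> (\<lambda>x. ?J \<pi> +>\<^bsub>N\<^esub> f x) ` carrier M" unfolding bspec[OF E \<pi>] .
      then obtain x where x: "x \<in> carrier M" "?J \<pi> +>\<^bsub>N\<^esub> y = ?J \<pi> +>\<^bsub>N\<^esub> f x" by (elim imageE)
      then have "y \<ominus>\<^bsub>N\<^esub> f x \<in> ?J \<pi>" using N.coset_eq_iff[OF J y(1) f.hom_closed[OF x(1)]] by simp
      then have "k (y \<ominus>\<^bsub>N\<^esub> f x) = \<zero>\<^bsub>\<pi>\<^esub>" using k(1) by (simp add: common_kernel_iff[OF cN dual(3)[OF \<pi>]])
      then have "k y = k (f x)" using k.hom_eq_iff[OF y(1) f.hom_closed[OF x(1)]] by simp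
      then show False using k(2)[OF imageI[OF x(1)]] k(3) by simp
    qed
    then show "f ` carrier M = {y \<in> carrier N. g y = \<zero>\<^bsub>P\<^esub>}"
      using gf f.hom_closed by (intro equalityI subsetI) auto
  qed
  also have "\<dots> \<longleftrightarrow> (\<forall>\<pi>\<in>smooth_dual G X.
      exact_at (stalk G \<pi> M) (stalk_map G \<pi> N f) (stalk G \<pi> N) (stalk_map G \<pi> P g) (stalk G \<pi> P))"
    by (intro ball_cong refl stalk_exact_iff[symmetric] tame M N P f g)
  finally show ?thesis unfolding ex .
qed

end
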